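(* Let $(S_t)_{t\in\mathbb{R}}$ be the $C_0$-unitary group of operators associated to a skew-adjoint operator $A$ on a Hilbert space $H$, let $T>0$, and let $\varphi:[0,T]\times H\to\mathbb{R}\cup\{+\infty\}$ be a time-dependent convex, Gateaux-differentiable function on $H$. Assume: (i) for some $m,n>1$ and $C_1,C_2>0$ we have, for every $x\in L^2_H$, $$C_1(\|x\|_{L^2_H}^m-1)\le\int_0^T\{\varphi(t,x(t))+\varphi^*(t,0)\}\,dt\le C_2(1+\|x\|_{L^2_H}^n);$$ (ii) $\psi:H\to\mathbb{R}\cup\{+\infty\}$ is a bounded below convex lower semi-continuous function on $H$ with $0\in\mathrm{Dom}(\psi)$. For any given $\omega\in\mathbb{R}$, consider the following functional on $A^2_H$: $$I(x)=\int_0^T e^{-2\omega t}\{\varphi(t,e^{\omega t}S_tx(t))+\varphi^*(t,-e^{\omega t}S_t\dot x(t))\}\,dt+\psi(x(0)-x(T))+\psi^*\Big(-\frac{x(0)+x(T)}{2}\Big).$$ Then there exists a path $u\in A^2_H$ such that: 1. $I(u)=\inf_{x\in A^2_H}I(x)=0$. 2. The path $v(t):=S_te^{\omega t}u(t)$ satisfies the integral equation $$v(t)=S_tv(0)-\int_0^tS_{t-s}\big(\partial\varphi(s,v(s))-\omega v(s)\big)\,ds\quad\text{for every }t\in[0,T],$$ together with the boundary condition $$\frac{v(0)+S_{-T}e^{-\omega T}v(T)}{2}\in-\partial\psi\big(v(0)-S_{-T}e^{-\omega T}v(T)\big).$$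
   Context: $H$ is a real or complex Hilbert space with $\langle\cdot,\cdot\rangle$ the (real part of the) inner product. $L^2_H=L^2([0,T];H)$, and $A^2_H=\{u:[0,T]\to H\text{ absolutely continuous};\ \dot u\in L^2_H\}$. The $C_0$-unitary group associated to the skew-adjoint operator $A$ is the strongly continuous group of unitary operators $(S_t)_{t\in\mathbb{R}}$ whose infinitesimal generator is $A$, i.e. $Ax=\lim_{t\downarrow0}\frac{S_tx-x}{t}$ for $x\in D(A)$. Time-dependent functions $\varphi$ on $[0,T]\times H$ are assumed measurable for the $\sigma$-field generated by products of Lebesgue sets in $[0,T]$ and Borel sets in $H$. $\varphi^*(t,\cdot)$ is the Legendre–Fenchel conjugate of $\varphi(t,\cdot)$: $\varphi^*(t,p)=\sup_{x\in H}\{\langle x,p\rangle-\varphi(t,x)\}$; similarly $\psi^*$. $\partial\varphi(t,\cdot)$ denotes the subdifferential (equal to the Gateaux differential) in the $H$-variable, $\partial\psi$ the subdifferential of $\psi$, and $\mathrm{Dom}(\psi)=\{\psi<+\infty\}$.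
   Formalization: The Hilbert space H is assumed separable; without this the claim fails, e.g. for H = l^2([0,1]) with basis (e_t), T=1, S=Id, ω=0, ψ(x)=|x|^2/2 and φ(t,x)=|x|^2/2-<x,e_t>, where I(x) ≥ 1/2 for every path. *)

theory Defs
  imports "HOL-Analysis.Analysis"
begin

text \<open>
  The Hilbert space \<open>H\<close> is a type of class \<open>real_inner\<close> and \<open>complete_space\<close>; a complex Hilbert
  space is covered through the real part of its inner product, with respect to which unitary groups,
  skew-adjointness, generators, conjugates and subdifferentials are the same as for the complex
  structure.  In the result \<open>H\<close> is moreover separable (class \<open>second_countable_topology\<close>); this makes
  Borel measurability of paths the same as strong measurability.  Without separability the result
  fails: let \<open>H\<close> have an orthonormal basis \<open>e\<close> indexed by \<open>{0..1}\<close>, \<open>T = 1\<close>, \<open>S t = id\<close>, \<open>\<omega> = 0\<close> and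
  \<open>\<phi> t x = (norm x)\<^sup>2 / 2 - x \<bullet> e t\<close>.  A strongly measurable path \<open>x\<close> has \<open>x t \<bullet> e t = 0\<close> for almost
  all \<open>t\<close>, which makes the functional at least \<open>1/2\<close>.
\<close>

subsection \<open>Unitary groups and skew-adjoint operators\<close>

text \<open>An unbounded operator is given by its domain \<open>D\<close> and a function \<open>A\<close> that matters on \<open>D\<close> only.\<close>

definition adjoint_graph :: "'a::real_inner set \<Rightarrow> ('a \<Rightarrow> 'a) \<Rightarrow> ('a \<times> 'a) set" where
  "adjoint_graph D A = {(y, z). \<forall>x\<in>D. A x \<bullet> y = x \<bullet> z}"

definition skew_adjoint :: "'a::real_inner set \<Rightarrow> ('a \<Rightarrow> 'a) \<Rightarrow> bool" where
  "skew_adjoint D A \<longleftrightarrow>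
     subspace D \<and> closure D = UNIV \<and>
     (\<forall>x\<in>D. \<forall>y\<in>D. A (x + y) = A x + A y) \<and> (\<forall>c. \<forall>x\<in>D. A (c *\<^sub>R x) = c *\<^sub>R A x) \<and>
     adjoint_graph D A = {(y, - A y) |y. y \<in> D}"

definition C0_unitary_group :: "(real \<Rightarrow> 'a::real_inner \<Rightarrow> 'a) \<Rightarrow> bool" where
  "C0_unitary_group S \<longleftrightarrow>
     (\<forall>t. orthogonal_transformation (S t) \<and> surj (S t)) \<and>
     S 0 = id \<and> (\<forall>s t. S (s + t) = S s \<circ> S t) \<and>
     (\<forall>x. continuous_on UNIV (\<lambda>t. S t x))"

definition is_generator ::
  "'a::real_normed_vector set \<Rightarrow> ('a \<Rightarrow> 'a) \<Rightarrow> (real \<Rightarrow> 'a \<Rightarrow> 'a) \<Rightarrow> bool" where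
  "is_generator D A S \<longleftrightarrow>
     D = {x. \<exists>l. ((\<lambda>t. (S t x - x) /\<^sub>R t) \<longlongrightarrow> l) (at_right 0)} \<and>
     (\<forall>x\<in>D. ((\<lambda>t. (S t x - x) /\<^sub>R t) \<longlongrightarrow> A x) (at_right 0))"

subsection \<open>Extended real valued convex functions\<close>

text \<open>Convexity is only meant for functions that do not take the value \<open>-\<infinity>\<close>.  Note
  that \<open>0 * \<infinity> = 0\<close> in type \<open>ereal\<close>.\<close>

definition ereal_convex :: "('a::real_vector \<Rightarrow> ereal) \<Rightarrow> bool" where
  "ereal_convex f \<longleftrightarrow>
     (\<forall>x y. \<forall>r\<in>{0..1}. f ((1 - r) *\<^sub>R x + r *\<^sub>R y) \<le> ereal (1 - r) * f x + ereal r * f y)"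

definition ereal_lsc :: "('a::topological_space \<Rightarrow> ereal) \<Rightarrow> bool" where
  "ereal_lsc f \<longleftrightarrow> (\<forall>x. f x \<le> Liminf (at x) f)"

definition eff_domain :: "('a \<Rightarrow> ereal) \<Rightarrow> 'a set" where
  "eff_domain f = {x. f x < \<infinity>}"

definition conjugate :: "('a::real_inner \<Rightarrow> ereal) \<Rightarrow> 'a \<Rightarrow> ereal" where
  "conjugate f p = (SUP x. ereal (x \<bullet> p) - f x)"

definition subdifferential :: "('a::real_inner \<Rightarrow> ereal) \<Rightarrow> 'a \<Rightarrow> 'a set" where
  "subdifferential f x = {p. \<bar>f x\<bar> \<noteq> \<infinity> \<and> (\<forall>y. f x + ereal (p \<bullet> (y - x)) \<le> f y)}"

text \<open>The value at the point itself has to be finite, and the differential is a bounded linear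
  functional.\<close>

definition gateaux_differentiable_at ::
  "('a::real_normed_vector \<Rightarrow> ereal) \<Rightarrow> 'a \<Rightarrow> bool" where
  "gateaux_differentiable_at f x \<longleftrightarrow>
     \<bar>f x\<bar> \<noteq> \<infinity> \<and>
     (\<exists>D. bounded_linear D \<and>
        (\<forall>h. ((\<lambda>r. (f (x + r *\<^sub>R h) - f x) / ereal r) \<longlongrightarrow> ereal (D h)) (at 0)))"

subsection \<open>Integrals of extended real valued functions\<close>

text \<open>Positive part minus negative part (\<open>e2ennreal\<close> maps negative numbers to \<open>0\<close>).  In type
  \<open>ereal\<close> we have \<open>\<infinity> - \<infinity> = \<infinity>\<close>, but the negative part has a finite integral
  in all uses below, by the Fenchel-Young inequality.\<close>

definition ereal_integral :: "'b measure \<Rightarrow> ('b \<Rightarrow> ereal) \<Rightarrow> ereal" where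
  "ereal_integral M f =
     enn2ereal (\<integral>\<^sup>+t. e2ennreal (f t) \<partial>M) - enn2ereal (\<integral>\<^sup>+t. e2ennreal (- f t) \<partial>M)"

subsection \<open>Path spaces\<close>

text \<open>Paths are functions on \<open>real\<close> of which only the values on \<open>{0..T}\<close> matter.\<close>

definition L2_paths :: "real \<Rightarrow> (real \<Rightarrow> 'a::real_normed_vector) set" where
  "L2_paths T = {x. x \<in> borel_measurable (lebesgue_on {0..T}) \<and>
                    integrable (lebesgue_on {0..T}) (\<lambda>t. (norm (x t))\<^sup>2)}"

definition L2_norm :: "real \<Rightarrow> (real \<Rightarrow> 'a::real_normed_vector) \<Rightarrow> real" where
  "L2_norm T x = sqrt (\<integral>t. (norm (x t))\<^sup>2 \<partial>lebesgue_on {0..T})"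

definition abs_cont_on :: "real set \<Rightarrow> (real \<Rightarrow> 'a::real_normed_vector) \<Rightarrow> bool" where
  "abs_cont_on X f \<longleftrightarrow>
     (\<forall>e>0. \<exists>d>0. \<forall>P::(real \<times> real) set.
        finite P \<and> (\<forall>(a, b)\<in>P. a \<le> b \<and> {a..b} \<subseteq> X) \<and>
        disjoint_family_on (\<lambda>(a, b). {a<..<b}) P \<and> (\<Sum>(a, b)\<in>P. b - a) < d \<longrightarrow>
        (\<Sum>(a, b)\<in>P. norm (f b - f a)) < e)"

abbreviation path_deriv :: "real \<Rightarrow> (real \<Rightarrow> 'a::real_normed_vector) \<Rightarrow> real \<Rightarrow> 'a" where
  "path_deriv T x t \<equiv> vector_derivative x (at t within {0..T})"

text \<open>In a Hilbert space, differentiability almost everywhere follows from absolute continuity.  It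
  is stated because \<open>vector_derivative\<close> is unspecified where there is no derivative.\<close>

definition A2_paths :: "real \<Rightarrow> (real \<Rightarrow> 'a::real_normed_vector) set" where
  "A2_paths T = {x. abs_cont_on {0..T} x \<and>
                    (AE t in lebesgue_on {0..T}. x differentiable (at t within {0..T})) \<and>
                    path_deriv T x \<in> L2_paths T}"

subsection \<open>The functional\<close>

definition path_functional ::
  "real \<Rightarrow> real \<Rightarrow> (real \<Rightarrow> 'a \<Rightarrow> 'a) \<Rightarrow> (real \<Rightarrow> 'a \<Rightarrow> ereal) \<Rightarrow> ('a \<Rightarrow> ereal) \<Rightarrow>
   (real \<Rightarrow> 'a::real_inner) \<Rightarrow> ereal" where
  "path_functional T \<omega> S \<phi> \<psi> x =
     ereal_integral (lebesgue_on {0..T})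
       (\<lambda>t. ereal (exp (- 2 * \<omega> * t)) *
          (\<phi> t (exp (\<omega> * t) *\<^sub>R S t (x t)) +
           conjugate (\<phi> t) (- (exp (\<omega> * t) *\<^sub>R S t (path_deriv T x t))))) +
     \<psi> (x 0 - x T) + conjugate \<psi> (- ((x 0 + x T) /\<^sub>R 2))"

end

theory Submission
  imports Defs
begin

text \<open>
  Put \<open>u t = S (- t) (exp (- \<omega> t) v t)\<close>.  The equation for \<open>v\<close> becomes \<open>u' = - G t u\<close>, where
  \<open>G t\<close> is the gradient of the convex function \<open>x \<mapsto> exp (- 2 \<omega> t) \<phi> t (exp (\<omega> t) S t x)\<close>.  The growth
  condition on the integral functional forces the pointwise bounds
  \<open>c |x|\<^sup>2 - a t \<le> \<phi> t x - \<phi> t 0 \<le> K |x|\<^sup>2 + b t\<close> with integrable \<open>a\<close>, \<open>b\<close>.  So \<open>G t\<close> is monotone,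
  demicontinuous, of linear growth and coercive.  By monotonicity the explicit Euler paths converge
  uniformly, and the limit solves the equation for any initial value.  The flow map
  \<open>P: u 0 \<mapsto> u T\<close> is nonexpansive, and coercivity gives \<open>|P x| \<le> q |x| + M\<close> with \<open>q < 1\<close>.  The
  boundary condition is a fixed point equation for \<open>P\<close> followed by the Cayley transform of \<open>\<partial>\<psi>\<close>,
  a nonexpansive map, and is solved by letting the contraction factor tend to 1.  Finally, the
  Fenchel-Young inequality and \<open>2 \<integral>x \<bullet> x' = |x T|\<^sup>2 - |x 0|\<^sup>2\<close> show that the functional is
  nonnegative, and that it vanishes at \<open>u\<close>.
\<close>

subsection \<open>Minimization and fixed points in Hilbert spaces\<close>

text \<open>Three obstacles shape the argument. Compactness of Peano type fails in infinite
  dimension, and a Gateaux gradient is only norm-to-weak continuous; hence Euler paths have to be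
  compared with each other, and the limit equation is tested against fixed vectors. Hypothesis (i)
  says nothing about single times, and \<open>m\<close>, \<open>n\<close> may differ from 2. The
  pointwise bounds are still quadratic because \<integral>|x|^2 is additive in time: a path of
  maximizers can be cut off where its L2 norm reaches a prescribed radius, and the sign of the
  comparison is needed at that one radius only. Finally, the flow map \<open>P\<close> need not be a
  strict contraction, as \<phi> need not be strictly convex; the slope \<open>q < 1\<close> only
  bounds the approximate fixed points, whose strong convergence comes from monotonicity of the
  identity minus the map. The weight exp (- 2 \<omega> t) compensates the scaling exp (\<omega> t),
  so the Fenchel-Young bounds in time and at the boundary are opposite numbers by the energy
  identity; this is why the minimal value is exactly 0.\<close>

lemma Cauchy_if_norm_diff_square_le:
  fixes X :: "nat \<Rightarrow> 'a::real_normed_vector"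
  assumes le: "\<And>j k. (norm (X j - X k))\<^sup>2 \<le> e j + e k" and e: "e \<longlonglongrightarrow> 0"
  shows "Cauchy X"
proof (rule metric_CauchyI)
  fix r :: real assume r: "r > 0"
  then have "\<forall>\<^sub>F k in sequentially. e k < r\<^sup>2 / 2"
    using order_tendstoD(2)[OF e, of "r\<^sup>2 / 2"] by simp
  then obtain N where N: "\<And>k. k \<ge> N \<Longrightarrow> e k < r\<^sup>2 / 2"
    by (auto simp: eventually_sequentially)
  have "dist (X j) (X k) < r" if "j \<ge> N" "k \<ge> N" for j k
  proof -
    have "(norm (X j - X k))\<^sup>2 < r\<^sup>2"
      using le[of j k] N[OF that(1)] N[OF that(2)] by simp
    then show ?thesis
      using r by (simp add: dist_norm power_less_imp_less_base)
  qed
  then show "\<exists>M. \<forall>m\<ge>M. \<forall>n\<ge>M. dist (X m) (X n) < r" by blast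
qed

text \<open>The midpoint of two near-minimizers cannot go below the infimum, so the gain
  \<open>\<kappa>\<close> |x - y|^2 in the midpoint inequality forces them together: minimizing
  sequences are Cauchy. The hypotheses quantify over real upper bounds \<open>a\<close>,
  \<open>b\<close>, which keeps the arithmetic away from infinite values; \<open>lsc\<close> is
  lower semicontinuity in terms of sublevel sets.\<close>

lemma strongly_midconvex_attains_minimum:
  fixes J :: "'a::{real_inner, complete_space} \<Rightarrow> ereal"
  assumes lb: "\<And>x. ereal c \<le> J x" and fin: "J x0 < \<infinity>" and \<kappa>: "\<kappa> > 0"
    and mid: "\<And>x y a b. J x \<le> ereal a \<Longrightarrow> J y \<le> ereal b \<Longrightarrow>
       J ((1/2) *\<^sub>R (x + y)) \<le> ereal ((a + b) / 2 - \<kappa> * (norm (x - y))\<^sup>2)"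
    and lsc: "\<And>X l a. X \<longlonglongrightarrow> l \<Longrightarrow> (\<And>k::nat. J (X k) \<le> ereal a) \<Longrightarrow> J l \<le> ereal a"
  shows "\<exists>z. J z < \<infinity> \<and> (\<forall>y. J z \<le> J y)"
proof -
  have i1: "ereal c \<le> (INF x. J x)" using lb by (simp add: INF_greatest)
  have i2: "(INF x. J x) < \<infinity>" using fin by (meson INF_lower UNIV_I order_le_less_trans)
  obtain m where m: "(INF x. J x) = ereal m"
    using i1 i2 by (cases "INF x. J x") auto
  have low: "ereal m \<le> J x" for x
    using m by (metis INF_lower UNIV_I)
  have "\<exists>x. J x \<le> ereal (m + 1 / Suc k)" for k
  proof -
    have "(INF x. J x) < ereal (m + 1 / Suc k)" by (simp add: m)
    then show ?thesis by (auto simp: INF_less_iff intro: less_imp_le)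
  qed
  then obtain X where X: "\<And>k. J (X k) \<le> ereal (m + 1 / Suc k)" by metis
  have dist: "(norm (X j - X k))\<^sup>2 \<le> (1 / Suc j) / (2 * \<kappa>) + (1 / Suc k) / (2 * \<kappa>)" for j k
  proof -
    have "m \<le> ((m + 1 / Suc j) + (m + 1 / Suc k)) / 2 - \<kappa> * (norm (X j - X k))\<^sup>2"
      using order_trans[OF low mid[OF X X]] by simp
    then have "\<kappa> * (norm (X j - X k))\<^sup>2 \<le> (1 / Suc j + 1 / Suc k) / 2" by argo
    then have "(norm (X j - X k))\<^sup>2 \<le> (1 / Suc j + 1 / Suc k) / 2 / \<kappa>"
      using \<kappa> by (simp add: pos_le_divide_eq mult.commute)
    then show ?thesis by (simp add: add_divide_distrib algebra_simps)
  qed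
  have "(\<lambda>k. (1 / real (Suc k)) / (2 * \<kappa>)) \<longlonglongrightarrow> 0 / (2 * \<kappa>)"
    by (intro tendsto_divide tendsto_const) (use \<kappa> LIMSEQ_inverse_real_of_nat in \<open>auto simp: inverse_eq_divide\<close>)
  then have "Cauchy X"
    using Cauchy_if_norm_diff_square_le[OF dist] by simp
  then obtain z where z: "X \<longlonglongrightarrow> z"
    using convergent_eq_Cauchy by blast
  have "J z \<le> ereal (m + e)" if e: "e > 0" for e
  proof -
    obtain N where N: "1 / Suc N < e"
      using nat_approx_posE[OF e] by blast
    show ?thesis
    proof (rule lsc)
      show "(\<lambda>k. X (k + N)) \<longlonglongrightarrow> z" using z by (rule LIMSEQ_ignore_initial_segment)
      fix k
      have "1 / real (Suc (k + N)) \<le> 1 / Suc N" by (simp add: frac_le)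
      then have "m + 1 / real (Suc (k + N)) \<le> m + e" using N by linarith
      then show "J (X (k + N)) \<le> ereal (m + e)"
        using X[of "k + N"] by (meson ereal_less_eq(3) order_trans)
    qed
  qed
  then have "J z \<le> ereal m"
    by (metis ereal_le_epsilon2 plus_ereal.simps(1))
  then show ?thesis
    using low by (intro exI[of _ z]) (auto intro: order_trans simp: order_le_less_trans)
qed

lemma norm_midpoint_square:
  fixes x y :: "'a::real_inner"
  shows "(norm ((1/2) *\<^sub>R (x + y)))\<^sup>2 = ((norm x)\<^sup>2 + (norm y)\<^sup>2) / 2 - (norm (x - y))\<^sup>2 / 4"
  by (simp add: power2_norm_eq_inner inner_add_left inner_add_right inner_diff_left
      inner_diff_right inner_commute[of y x] field_simps)

lemma norm_add_scaleR_square: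
  fixes x y :: "'a::real_inner"
  shows "(norm (x + r *\<^sub>R y))\<^sup>2 = (norm x)\<^sup>2 + 2 * r * (x \<bullet> y) + r\<^sup>2 * (norm y)\<^sup>2"
  unfolding power2_norm_eq_inner
  by (simp add: inner_add_left inner_add_right inner_commute[of y x] power2_eq_square algebra_simps)

text \<open>The representing vector is the minimizer \<open>z\<close> of |x|^2 / 2 - D x, whose
  first variation in direction \<open>h\<close> is z \<bullet> h - D h.\<close>

lemma riesz_representation:
  fixes D :: "'a::{real_inner, complete_space} \<Rightarrow> real"
  assumes D: "bounded_linear D"
  shows "\<exists>g. \<forall>h. D h = g \<bullet> h"
proof -
  interpret D: bounded_linear D by (rule D)
  obtain K where K: "\<And>x. norm (D x) \<le> norm x * K" using D.bounded by blast
  define J where "J x = (norm x)\<^sup>2 / 2 - D x" for x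
  \<comment> \<open>The lower bound completes the square with |D x| \<le> K |x|;
    \<open>\<kappa>\<close> is half of the 1/4 in \<open>norm_midpoint_square\<close>, since the
    square carries the factor 1/2.\<close>
  have "\<exists>z. ereal (J z) < \<infinity> \<and> (\<forall>y. ereal (J z) \<le> ereal (J y))"
  proof (rule strongly_midconvex_attains_minimum[where c = "- K\<^sup>2 / 2" and \<kappa> = "1/8"])
    fix x :: 'a
    have "0 \<le> (norm x - K)\<^sup>2" by simp
    moreover have "D x \<le> norm x * K" using K[of x] by simp
    ultimately show "ereal (- K\<^sup>2 / 2) \<le> ereal (J x)"
      by (simp add: J_def power2_eq_square algebra_simps)
  next
    fix x y a b assume "ereal (J x) \<le> ereal a" "ereal (J y) \<le> ereal b"
    then show "ereal (J ((1/2) *\<^sub>R (x + y))) \<le> ereal ((a + b) / 2 - 1/8 * (norm (x - y))\<^sup>2)"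
      unfolding ereal_less_eq J_def norm_midpoint_square D.scaleR D.add by (simp add: field_simps)
  next
    fix X l a assume "X \<longlonglongrightarrow> l" and le: "\<And>k::nat. ereal (J (X k)) \<le> ereal a"
    then have "(\<lambda>k. J (X k)) \<longlonglongrightarrow> J l"
      unfolding J_def by (intro tendsto_intros D.tendsto) auto
    then show "ereal (J l) \<le> ereal a"
      using le by (auto intro: LIMSEQ_le_const2)
  qed auto
  then obtain z where z: "\<And>y. J z \<le> J y" by auto
  have "D h = z \<bullet> h" for h
  proof -
    define q where "q = z \<bullet> h - D h"
    define n where "n = (norm h)\<^sup>2"
    \<comment> \<open>The parabola r q + r^2 n / 2 has its minimum at - q / n; the denominator
      \<open>n + 1\<close> avoids a case distinction for \<open>h = 0\<close> and still gives a
      negative value unless \<open>q = 0\<close>.\<close>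
    define r where "r = - q / (n + 1)"
    have n: "n \<ge> 0" by (simp add: n_def)
    have "J (z + r *\<^sub>R h) = J z + r * q + r\<^sup>2 * n / 2"
      unfolding J_def q_def n_def
      by (simp only: power2_norm_eq_inner D.add D.scaleR inner_add_left inner_add_right
          inner_scaleR_left inner_scaleR_right inner_commute[of h z])
        (simp add: algebra_simps power2_eq_square add_divide_distrib)
    then have "0 \<le> r * q + r\<^sup>2 * n / 2" using z[of "z + r *\<^sub>R h"] by linarith
    also have "\<dots> = - (q\<^sup>2 * (n + 2)) / (2 * (n + 1)\<^sup>2)"
      unfolding r_def using n by (simp add: divide_simps power2_eq_square) (simp add: algebra_simps)
    finally have "q\<^sup>2 * (n + 2) \<le> 0"
      using n by (simp add: field_simps)
    then have "q = 0" using n by (auto simp: mult_le_0_iff)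
    then show ?thesis by (simp add: q_def)
  qed
  then show ?thesis by blast
qed

lemma ereal_lsc_sequentially:
  fixes f :: "'a::real_normed_vector \<Rightarrow> ereal"
  assumes lsc: "ereal_lsc f" and X: "X \<longlonglongrightarrow> l" and le: "\<And>k::nat. f (X k) \<le> a"
  shows "f l \<le> a"
proof (rule ccontr)
  assume n: "\<not> f l \<le> a"
  have "a < Liminf (at l) f" using lsc n unfolding ereal_lsc_def by (meson not_le order_less_le_trans)
  then have "\<forall>\<^sub>F x in at l. a < f x"
    using le_Liminf_iff[of "Liminf (at l) f" "at l" f] by auto
  \<comment> \<open>Since \<open>f (X k) \<le> a < f l\<close>, the sequence never hits
    \<open>l\<close>, so it converges along the punctured neighbourhoods used by
    \<open>Liminf (at l)\<close>.\<close>
  moreover have "filterlim X (at l) sequentially"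
    using X le n by (auto simp: filterlim_at intro!: always_eventually)
  ultimately have "\<forall>\<^sub>F k in sequentially. a < f (X k)"
    by (rule eventually_compose_filterlim)
  then show False using le by (auto simp: eventually_sequentially not_less[symmetric])
qed

text \<open>The point \<open>z\<close> is the minimizer of \<psi> x + |x|^2 / 4 - x \<bullet> y,
  whose Euler condition is y - z / 2 \<in> \<partial>\<psi> z. The factor 1/2 is the one in the
  boundary condition.\<close>

lemma subdifferential_resolvent_exists:
  fixes \<psi> :: "'a::{real_inner, complete_space} \<Rightarrow> ereal"
  assumes bdd: "\<And>x. ereal c \<le> \<psi> x" and conv: "ereal_convex \<psi>" and lsc: "ereal_lsc \<psi>"
    and dom: "\<psi> x0 < \<infinity>"
  shows "\<exists>z. y - z /\<^sub>R 2 \<in> subdifferential \<psi> z"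
proof -
  define q where "q x = (norm x)\<^sup>2 / 4 - x \<bullet> y" for x
  define J where "J x = \<psi> x + ereal (q x)" for x
  have not_minf: "\<psi> x \<noteq> -\<infinity>" for x using bdd[of x] by auto
  have J_le: "J x \<le> ereal a \<longleftrightarrow> \<psi> x \<le> ereal (a - q x)" for x a
    unfolding J_def using not_minf[of x] by (cases "\<psi> x") auto
  \<comment> \<open>The lower bound comes from (|x| / 2 - |y|)^2 \<ge> 0; 1/16 is the coefficient
    1/4 of the square in \<open>q\<close> times the 1/4 of
    \<open>norm_midpoint_square\<close>.\<close>
  have "\<exists>z. J z < \<infinity> \<and> (\<forall>y. J z \<le> J y)"
  proof (rule strongly_midconvex_attains_minimum[where c = "c - (norm y)\<^sup>2" and \<kappa> = "1/16"])
    fix x :: 'a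
    have "0 \<le> (norm x / 2 - norm y)\<^sup>2" by simp
    moreover have "x \<bullet> y \<le> norm x * norm y" by (rule norm_cauchy_schwarz)
    ultimately have "- (norm y)\<^sup>2 \<le> q x" by (simp add: q_def power2_eq_square algebra_simps)
    then have "ereal c + ereal (- (norm y)\<^sup>2) \<le> J x"
      unfolding J_def by (intro add_mono bdd) auto
    then show "ereal (c - (norm y)\<^sup>2) \<le> J x" by simp
  next
    show "J x0 < \<infinity>" using dom by (simp add: J_def)
  next
    fix u v a b assume a: "J u \<le> ereal a" and b: "J v \<le> ereal b"
    have "\<psi> ((1/2) *\<^sub>R (u + v)) \<le> ereal (1/2) * \<psi> u + ereal (1/2) * \<psi> v"
      using conv[unfolded ereal_convex_def, rule_format, of "1/2" u v] by (simp add: scaleR_add_right)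
    also have "\<dots> \<le> ereal (1/2) * ereal (a - q u) + ereal (1/2) * ereal (b - q v)"
      using a b by (intro add_mono ereal_mult_left_mono) (auto simp: J_le)
    also have "\<dots> = ereal (((a + b) / 2 - 1/16 * (norm (u - v))\<^sup>2) - q ((1/2) *\<^sub>R (u + v)))"
      unfolding q_def norm_midpoint_square by (simp add: inner_add_left field_simps)
    finally show "J ((1/2) *\<^sub>R (u + v)) \<le> ereal ((a + b) / 2 - 1/16 * (norm (u - v))\<^sup>2)"
      by (simp add: J_le)
  next
    fix X l a assume X: "X \<longlonglongrightarrow> l" and le: "\<And>k::nat. J (X k) \<le> ereal a"
    have q: "(\<lambda>k. q (X k)) \<longlonglongrightarrow> q l" unfolding q_def using X by (intro tendsto_intros) auto
    have "\<psi> l \<le> ereal (a - q l) + ereal e" if e: "e > 0" for e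
    proof -
      have "\<forall>\<^sub>F k in sequentially. q l - e < q (X k)"
        using order_tendstoD(1)[OF q, of "q l - e"] e by simp
      then obtain N where N: "\<And>k. k \<ge> N \<Longrightarrow> q l - e < q (X k)" by (auto simp: eventually_sequentially)
      show ?thesis
      proof (rule ereal_lsc_sequentially[OF lsc])
        show "(\<lambda>k. X (k + N)) \<longlonglongrightarrow> l" using X by (rule LIMSEQ_ignore_initial_segment)
        fix k
        have "a - q (X (k + N)) \<le> a - q l + e" using N[of "k + N"] by simp
        then show "\<psi> (X (k + N)) \<le> ereal (a - q l) + ereal e"
          using le[of "k + N", unfolded J_le] by (simp add: order_trans[OF _ iffD2[OF ereal_less_eq(3)]])
      qed
    qed
    then have "\<psi> l \<le> ereal (a - q l)"
      by (metis ereal_le_epsilon2)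
    then show "J l \<le> ereal a" by (simp add: J_le)
  qed auto
  then obtain z where z1: "J z < \<infinity>" and z2: "\<And>x. J z \<le> J x" by blast
  obtain p where p: "\<psi> z = ereal p" using z1 not_minf[of z] by (cases "\<psi> z") (auto simp: J_def)
  have "\<psi> z + ereal ((y - z /\<^sub>R 2) \<bullet> (w - z)) \<le> \<psi> w" for w
  proof (cases "\<psi> w")
    case (real s)
    define n where "n = (norm (w - z))\<^sup>2"
    \<comment> \<open>Comparison of \<open>z\<close> with the points z + r (w - z): convexity makes
      the change of \<psi> at most linear in \<open>r\<close>, and the quadratic part of
      \<open>q\<close> leaves r^2 n / 4. Dividing by \<open>r\<close> and letting it tend to 0 gives
      the subgradient inequality.\<close>
    have *: "p + (y - z /\<^sub>R 2) \<bullet> (w - z) - s \<le> r * (n / 4)" if r: "0 < r" "r \<le> 1" for r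
    proof -
      let ?v = "(1 - r) *\<^sub>R z + r *\<^sub>R w"
      have v: "?v = z + r *\<^sub>R (w - z)" by (simp add: algebra_simps)
      have "\<psi> ?v \<le> ereal (1 - r) * \<psi> z + ereal r * \<psi> w"
        using conv r by (simp add: ereal_convex_def)
      also have "\<dots> = ereal ((1 - r) * p + r * s)" by (simp add: p real)
      finally have "J ?v \<le> ereal ((1 - r) * p + r * s + q ?v)" by (simp add: J_le)
      then have "J z \<le> ereal ((1 - r) * p + r * s + q ?v)" using z2 order_trans by blast
      then have "p + q z \<le> (1 - r) * p + r * s + q ?v" by (simp add: J_def p)
      moreover have "q ?v = q z + r * ((z /\<^sub>R 2 - y) \<bullet> (w - z)) + r\<^sup>2 * n / 4"
        unfolding v q_def n_def norm_add_scaleR_square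
        by (simp add: inner_add_left inner_add_right inner_diff_left inner_diff_right inner_commute field_simps)
      ultimately have "0 \<le> r * (s - p) - r * ((y - z /\<^sub>R 2) \<bullet> (w - z)) + r * (r * (n / 4))"
        by (simp add: inner_diff_left power2_eq_square algebra_simps)
      then have "0 \<le> r * (s - p - (y - z /\<^sub>R 2) \<bullet> (w - z) + r * (n / 4))"
        by (simp add: algebra_simps)
      then show ?thesis using r by (simp add: zero_le_mult_iff)
    qed
    have "p + (y - z /\<^sub>R 2) \<bullet> (w - z) - s \<le> 0"
    proof (rule tendsto_lowerbound)
      show "((\<lambda>r. r * (n / 4)) \<longlongrightarrow> 0) (at_right 0)"
        by (rule tendsto_eq_intros refl | simp)+
      show "\<forall>\<^sub>F r in at_right 0. p + (y - z /\<^sub>R 2) \<bullet> (w - z) - s \<le> r * (n / 4)"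
        using * by (auto simp: eventually_at_right_field intro!: exI[of _ 1])
    qed simp
    then show ?thesis by (simp add: p real)
  qed (use not_minf in auto)
  then show ?thesis
    by (intro exI[of _ z]) (auto simp: subdifferential_def p)
qed

text \<open>The maps F / (1 + e) are contractions; a fixed point \<open>x\<close> of one satisfies
  |x| \<le> |F x|, so \<open>q < 1\<close> bounds it. Pairing the equations for two parameters with
  \<open>x k - x l\<close>, nonexpansiveness gives x k \<bullet> (x k - x l) \<le> 0 for k < l,
  hence |x k - x l|^2 \<le> |x l|^2 - |x k|^2. The norms thus increase to a limit and the sequence
  converges strongly.\<close>

lemma nonexpansive_fixed_point:
  fixes F :: "'a::{real_inner, complete_space} \<Rightarrow> 'a"
  assumes ne: "\<And>x y. norm (F x - F y) \<le> norm (x - y)"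
    and bd: "\<And>x. norm (F x) \<le> q * norm x + M" and q: "q < 1"
  shows "\<exists>x. F x = x"
proof -
  define e where "e k = 1 / real (Suc k)" for k
  have e0: "e k > 0" for k by (simp add: e_def)
  have "\<exists>x. F x = (1 + e k) *\<^sub>R x" for k
  proof -
    have "\<exists>!x. (1 / (1 + e k)) *\<^sub>R F x = x"
    proof (rule banach_fix_type[of "1 / (1 + e k)"])
      show "\<forall>x y. dist ((1 / (1 + e k)) *\<^sub>R F x) ((1 / (1 + e k)) *\<^sub>R F y) \<le> 1 / (1 + e k) * dist x y"
      proof (intro allI)
        fix x y
        have "dist ((1 / (1 + e k)) *\<^sub>R F x) ((1 / (1 + e k)) *\<^sub>R F y) = 1 / (1 + e k) * norm (F x - F y)"
          using e0[of k] by (simp add: dist_norm flip: scaleR_diff_right)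
        also have "\<dots> \<le> 1 / (1 + e k) * dist x y"
          using ne e0[of k] unfolding dist_norm by (intro mult_left_mono) auto
        finally show "dist ((1 / (1 + e k)) *\<^sub>R F x) ((1 / (1 + e k)) *\<^sub>R F y) \<le> 1 / (1 + e k) * dist x y" .
      qed
    qed (use e0[of k] in auto)
    then obtain x where x: "(1 / (1 + e k)) *\<^sub>R F x = x" by blast
    have "(1 + e k) *\<^sub>R x = F x" by (subst x[symmetric]) (use e0[of k] in simp)
    then show ?thesis by (intro exI[of _ x]) simp
  qed
  then obtain x where x: "\<And>k. F (x k) = (1 + e k) *\<^sub>R x k" by metis
  have bound: "norm (x k) \<le> M / (1 - q)" for k
  proof -
    have "norm (x k) \<le> norm (F (x k))"
      using e0[of k] by (simp add: x mult_le_cancel_right1)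
    then show ?thesis using bd[of "x k"] q by (simp add: field_simps)
  qed
  have mono: "(norm (x k - x l))\<^sup>2 \<le> (norm (x l))\<^sup>2 - (norm (x k))\<^sup>2" if "k \<le> l" for k l
  proof -
    have ekl: "e l \<le> e k" using that by (simp add: e_def frac_le)
    show ?thesis
    proof (cases "k = l")
      case False
      then have lt: "e l < e k" using that by (simp add: e_def frac_less2)
      have "(F (x k) - F (x l)) \<bullet> (x k - x l) \<le> norm (x k - x l) * norm (x k - x l)"
        using norm_cauchy_schwarz[of "F (x k) - F (x l)" "x k - x l"] ne[of "x k" "x l"]
        by (meson mult_right_mono norm_ge_zero order_trans)
      then have "(F (x k) - F (x l)) \<bullet> (x k - x l) \<le> (x k - x l) \<bullet> (x k - x l)"
        by (simp add: power2_norm_eq_inner flip: power2_eq_square)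
      moreover have "F (x k) - F (x l) = (x k - x l) + e l *\<^sub>R (x k - x l) + (e k - e l) *\<^sub>R x k"
        by (simp add: x algebra_simps)
      ultimately have "e l * ((x k - x l) \<bullet> (x k - x l)) + (e k - e l) * (x k \<bullet> (x k - x l)) \<le> 0"
        by (simp add: inner_add_left)
      moreover have "0 \<le> e l * ((x k - x l) \<bullet> (x k - x l))" using e0[of l] by simp
      ultimately have "(e k - e l) * (x k \<bullet> (x k - x l)) \<le> 0" by linarith
      then have "x k \<bullet> (x k - x l) \<le> 0" using lt by (simp add: mult_le_0_iff)
      then show ?thesis
        by (simp add: power2_norm_eq_inner algebra_simps inner_commute)
    qed simp
  qed
  have inc: "incseq (\<lambda>k. (norm (x k))\<^sup>2)"
  proof (rule incseq_SucI)
    fix k show "(norm (x k))\<^sup>2 \<le> (norm (x (Suc k)))\<^sup>2"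
      using mono[of k "Suc k"] zero_le_power2[of "norm (x k - x (Suc k))"] by linarith
  qed
  have "\<forall>k. (norm (x k))\<^sup>2 \<le> (M / (1 - q))\<^sup>2" using bound by (auto intro: power_mono)
  then obtain L where L: "(\<lambda>k. (norm (x k))\<^sup>2) \<longlonglongrightarrow> L" and Lub: "\<And>k. (norm (x k))\<^sup>2 \<le> L"
    using incseq_convergent[OF inc] by blast
  have "(norm (x k - x l))\<^sup>2 \<le> (L - (norm (x k))\<^sup>2) + (L - (norm (x l))\<^sup>2)" for k l
    using mono[of k l] mono[of l k] Lub[of k] Lub[of l]
    by (cases "k \<le> l") (auto simp: norm_minus_commute[of "x l" "x k"])
  moreover have "(\<lambda>k. L - (norm (x k))\<^sup>2) \<longlonglongrightarrow> 0"
    using tendsto_diff[OF tendsto_const[of L] L] by simp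
  ultimately have "Cauchy x" by (rule Cauchy_if_norm_diff_square_le)
  then obtain z where z: "x \<longlonglongrightarrow> z" using convergent_eq_Cauchy by blast
  have "(\<lambda>k. F (x k)) \<longlonglongrightarrow> F z"
  proof (rule Lim_null_comparison[THEN LIM_zero_cancel])
    show "\<forall>\<^sub>F k in sequentially. norm (F (x k) - F z) \<le> norm (x k - z)" using ne by simp
    show "(\<lambda>k. norm (x k - z)) \<longlonglongrightarrow> 0" using z by (simp add: tendsto_norm_zero_iff LIM_zero)
  qed
  moreover have "e \<longlonglongrightarrow> 0"
    unfolding e_def using LIMSEQ_inverse_real_of_nat by (simp add: inverse_eq_divide)
  then have "(\<lambda>k. (1 + e k) *\<^sub>R x k) \<longlonglongrightarrow> (1 + 0) *\<^sub>R z"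
    using z by (intro tendsto_intros)
  ultimately show ?thesis
    unfolding x using LIMSEQ_unique by (intro exI[of _ z]) fastforce
qed

subsection \<open>Indefinite Lebesgue integrals\<close>

text \<open>The intervals may contain \<open>x\<close> in any position, as needed for a derivative
  within a closed interval. They are split at \<open>x\<close>, and the one-sided statement is
  applied to \<open>g\<close> on the right and to its reflection on the left. The error in the form
  e (b - a) also covers \<open>a = b\<close>.\<close>

lemma lebesgue_differentiation_real:
  fixes g :: "real \<Rightarrow> real"
  assumes g: "\<And>a b. g integrable_on {a..b}"
  shows "AE x in lebesgue. \<forall>e>0. \<exists>d>0. \<forall>a b. a \<le> x \<longrightarrow> x \<le> b \<longrightarrow> b - a < d \<longrightarrow>
           \<bar>integral {a..b} g - (b - a) * g x\<bar> \<le> e * (b - a)"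
proof -
  have right: "\<exists>N. negligible N \<and> (\<forall>x e. x \<notin> N \<longrightarrow> 0 < e \<longrightarrow>
      (\<exists>d>0. \<forall>h. 0 < h \<and> h < d \<longrightarrow> \<bar>integral {x..x+h} f - h * f x\<bar> \<le> e * h))"
    if f: "\<And>a b. f integrable_on {a..b}" for f :: "real \<Rightarrow> real"
  proof -
    have "\<And>a b. f integrable_on cbox a b" using f by simp
    then obtain N where N: "negligible N" and
      *: "\<And>x e. \<lbrakk>x \<notin> N; 0 < e\<rbrakk> \<Longrightarrow> \<exists>d>0. \<forall>h. 0 < h \<and> h < d \<longrightarrow>
           norm (integral (cbox x (x + h *\<^sub>R One)) f /\<^sub>R h ^ DIM(real) - f x) < e"
      using integrable_ccontinuous_explicit[of f] by blast
    have "\<exists>d>0. \<forall>h. 0 < h \<and> h < d \<longrightarrow> \<bar>integral {x..x+h} f - h * f x\<bar> \<le> e * h"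
      if xe: "x \<notin> N" "0 < e" for x e
    proof -
      obtain d where d: "d > 0" and dd: "\<And>h. 0 < h \<and> h < d \<Longrightarrow>
           norm (integral (cbox x (x + h *\<^sub>R One)) f /\<^sub>R h ^ DIM(real) - f x) < e"
        using *[OF xe] by blast
      have "\<bar>integral {x..x+h} f - h * f x\<bar> \<le> e * h" if h: "0 < h" "h < d" for h
      proof -
        have "\<bar>integral {x..x+h} f / h - f x\<bar> < e"
          using dd[of h] h by (simp add: divide_inverse mult.commute)
        then have "\<bar>integral {x..x+h} f / h - f x\<bar> * h \<le> e * h"
          using h by (intro mult_right_mono) auto
        also have "\<bar>integral {x..x+h} f / h - f x\<bar> * h = \<bar>(integral {x..x+h} f / h - f x) * h\<bar>"
          using h by (simp add: abs_mult)
        also have "(integral {x..x+h} f / h - f x) * h = integral {x..x+h} f - h * f x"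
          using h by (simp add: field_simps)
        finally show ?thesis .
      qed
      then show ?thesis using d by blast
    qed
    then show ?thesis using N by blast
  qed
  obtain N1 where N1: "negligible N1" and R: "\<And>x e. x \<notin> N1 \<Longrightarrow> 0 < e \<Longrightarrow>
      \<exists>d>0. \<forall>h. 0 < h \<and> h < d \<longrightarrow> \<bar>integral {x..x+h} g - h * g x\<bar> \<le> e * h"
    using right[OF g] by blast
  have g': "(\<lambda>x. g (- x)) integrable_on {a..b}" for a b
    using Henstock_Kurzweil_Integration.integrable_reflect_real[where f = g and a = "- b" and b = "- a"] g by simp
  obtain N2 where N2: "negligible N2" and L: "\<And>x e. x \<notin> N2 \<Longrightarrow> 0 < e \<Longrightarrow>
      \<exists>d>0. \<forall>h. 0 < h \<and> h < d \<longrightarrow> \<bar>integral {x..x+h} (\<lambda>x. g (- x)) - h * g (- x)\<bar> \<le> e * h"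
    using right[OF g'] by blast
  have N2': "negligible (uminus ` N2)"
    by (rule negligible_differentiable_image_negligible[OF _ N2]) (auto intro!: derivative_intros simp: differentiable_on_def)
  show ?thesis
    unfolding eventually_ae_filter_negligible
  proof (intro exI conjI subsetI)
    show "negligible (N1 \<union> uminus ` N2)" using N1 N2' by (rule negligible_Un)
    fix x assume "x \<in> {x. \<not> (\<forall>e>0. \<exists>d>0. \<forall>a b. a \<le> x \<longrightarrow> x \<le> b \<longrightarrow> b - a < d \<longrightarrow>
           \<bar>integral {a..b} g - (b - a) * g x\<bar> \<le> e * (b - a))}"
    moreover have "\<exists>d>0. \<forall>a b. a \<le> x \<longrightarrow> x \<le> b \<longrightarrow> b - a < d \<longrightarrow>
           \<bar>integral {a..b} g - (b - a) * g x\<bar> \<le> e * (b - a)"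
      if x: "x \<notin> N1 \<union> uminus ` N2" and e: "e > 0" for e
    proof -
      have x1: "x \<notin> N1" and x2: "- x \<notin> N2" using x by (auto simp: image_iff)
      obtain d1 where d1: "d1 > 0" "\<And>h. 0 < h \<Longrightarrow> h < d1 \<Longrightarrow>
          \<bar>integral {x..x+h} g - h * g x\<bar> \<le> e * h" using R[OF x1 e] by blast
      obtain d2 where d2: "d2 > 0" "\<And>h. 0 < h \<Longrightarrow> h < d2 \<Longrightarrow>
          \<bar>integral {-x..-x+h} (\<lambda>x. g (- x)) - h * g x\<bar> \<le> e * h" using L[OF x2 e] by auto
      have "\<bar>integral {a..b} g - (b - a) * g x\<bar> \<le> e * (b - a)"
        if ab: "a \<le> x" "x \<le> b" "b - a < min d1 d2" for a b
      proof -
        have r: "\<bar>integral {x..b} g - (b - x) * g x\<bar> \<le> e * (b - x)"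
          using d1(2)[of "b - x"] ab by (cases "b = x") auto
        have "integral {-x..-x+(x-a)} (\<lambda>x. g (- x)) = integral {a..x} g"
          using Henstock_Kurzweil_Integration.integral_reflect_real[where f = g and a = a and b = x] by simp
        then have l: "\<bar>integral {a..x} g - (x - a) * g x\<bar> \<le> e * (x - a)"
          using d2(2)[of "x - a"] ab by (cases "a = x") auto
        have "integral {a..x} g + integral {x..b} g = integral {a..b} g"
          using ab g by (intro Henstock_Kurzweil_Integration.integral_combine)
        then have "integral {a..b} g - (b - a) * g x
            = (integral {a..x} g - (x - a) * g x) + (integral {x..b} g - (b - x) * g x)"
          by (simp add: algebra_simps)
        then have "\<bar>integral {a..b} g - (b - a) * g x\<bar> \<le> e * (x - a) + e * (b - x)"
          using l r by linarith
        then show ?thesis by (simp add: algebra_simps)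
      qed
      then show ?thesis using d1(1) d2(1) by (intro exI[of _ "min d1 d2"]) auto
    qed
    ultimately show "x \<in> N1 \<union> uminus ` N2" by blast
  qed
qed

lemma set_integrable_const_lebesgue:
  fixes c :: "'a::{banach, second_countable_topology}"
  shows "set_integrable lebesgue {a..b::real} (\<lambda>_. c)"
  unfolding set_integrable_def
  by (rule integrable_scaleR_left)
    (use lmeasurable_cbox[of a b] in \<open>simp only: lmeasurable_iff_integrable box_real\<close>)

lemma set_integral_const_lebesgue:
  fixes c :: "'a::{banach, second_countable_topology}"
  assumes "a \<le> b"
  shows "(LINT s:{a..b::real}|lebesgue. c) = (b - a) *\<^sub>R c"
proof -
  have "integrable lebesgue (indicat_real {a..b})"
    using lmeasurable_cbox[of a b] by (simp only: lmeasurable_iff_integrable box_real)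
  then have "(LINT s:{a..b}|lebesgue. c) = (LINT s|lebesgue. indicat_real {a..b} s) *\<^sub>R c"
    unfolding set_lebesgue_integral_def by (rule integral_scaleR_left)
  also have "(LINT s|lebesgue. indicat_real {a..b} s) = measure lebesgue {a..b}"
    by (simp only: Bochner_Integration.integral_indicator space_completion space_lborel space_borel Int_UNIV_right)
  also have "\<dots> = b - a" using assms by (subst measure_completion) (auto simp: measure_lborel_Icc)
  finally show ?thesis .
qed

lemma set_integral_Icc_split:
  fixes w :: "real \<Rightarrow> 'a::{banach, second_countable_topology}"
  assumes w: "set_integrable lebesgue {a..c} w" and "a \<le> b" "b \<le> c"
  shows "(LINT s:{a..c}|lebesgue. w s) = (LINT s:{a..b}|lebesgue. w s) + (LINT s:{b..c}|lebesgue. w s)"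
proof -
  have "{a..c} = {a..b} \<union> {b..c}" using assms by auto
  moreover have "AE x in lebesgue. \<not> (x \<in> {a..b} \<and> x \<in> {b..c})"
    unfolding eventually_ae_filter_negligible by (intro exI[of _ "{b}"]) auto
  ultimately show ?thesis
    by (simp only:) (rule set_integral_Un_AE; use set_integrable_subset[OF w] assms in auto)
qed

lemma set_integral_norm_le:
  fixes w :: "real \<Rightarrow> 'a::{banach, second_countable_topology}"
  shows "norm (LINT s:A|lebesgue. w s) \<le> (LINT s:A|lebesgue. norm (w s))"
  unfolding set_lebesgue_integral_def
  using integral_norm_bound[of lebesgue "\<lambda>s. indicator A s *\<^sub>R w s"] by simp

text \<open>Applied to the real functions |w - q| for \<open>q\<close> in a countable dense set, the
  scalar theorem has one common null set; choosing \<open>q\<close> close to \<open>w x\<close> then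
  controls the vector-valued averages at \<open>x\<close>.\<close>

lemma lebesgue_differentiation:
  fixes w :: "real \<Rightarrow> 'a::{banach, second_countable_topology}"
  assumes w: "\<And>a b. set_integrable lebesgue {a..b} w"
  shows "AE x in lebesgue. \<forall>e>0. \<exists>d>0. \<forall>a b. a \<le> x \<longrightarrow> x \<le> b \<longrightarrow> b - a < d \<longrightarrow>
           norm ((LINT s:{a..b}|lebesgue. w s) - (b - a) *\<^sub>R w x) \<le> e * (b - a)"
proof -
  obtain Q :: "'a set" where Q: "countable Q" "\<And>X. open X \<Longrightarrow> X \<noteq> {} \<Longrightarrow> \<exists>d\<in>Q. d \<in> X"
    using countable_dense_setE by blast
  have int: "set_integrable lebesgue {a..b} (\<lambda>s. norm (w s - q))" for a b q
    by (intro set_integrable_norm set_integral_diff w set_integrable_const_lebesgue)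
  have "AE x in lebesgue. \<forall>q\<in>Q. \<forall>e>0. \<exists>d>0. \<forall>a b. a \<le> x \<longrightarrow> x \<le> b \<longrightarrow> b - a < d \<longrightarrow>
           \<bar>integral {a..b} (\<lambda>s. norm (w s - q)) - (b - a) * norm (w x - q)\<bar> \<le> e * (b - a)"
    by (intro AE_ball_countable[THEN iffD2] Q(1) ballI lebesgue_differentiation_real
        set_lebesgue_integral_eq_integral int)
  then show ?thesis
  proof eventually_elim
    fix x assume *: "\<forall>q\<in>Q. \<forall>e>0. \<exists>d>0. \<forall>a b. a \<le> x \<longrightarrow> x \<le> b \<longrightarrow> b - a < d \<longrightarrow>
           \<bar>integral {a..b} (\<lambda>s. norm (w s - q)) - (b - a) * norm (w x - q)\<bar> \<le> e * (b - a)"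
    show "\<forall>e>0. \<exists>d>0. \<forall>a b. a \<le> x \<longrightarrow> x \<le> b \<longrightarrow> b - a < d \<longrightarrow>
           norm ((LINT s:{a..b}|lebesgue. w s) - (b - a) *\<^sub>R w x) \<le> e * (b - a)"
    proof (intro allI impI)
      fix e :: real assume e: "e > 0"
      \<comment> \<open>One third of \<open>e\<close> goes to the differentiation error, and one to
        each of the two occurrences of |w x - q| below.\<close>
      obtain q where q: "q \<in> Q" "dist (w x) q < e / 3"
        using Q(2)[of "ball (w x) (e / 3)"] e by auto
      obtain d where d: "d > 0" "\<And>a b. a \<le> x \<Longrightarrow> x \<le> b \<Longrightarrow> b - a < d \<Longrightarrow>
           \<bar>integral {a..b} (\<lambda>s. norm (w s - q)) - (b - a) * norm (w x - q)\<bar> \<le> e / 3 * (b - a)"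
        using *[rule_format, OF q(1), of "e / 3"] e by auto
      have "norm ((LINT s:{a..b}|lebesgue. w s) - (b - a) *\<^sub>R w x) \<le> e * (b - a)"
        if ab: "a \<le> x" "x \<le> b" "b - a < d" for a b
      proof -
        have "norm ((LINT s:{a..b}|lebesgue. w s - q)) \<le> (LINT s:{a..b}|lebesgue. norm (w s - q))"
          by (rule set_integral_norm_le)
        also have "\<dots> = integral {a..b} (\<lambda>s. norm (w s - q))"
          by (rule set_lebesgue_integral_eq_integral[OF int])
        also have "\<dots> \<le> (b - a) * norm (w x - q) + e / 3 * (b - a)"
          using d(2)[OF ab] by linarith
        finally have 1: "norm ((LINT s:{a..b}|lebesgue. w s - q)) \<le> (b - a) * norm (w x - q) + e / 3 * (b - a)" .
        have "(LINT s:{a..b}|lebesgue. w s) - (b - a) *\<^sub>R w x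
            = (LINT s:{a..b}|lebesgue. w s - q) + (b - a) *\<^sub>R (q - w x)"
          using ab by (subst set_integral_diff(2)[OF w set_integrable_const_lebesgue])
            (simp add: set_integral_const_lebesgue algebra_simps)
        then have "norm ((LINT s:{a..b}|lebesgue. w s) - (b - a) *\<^sub>R w x)
            \<le> norm (LINT s:{a..b}|lebesgue. w s - q) + (b - a) * norm (w x - q)"
          using norm_triangle_ineq[of "LINT s:{a..b}|lebesgue. w s - q" "(b - a) *\<^sub>R (q - w x)"] ab
          by (simp add: norm_minus_commute)
        also have "\<dots> \<le> (b - a) * norm (w x - q) + e / 3 * (b - a) + (b - a) * norm (w x - q)"
          using 1 by simp
        also have "\<dots> \<le> (b - a) * (e / 3) + e / 3 * (b - a) + (b - a) * (e / 3)"
          using q(2) ab e by (intro add_mono mult_left_mono order_refl) (auto simp: dist_norm norm_minus_commute)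
        also have "\<dots> = e * (b - a)" by (simp add: field_simps)
        finally show ?thesis .
      qed
      then show "\<exists>d>0. \<forall>a b. a \<le> x \<longrightarrow> x \<le> b \<longrightarrow> b - a < d \<longrightarrow>
           norm ((LINT s:{a..b}|lebesgue. w s) - (b - a) *\<^sub>R w x) \<le> e * (b - a)"
        using d(1) by blast
    qed
  qed
qed

lemma AE_has_vector_derivative_indefinite_integral:
  fixes w :: "real \<Rightarrow> 'a::{banach, second_countable_topology}"
  assumes w: "set_integrable lebesgue {0..T} w"
  shows "AE t in lebesgue_on {0..T}.
    ((\<lambda>t. c + (LINT s:{0..t}|lebesgue. w s)) has_vector_derivative w t) (at t within {0..T})"
proof -
  \<comment> \<open>Extension by zero makes the function integrable on all intervals, also on those
    reaching beyond \<open>{0..T}\<close>.\<close>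
  define v where "v s = indicator {0..T} s *\<^sub>R w s" for s
  have v: "set_integrable lebesgue {a..b} v" for a b
    unfolding set_integrable_def v_def
    by (rule integrable_mult_indicator) (use w in \<open>auto simp: set_integrable_def\<close>)
  have vw: "(LINT s:{a..b}|lebesgue. v s) = (LINT s:{a..b}|lebesgue. w s)" if "0 \<le> a" "b \<le> T" for a b
    by (rule set_lebesgue_integral_cong) (use that in \<open>auto simp: v_def\<close>)
  have "AE t in lebesgue. t \<in> {0..T} \<longrightarrow>
    ((\<lambda>t. c + (LINT s:{0..t}|lebesgue. w s)) has_vector_derivative w t) (at t within {0..T})"
    using lebesgue_differentiation[OF v]
  proof eventually_elim
    fix t assume *: "\<forall>e>0. \<exists>d>0. \<forall>a b. a \<le> t \<longrightarrow> t \<le> b \<longrightarrow> b - a < d \<longrightarrow>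
           norm ((LINT s:{a..b}|lebesgue. v s) - (b - a) *\<^sub>R v t) \<le> e * (b - a)"
    show "t \<in> {0..T} \<longrightarrow>
      ((\<lambda>t. c + (LINT s:{0..t}|lebesgue. w s)) has_vector_derivative w t) (at t within {0..T})"
    proof
      assume t: "t \<in> {0..T}"
      have vt: "v t = w t" using t by (simp add: v_def)
      show "((\<lambda>t. c + (LINT s:{0..t}|lebesgue. w s)) has_vector_derivative w t) (at t within {0..T})"
        unfolding has_vector_derivative_def has_derivative_within_alt
      proof (intro conjI allI impI)
        show "bounded_linear (\<lambda>x. x *\<^sub>R w t)" by (rule bounded_linear_scaleR_left)
        fix e :: real assume "e > 0"
        then obtain d where d: "d > 0" "\<And>a b. a \<le> t \<Longrightarrow> t \<le> b \<Longrightarrow> b - a < d \<Longrightarrow>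
            norm ((LINT s:{a..b}|lebesgue. v s) - (b - a) *\<^sub>R w t) \<le> e * (b - a)"
          using * vt by metis
        have "norm (c + (LINT s:{0..y}|lebesgue. w s) - (c + (LINT s:{0..t}|lebesgue. w s)) - (y - t) *\<^sub>R w t)
            \<le> e * norm (y - t)" if y: "y \<in> {0..T}" "norm (y - t) < d" for y
        proof (cases "t \<le> y")
          case True
          have "(LINT s:{0..y}|lebesgue. w s) = (LINT s:{0..t}|lebesgue. w s) + (LINT s:{t..y}|lebesgue. w s)"
            by (rule set_integral_Icc_split) (use True t y set_integrable_subset[OF w] in auto)
          then show ?thesis using d(2)[of t y] True y t by (simp add: vw)
        next
          case False
          have "(LINT s:{0..t}|lebesgue. w s) = (LINT s:{0..y}|lebesgue. w s) + (LINT s:{y..t}|lebesgue. w s)"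
            by (rule set_integral_Icc_split) (use False t y set_integrable_subset[OF w] in auto)
          then have "norm (c + (LINT s:{0..y}|lebesgue. w s) - (c + (LINT s:{0..t}|lebesgue. w s)) - (y - t) *\<^sub>R w t)
             = norm ((LINT s:{y..t}|lebesgue. w s) - (t - y) *\<^sub>R w t)"
            by (subst norm_minus_cancel[symmetric]) (simp add: algebra_simps)
          then show ?thesis using d(2)[of y t] False y t by (simp add: vw)
        qed
        then show "\<exists>d>0. \<forall>y\<in>{0..T}. norm (y - t) < d \<longrightarrow>
            norm (c + (LINT s:{0..y}|lebesgue. w s) - (c + (LINT s:{0..t}|lebesgue. w s)) - (y - t) *\<^sub>R w t)
            \<le> e * norm (y - t)" using d(1) by blast
      qed
    qed
  qed
  then show ?thesis by (subst AE_restrict_space_iff) auto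
qed

text \<open>The integral of |g| over a set is at most that of |g| - min |g| n over the line, which
  is small for large \<open>n\<close>, plus \<open>n\<close> times the measure of the set.\<close>

lemma integral_small_if_measure_small:
  fixes g :: "real \<Rightarrow> real"
  assumes g: "integrable lebesgue g" and e: "e > 0"
  shows "\<exists>d>0. \<forall>A\<in>sets lebesgue. emeasure lebesgue A < ennreal d \<longrightarrow> (LINT s:A|lebesgue. \<bar>g s\<bar>) < e"
proof -
  have [measurable]: "g \<in> borel_measurable lebesgue" using g by auto
  have "(\<lambda>n. LINT s|lebesgue. \<bar>g s\<bar> - min \<bar>g s\<bar> (real n)) \<longlonglongrightarrow> integral\<^sup>L lebesgue (\<lambda>s::real. 0::real)"
  proof (rule integral_dominated_convergence[where w = "\<lambda>s. \<bar>g s\<bar>"])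
    show "AE s in lebesgue. (\<lambda>n. \<bar>g s\<bar> - min \<bar>g s\<bar> (real n)) \<longlonglongrightarrow> 0"
    proof (rule AE_I2)
      fix s
      obtain N :: nat where "\<bar>g s\<bar> \<le> real N" using real_arch_simple by blast
      then have "\<forall>\<^sub>F n in sequentially. \<bar>g s\<bar> - min \<bar>g s\<bar> (real n) = 0"
        by (intro eventually_sequentiallyI[of N]) (simp add: min_absorb1)
      then show "(\<lambda>n. \<bar>g s\<bar> - min \<bar>g s\<bar> (real n)) \<longlonglongrightarrow> 0" by (rule tendsto_eventually)
    qed
  qed (use g in auto)
  then have "\<forall>\<^sub>F n in sequentially. (LINT s|lebesgue. \<bar>g s\<bar> - min \<bar>g s\<bar> (real n)) < e / 2"
    using order_tendstoD(2)[of _ 0 sequentially "e / 2"] e by simp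
  then obtain n where n: "(LINT s|lebesgue. \<bar>g s\<bar> - min \<bar>g s\<bar> (real n)) < e / 2"
    by (auto simp: eventually_sequentially)
  have imin: "integrable lebesgue (\<lambda>s. \<bar>g s\<bar> - min \<bar>g s\<bar> (real n))"
    by (rule Bochner_Integration.integrable_bound[OF g]) auto
  show ?thesis
  proof (intro exI[of _ "e / (2 * real (Suc n))"] conjI ballI impI)
    show "0 < e / (2 * real (Suc n))" using e by simp
    fix A :: "real set" assume A[measurable]: "A \<in> sets lebesgue" and small: "emeasure lebesgue A < ennreal (e / (2 * real (Suc n)))"
    have fin: "emeasure lebesgue A < \<infinity>" using small by (simp add: order_less_trans)
    have m: "measure lebesgue A < e / (2 * real (Suc n))"
    proof -
      have "emeasure lebesgue A = ennreal (measure lebesgue A)"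
        using fin by (intro emeasure_eq_ennreal_measure) auto
      then show ?thesis using small by (simp only: ennreal_less_iff measure_nonneg)
    qed
    have iA: "integrable lebesgue (\<lambda>s. indicator A s * real n)"
      using fin by (intro integrable_mult_left) auto
    have "(LINT s:A|lebesgue. \<bar>g s\<bar>) \<le> (LINT s|lebesgue. (\<bar>g s\<bar> - min \<bar>g s\<bar> (real n)) + indicator A s * real n)"
      unfolding set_lebesgue_integral_def
    proof (rule integral_mono)
      show "integrable lebesgue (\<lambda>x. indicat_real A x *\<^sub>R \<bar>g x\<bar>)"
        by (intro integrable_mult_indicator) (use g in auto)
    qed (use imin iA in \<open>auto simp: indicator_def\<close>)
    also have "\<dots> = (LINT s|lebesgue. \<bar>g s\<bar> - min \<bar>g s\<bar> (real n)) + measure lebesgue A * real n"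
      using imin iA by simp
    also have "\<dots> < e / 2 + e / (2 * real (Suc n)) * real (Suc n)"
      using n m e by (intro add_less_le_mono mult_mono) auto
    also have "\<dots> = e" by (simp del: of_nat_Suc)
    finally show "(LINT s:A|lebesgue. \<bar>g s\<bar>) < e" .
  qed
qed

lemma abs_cont_on_indefinite_integral:
  fixes w :: "real \<Rightarrow> 'a::{banach, second_countable_topology}"
  assumes w: "set_integrable lebesgue {0..T} w"
  shows "abs_cont_on {0..T} (\<lambda>t. c + (LINT s:{0..t}|lebesgue. w s))"
  unfolding abs_cont_on_def
proof (intro allI impI)
  fix e :: real assume e: "e > 0"
  define g where "g s = indicator {0..T} s * norm (w s)" for s
  have g: "integrable lebesgue g"
    using set_integrable_norm[OF w] by (simp add: g_def[abs_def] set_integrable_def)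
  obtain d where d: "d > 0" and dd: "\<And>A. A \<in> sets lebesgue \<Longrightarrow> emeasure lebesgue A < ennreal d \<Longrightarrow>
      (LINT s:A|lebesgue. \<bar>g s\<bar>) < e"
    using integral_small_if_measure_small[OF g e] by blast
  show "\<exists>d>0. \<forall>P. finite P \<and> (\<forall>(a, b)\<in>P. a \<le> b \<and> {a..b} \<subseteq> {0..T}) \<and>
      disjoint_family_on (\<lambda>(a, b). {a<..<b}) P \<and> (\<Sum>(a, b)\<in>P. b - a) < d \<longrightarrow>
      (\<Sum>(a, b)\<in>P. norm (c + (LINT s:{0..b}|lebesgue. w s) - (c + (LINT s:{0..a}|lebesgue. w s)))) < e"
  proof (intro exI[of _ d] conjI allI impI d)
    fix P :: "(real \<times> real) set"
    assume *: "finite P \<and> (\<forall>(a, b)\<in>P. a \<le> b \<and> {a..b} \<subseteq> {0..T}) \<and>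
      disjoint_family_on (\<lambda>(a, b). {a<..<b}) P \<and> (\<Sum>(a, b)\<in>P. b - a) < d"
    then have fin: "finite P" and ab: "\<And>a b. (a, b) \<in> P \<Longrightarrow> a \<le> b \<and> 0 \<le> a \<and> b \<le> T"
      and disj: "disjoint_family_on (\<lambda>(a, b). {a<..<b}) P" and small: "(\<Sum>(a, b)\<in>P. b - a) < d"
      by fastforce+
    let ?I = "\<lambda>(a, b). {a<..<b::real}"
    have gi: "set_integrable lebesgue A (\<lambda>s. \<bar>g s\<bar>)" if "A \<in> sets lebesgue" for A
      unfolding set_integrable_def using that g by (intro integrable_mult_indicator) auto
    have "norm (c + (LINT s:{0..b}|lebesgue. w s) - (c + (LINT s:{0..a}|lebesgue. w s)))
        \<le> (LINT s:{a<..<b}|lebesgue. \<bar>g s\<bar>)" if P: "(a, b) \<in> P" for a b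
    proof -
      have "(LINT s:{0..b}|lebesgue. w s) = (LINT s:{0..a}|lebesgue. w s) + (LINT s:{a..b}|lebesgue. w s)"
        by (rule set_integral_Icc_split) (use ab[OF P] set_integrable_subset[OF w] in auto)
      then have "norm (c + (LINT s:{0..b}|lebesgue. w s) - (c + (LINT s:{0..a}|lebesgue. w s)))
         = norm (LINT s:{a..b}|lebesgue. w s)" by simp
      also have "\<dots> \<le> (LINT s:{a..b}|lebesgue. norm (w s))" by (rule set_integral_norm_le)
      also have "\<dots> = (LINT s:{a..b}|lebesgue. \<bar>g s\<bar>)"
        by (rule set_lebesgue_integral_cong) (use ab[OF P] in \<open>auto simp: g_def\<close>)
      \<comment> \<open>Only the open intervals are disjoint in \<open>abs_cont_on\<close>, so the
        endpoints are dropped before the integrals are added over the union.\<close>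
      also have "\<dots> = (LINT s:{a<..<b}|lebesgue. \<bar>g s\<bar>)"
      proof (rule set_integral_null_delta)
        have "({a..b} - {a<..<b}) \<union> ({a<..<b} - {a..b}) \<subseteq> {a, b}" by auto
        then show "({a..b} - {a<..<b}) \<union> ({a<..<b} - {a..b}) \<in> null_sets lebesgue"
          using negligible_subset[of "{a, b}"] by (simp flip: negligible_iff_null_sets)
      qed (use g in auto)
      finally show ?thesis .
    qed
    then have "(\<Sum>(a, b)\<in>P. norm (c + (LINT s:{0..b}|lebesgue. w s) - (c + (LINT s:{0..a}|lebesgue. w s))))
        \<le> (\<Sum>p\<in>P. LINT s:?I p|lebesgue. \<bar>g s\<bar>)"
      by (intro sum_mono) auto
    also have "\<dots> = (LINT s:(\<Union>p\<in>P. ?I p)|lebesgue. \<bar>g s\<bar>)"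
      by (rule set_integral_finite_Union[symmetric]) (use fin disj gi in \<open>auto split: prod.splits\<close>)
    also have "\<dots> < e"
    proof (rule dd)
      show "(\<Union>p\<in>P. ?I p) \<in> sets lebesgue" using fin by (auto split: prod.splits)
      have "emeasure lebesgue (\<Union>p\<in>P. ?I p) = (\<Sum>p\<in>P. emeasure lebesgue (?I p))"
        by (rule sum_emeasure[symmetric]) (use fin disj in \<open>auto split: prod.splits\<close>)
      also have "\<dots> = (\<Sum>p\<in>P. ennreal (snd p - fst p))"
        by (intro sum.cong) (use ab in \<open>auto split: prod.splits\<close>)
      also have "\<dots> = ennreal (\<Sum>p\<in>P. snd p - fst p)"
        by (rule sum_ennreal) (use ab in auto)
      also have "\<dots> < ennreal d"
        using small d by (intro ennreal_lessI) (auto simp: case_prod_beta)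
      finally show "emeasure lebesgue (\<Union>p\<in>P. ?I p) < ennreal d" .
    qed
    finally show "(\<Sum>(a, b)\<in>P. norm (c + (LINT s:{0..b}|lebesgue. w s) - (c + (LINT s:{0..a}|lebesgue. w s)))) < e" .
  qed
qed

subsection \<open>Absolutely continuous functions\<close>

text \<open>The single source of closure properties: differences, bilinear products and isometric
  images all have increments controlled in this way. A comparison with one function takes
  \<open>f = g\<close>.\<close>

lemma abs_cont_on_comparison:
  fixes f :: "real \<Rightarrow> 'a::real_normed_vector" and g :: "real \<Rightarrow> 'b::real_normed_vector"
    and h :: "real \<Rightarrow> 'c::real_normed_vector"
  assumes f: "abs_cont_on X f" and g: "abs_cont_on X g"
    and le: "\<And>a b. a \<in> X \<Longrightarrow> b \<in> X \<Longrightarrow> norm (h b - h a) \<le> K * (norm (f b - f a) + norm (g b - g a))"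
  shows "abs_cont_on X h"
  unfolding abs_cont_on_def
proof (intro allI impI)
  fix e :: real assume e: "e > 0"
  define K' where "K' = max K 1"
  have K': "K' > 0" by (simp add: K'_def)
  have e': "e / (2 * K') > 0" using e K' by simp
  let ?ok = "\<lambda>d P. finite P \<and> (\<forall>(a, b)\<in>P. a \<le> b \<and> {a..b} \<subseteq> X) \<and>
        disjoint_family_on (\<lambda>(a, b). {a<..<b}) P \<and> (\<Sum>(a, b)\<in>P. b - a) < d"
  obtain d1 where d1: "d1 > 0" "\<And>P. ?ok d1 P \<Longrightarrow> (\<Sum>(a, b)\<in>P. norm (f b - f a)) < e / (2 * K')"
    using f[unfolded abs_cont_on_def, rule_format, OF e'] by blast
  obtain d2 where d2: "d2 > 0" "\<And>P. ?ok d2 P \<Longrightarrow> (\<Sum>(a, b)\<in>P. norm (g b - g a)) < e / (2 * K')"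
    using g[unfolded abs_cont_on_def, rule_format, OF e'] by blast
  show "\<exists>d>0. \<forall>P. ?ok d P \<longrightarrow> (\<Sum>(a, b)\<in>P. norm (h b - h a)) < e"
  proof (intro exI[of _ "min d1 d2"] conjI allI impI)
    fix P assume P: "?ok (min d1 d2) P"
    have "norm (h b - h a) \<le> K' * norm (f b - f a) + K' * norm (g b - g a)" if "(a, b) \<in> P" for a b
    proof -
      have "a \<le> b" "{a..b} \<subseteq> X" using P that by auto
      then have "a \<in> X" "b \<in> X" by auto
      from le[OF this] have "norm (h b - h a) \<le> K * (norm (f b - f a) + norm (g b - g a))" .
      also have "\<dots> \<le> K' * (norm (f b - f a) + norm (g b - g a))"
        by (intro mult_right_mono) (auto simp: K'_def)
      finally show ?thesis by (simp add: distrib_left)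
    qed
    then have "(\<Sum>(a, b)\<in>P. norm (h b - h a)) \<le> (\<Sum>p\<in>P. K' * (case p of (a, b) \<Rightarrow> norm (f b - f a)) + K' * (case p of (a, b) \<Rightarrow> norm (g b - g a)))"
      by (intro sum_mono) auto
    also have "\<dots> = K' * (\<Sum>(a, b)\<in>P. norm (f b - f a)) + K' * (\<Sum>(a, b)\<in>P. norm (g b - g a))"
      by (simp add: sum.distrib sum_distrib_left)
    also have "\<dots> < K' * (e / (2 * K')) + K' * (e / (2 * K'))"
      using d1(2)[of P] d2(2)[of P] P K' by (intro add_strict_mono mult_strict_left_mono) auto
    also have "\<dots> = e" using K' by (simp add: field_simps)
    finally show "(\<Sum>(a, b)\<in>P. norm (h b - h a)) < e" .
  qed (use d1 d2 in auto)
qed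

lemma abs_cont_on_subset:
  assumes "abs_cont_on X f" "Y \<subseteq> X"
  shows "abs_cont_on Y f"
  unfolding abs_cont_on_def
proof (intro allI impI)
  fix e :: real assume "e > 0"
  then obtain d where d: "d > 0" "\<And>P. finite P \<and> (\<forall>(a, b)\<in>P. a \<le> b \<and> {a..b} \<subseteq> X) \<and>
        disjoint_family_on (\<lambda>(a, b). {a<..<b}) P \<and> (\<Sum>(a, b)\<in>P. b - a) < d \<Longrightarrow>
        (\<Sum>(a, b)\<in>P. norm (f b - f a)) < e"
    using assms(1) unfolding abs_cont_on_def by blast
  show "\<exists>d>0. \<forall>P. finite P \<and> (\<forall>(a, b)\<in>P. a \<le> b \<and> {a..b} \<subseteq> Y) \<and>
        disjoint_family_on (\<lambda>(a, b). {a<..<b}) P \<and> (\<Sum>(a, b)\<in>P. b - a) < d \<longrightarrow>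
        (\<Sum>(a, b)\<in>P. norm (f b - f a)) < e"
    using d assms(2) by (intro exI[of _ d]) fastforce
qed

lemma abs_cont_on_imp_continuous_on:
  assumes f: "abs_cont_on {a..b} f"
  shows "continuous_on {a..b} f"
  unfolding continuous_on_iff
proof (intro ballI allI impI)
  fix x and e :: real assume x: "x \<in> {a..b}" and e: "e > 0"
  obtain d where d: "d > 0" "\<And>P. finite P \<and> (\<forall>(u, v)\<in>P. u \<le> v \<and> {u..v} \<subseteq> {a..b}) \<and>
        disjoint_family_on (\<lambda>(u, v). {u<..<v}) P \<and> (\<Sum>(u, v)\<in>P. v - u) < d \<Longrightarrow>
        (\<Sum>(u, v)\<in>P. norm (f v - f u)) < e"
    using f[unfolded abs_cont_on_def, rule_format, OF e] by blast
  have "dist (f y) (f x) < e" if y: "y \<in> {a..b}" "dist y x < d" for y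
  proof (cases "x \<le> y")
    case True
    then show ?thesis using d(2)[of "{(x, y)}"] x y by (auto simp: disjoint_family_on_def dist_norm)
  next
    case False
    then show ?thesis using d(2)[of "{(y, x)}"] x y
      by (auto simp: disjoint_family_on_def dist_norm norm_minus_commute)
  qed
  then show "\<exists>d>0. \<forall>x'\<in>{a..b}. dist x' x < d \<longrightarrow> dist (f x') (f x) < e"
    using d(1) by blast
qed

text \<open>The gauge is chosen in two ways. At a tag where the derivative exists it is small enough
  for the linear approximation; at a tag in the null set \<open>N\<close> it is an open set of
  measure below the \<open>\<delta>\<close> of absolute continuity, so the increments over all
  intervals tagged in \<open>N\<close> add up to little. With a gauge integral, integrability of
  \<open>f'\<close> is part of the conclusion.\<close>

lemma has_integral_vector_derivative_abs_cont:
  fixes f :: "real \<Rightarrow> 'a::real_normed_vector"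
  assumes ac: "abs_cont_on {a..b} f" and ab: "a \<le> b"
    and der: "AE t in lebesgue_on {a..b}. (f has_vector_derivative f' t) (at t within {a..b})"
  shows "(f' has_integral (f b - f a)) {a..b}"
proof (cases "a = b")
  case False
  then have ab: "a < b" using ab by simp
  have "AE t in lebesgue. t \<in> {a..b} \<longrightarrow> (f has_vector_derivative f' t) (at t within {a..b})"
    using der by (subst (asm) AE_restrict_space_iff) auto
  then obtain N where N: "negligible N"
    and derN: "\<And>t. t \<in> {a..b} \<Longrightarrow> t \<notin> N \<Longrightarrow> (f has_vector_derivative f' t) (at t within {a..b})"
    unfolding eventually_ae_filter_negligible by blast
  \<comment> \<open>With the value 0 on \<open>N\<close>, the Riemann terms tagged there vanish and
    only the increments of \<open>f\<close> remain.\<close>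
  define g where "g t = (if t \<in> N then 0 else f' t)" for t
  have "(g has_integral (f b - f a)) {a..b}"
    unfolding has_integral_factor_content_real
  proof (intro allI impI)
    fix e :: real assume e: "e > 0"
    have e1: "e / 2 > 0" and e2: "e / 2 * (b - a) > 0" using e ab by auto
    have "\<exists>r>0. \<forall>y\<in>{a..b}. norm (y - t) < r \<longrightarrow>
        norm (f y - f t - (y - t) *\<^sub>R f' t) \<le> e / 2 * norm (y - t)" if "t \<in> {a..b}" "t \<notin> N" for t
      using derN[OF that] e1 unfolding has_vector_derivative_def has_derivative_within_alt by blast
    then obtain r where r: "\<And>t. t \<in> {a..b} \<Longrightarrow> t \<notin> N \<Longrightarrow> r t > 0"
      and rr: "\<And>t y. t \<in> {a..b} \<Longrightarrow> t \<notin> N \<Longrightarrow> y \<in> {a..b} \<Longrightarrow> norm (y - t) < r t \<Longrightarrow>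
        norm (f y - f t - (y - t) *\<^sub>R f' t) \<le> e / 2 * norm (y - t)" by metis
    obtain \<delta> where \<delta>: "\<delta> > 0" "\<And>P. finite P \<and> (\<forall>(u, v)\<in>P. u \<le> v \<and> {u..v} \<subseteq> {a..b}) \<and>
        disjoint_family_on (\<lambda>(u, v). {u<..<v}) P \<and> (\<Sum>(u, v)\<in>P. v - u) < \<delta> \<Longrightarrow>
        (\<Sum>(u, v)\<in>P. norm (f v - f u)) < e / 2 * (b - a)"
      using ac[unfolded abs_cont_on_def, rule_format, OF e2] by blast
    have NL: "N \<in> sets lebesgue" "N \<in> lmeasurable"
      using N negligible_imp_sets negligible_imp_measurable by auto
    obtain G where G: "open G" "N \<subseteq> G" "G - N \<in> lmeasurable" "emeasure lebesgue (G - N) < ennreal \<delta>"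
      using sets_lebesgue_outer_open[OF NL(1) \<delta>(1)] by blast
    have "G = (G - N) \<union> N" using G(2) by blast
    then have G3: "G \<in> lmeasurable" using fmeasurable.Un[OF G(3) NL(2)] by simp
    have "measure lebesgue (G - N) < \<delta>"
    proof -
      have "emeasure lebesgue (G - N) = ennreal (measure lebesgue (G - N))"
        using G(3) by (intro emeasure_eq_ennreal_measure) (auto simp: fmeasurable_def)
      then show ?thesis using G(4) by (simp only: ennreal_less_iff measure_nonneg)
    qed
    then have G4: "measure lebesgue G < \<delta>"
      using measure_Un_le[of "G - N" lebesgue N] NL(1) G(3) \<open>G = (G - N) \<union> N\<close> negligible_imp_measure0[OF N]
      by (simp add: fmeasurable_def)
    define d where "d x = (if x \<in> N then G else if x \<in> {a..b} then ball x (r x) else ball x 1)" for x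
    have gd: "gauge d" unfolding gauge_def d_def using G r by auto
    have key: "norm ((\<Sum>(x, k)\<in>p. measure lborel k *\<^sub>R g x) - (f b - f a)) \<le> e * measure lborel {a..b}"
      if p: "p tagged_division_of {a..b}" and fine: "d fine p" for p
    proof -
      have finp: "finite p" using p by blast
      have shape: "\<exists>u v. k = {u..v} \<and> u \<le> x \<and> x \<le> v \<and> a \<le> u \<and> v \<le> b" if "(x, k) \<in> p" for x k
        using tagged_division_ofD(2,3,4)[OF p that] by (fastforce simp: box_real)
      let ?D = "\<lambda>(x, k). measure lborel k *\<^sub>R g x - (f (Sup k) - f (Inf k))"
      let ?pN = "{q \<in> p. fst q \<in> N}"
      have "(\<Sum>(x, k)\<in>p. measure lborel k *\<^sub>R g x) - (f b - f a) = (\<Sum>q\<in>p. ?D q)"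
        using additive_tagged_division_1[OF less_imp_le[OF ab] p, of f]
        by (simp add: case_prod_beta sum_subtractf)
      also have "norm \<dots> \<le> (\<Sum>q\<in>p. norm (?D q))" by (rule norm_sum)
      also have "\<dots> = (\<Sum>q\<in>?pN. norm (?D q)) + (\<Sum>q\<in>p - ?pN. norm (?D q))"
        using finp by (subst sum.subset_diff[of ?pN p]) auto
      also have "(\<Sum>q\<in>p - ?pN. norm (?D q)) \<le> (\<Sum>q\<in>p - ?pN. e / 2 * measure lborel (snd q))"
      proof (rule sum_mono)
        fix q assume q: "q \<in> p - ?pN"
        obtain x k where xk: "q = (x, k)" by (cases q)
        with q have xkp: "(x, k) \<in> p" and xN: "x \<notin> N" by auto
        obtain u v where uv: "k = {u..v}" "u \<le> x" "x \<le> v" "a \<le> u" "v \<le> b" using shape[OF xkp] by blast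
        have x: "x \<in> {a..b}" using uv by auto
        have "k \<subseteq> ball x (r x)" using fine xkp xN x unfolding fine_def d_def by fastforce
        moreover have "u \<in> k" "v \<in> k" using uv by auto
        ultimately have "u \<in> ball x (r x)" "v \<in> ball x (r x)" by blast+
        then have "norm (u - x) < r x" "norm (v - x) < r x" by (auto simp: dist_norm norm_minus_commute)
        then have 1: "norm (f u - f x - (u - x) *\<^sub>R f' x) \<le> e / 2 * (x - u)"
          and 2: "norm (f v - f x - (v - x) *\<^sub>R f' x) \<le> e / 2 * (v - x)"
          using rr[OF x xN, of u] rr[OF x xN, of v] uv by auto
        \<comment> \<open>Both endpoints are compared with the tag; as u \<le> x \<le> v, the two
          errors add up to e / 2 times v - u.\<close>
        have "?D q = (f u - f x - (u - x) *\<^sub>R f' x) - (f v - f x - (v - x) *\<^sub>R f' x)"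
          using uv xN by (simp add: xk g_def algebra_simps)
        then have "norm (?D q) \<le> e / 2 * (x - u) + e / 2 * (v - x)"
          using norm_triangle_ineq4[of "f u - f x - (u - x) *\<^sub>R f' x" "f v - f x - (v - x) *\<^sub>R f' x"] 1 2 by simp
        also have "\<dots> = e / 2 * measure lborel (snd q)" using uv by (simp add: xk field_simps)
        finally show "norm (?D q) \<le> e / 2 * measure lborel (snd q)" .
      qed
      also have "\<dots> \<le> (\<Sum>q\<in>p. e / 2 * measure lborel (snd q))"
        using finp e by (intro sum_mono2) auto
      also have "\<dots> = e / 2 * (b - a)"
        unfolding sum_distrib_left[symmetric]
        using additive_content_tagged_division[of p a b] p ab by (simp add: case_prod_beta)
      also have "(\<Sum>q\<in>?pN. norm (?D q)) \<le> e / 2 * (b - a)"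
      proof -
        let ?h = "\<lambda>q. (Inf (snd q), Sup (snd q :: real set))"
        have inter: "interior (snd q) \<inter> interior (snd q') = {}" if "q \<in> p" "q' \<in> p" "q \<noteq> q'" for q q'
          using tagged_division_ofD(5)[OF p, of "fst q" "snd q" "fst q'" "snd q'"] that
          by (metis prod.collapse)
        have shape': "\<exists>u v. snd q = {u..v} \<and> u \<le> fst q \<and> fst q \<le> v \<and> a \<le> u \<and> v \<le> b" if "q \<in> p" for q
          using shape[of "fst q" "snd q"] that by simp
        \<comment> \<open>Absolute continuity speaks of a set of pairs, so the passage from tagged
          intervals has to be injective. Two different elements with the same interval have disjoint
          interiors; the interval is then a single point, and the tags agree as well.\<close>
        have inj: "inj_on ?h ?pN"
        proof (rule inj_onI)
          fix q q' assume q: "q \<in> ?pN" "q' \<in> ?pN" and eq: "?h q = ?h q'"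
          obtain u v where uv: "snd q = {u..v}" "u \<le> fst q" "fst q \<le> v" using shape'[of q] q by auto
          obtain u' v' where uv': "snd q' = {u'..v'}" "u' \<le> fst q'" "fst q' \<le> v'" using shape'[of q'] q by auto
          have "u = u'" "v = v'" using eq uv uv' by auto
          show "q = q'"
          proof (rule ccontr)
            assume "q \<noteq> q'"
            then have "{u<..<v} = {}"
              using inter[of q q'] q uv uv' \<open>u = u'\<close> \<open>v = v'\<close> by auto
            then have "u = v" using uv by auto
            then show False using uv uv' \<open>u = u'\<close> \<open>v = v'\<close> \<open>q \<noteq> q'\<close> by (metis order_antisym prod.collapse)
          qed
        qed
        have disj: "disjoint_family_on (\<lambda>(u, v). {u<..<v}) (?h ` ?pN)"
          unfolding disjoint_family_on_def
        proof (intro ballI impI)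
          fix P P' assume PP: "P \<in> ?h ` ?pN" "P' \<in> ?h ` ?pN" "P \<noteq> P'"
          then obtain q q' where q: "q \<in> ?pN" "P = ?h q" "q' \<in> ?pN" "P' = ?h q'" by blast
          then have "interior (snd q) \<inter> interior (snd q') = {}" using inter[of q q'] PP(3) by blast
          then show "(case P of (u, v) \<Rightarrow> {u<..<v}) \<inter> (case P' of (u, v) \<Rightarrow> {u<..<v}) = {}"
            using shape'[of q] shape'[of q'] q by auto
        qed
        have sub: "(\<Union>P\<in>?h ` ?pN. case P of (u, v) \<Rightarrow> {u<..<v}) \<subseteq> G"
        proof
          fix y assume "y \<in> (\<Union>P\<in>?h ` ?pN. case P of (u, v) \<Rightarrow> {u<..<v})"
          then obtain x k where q: "(x, k) \<in> p" "x \<in> N" "y \<in> {Inf k<..<Sup k}" by auto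
          obtain u v where uv: "k = {u..v}" "u \<le> x" "x \<le> v" using shape[OF q(1)] by blast
          then have "y \<in> k" using q(3) by auto
          moreover have "k \<subseteq> G" using fine q(1,2) unfolding fine_def d_def by fastforce
          ultimately show "y \<in> G" by blast
        qed
        have "(\<Sum>(u, v)\<in>?h ` ?pN. v - u) = (\<Sum>P\<in>?h ` ?pN. measure lebesgue (case P of (u, v) \<Rightarrow> {u<..<v}))"
          by (intro sum.cong) (use shape' in force)+
        also have "\<dots> = measure lebesgue (\<Union>P\<in>?h ` ?pN. case P of (u, v) \<Rightarrow> {u<..<v})"
        proof (rule measure_finite_Union[symmetric])
          fix P assume "P \<in> ?h ` ?pN"
          show "emeasure lebesgue (case P of (u, v) \<Rightarrow> {u<..<v}) \<noteq> \<infinity>"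
            using emeasure_bounded_finite[of "{fst P<..<snd P}"] by (simp add: case_prod_beta)
        qed (use finp disj in \<open>auto split: prod.splits\<close>)
        also have "\<dots> \<le> measure lebesgue G"
          by (rule measure_mono_fmeasurable[OF sub]) (use finp G3 in \<open>auto split: prod.splits\<close>)
        finally have small: "(\<Sum>(u, v)\<in>?h ` ?pN. v - u) < \<delta>" using G4 by simp
        have "(\<Sum>q\<in>?pN. norm (?D q)) = (\<Sum>q\<in>?pN. case ?h q of (u, v) \<Rightarrow> norm (f v - f u))"
          by (intro sum.cong) (auto simp: g_def norm_minus_commute)
        also have "\<dots> = (\<Sum>(u, v)\<in>?h ` ?pN. norm (f v - f u))"
          by (subst sum.reindex[OF inj]) simp
        also have "\<dots> < e / 2 * (b - a)"
        proof (rule \<delta>(2), intro conjI)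
          show "finite (?h ` ?pN)" using finp by simp
          show "\<forall>(u, v)\<in>?h ` ?pN. u \<le> v \<and> {u..v} \<subseteq> {a..b}" using shape' by fastforce
        qed (use disj small in auto)
        finally show ?thesis by simp
      qed
      finally have "norm ((\<Sum>(x, k)\<in>p. measure lborel k *\<^sub>R g x) - (f b - f a)) \<le> e / 2 * (b - a) + e / 2 * (b - a)"
        by simp
      then show ?thesis using ab by simp
    qed
    show "\<exists>d. gauge d \<and> (\<forall>p. p tagged_division_of {a..b} \<and> d fine p \<longrightarrow>
        norm ((\<Sum>(x, k)\<in>p. measure lborel k *\<^sub>R g x) - (f b - f a)) \<le> e * measure lborel {a..b})"
    proof (intro exI conjI allI impI)
      show "gauge d" by (rule gd)
    qed (rule key; simp)
  qed
  then show ?thesis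
    by (rule has_integral_spike[OF N, rotated]) (auto simp: g_def)
qed auto

subsection \<open>A Banach space copy of a complete inner product space\<close>

text \<open>The sort of a complete inner product space is not below \<open>banach\<close>, on which the Bochner
  integral is developed.  The theorems about integrals are therefore proved for an isomorphic copy
  of the space which has an instance of \<open>banach\<close>, and transferred along the isometry.\<close>

typedef 'a banach_copy = "UNIV :: 'a set" morphisms of_copy to_copy by auto

setup_lifting type_definition_banach_copy

instantiation banach_copy :: (real_vector) real_vector
begin

lift_definition zero_banach_copy :: "'a banach_copy" is 0 .
lift_definition plus_banach_copy :: "'a banach_copy \<Rightarrow> 'a banach_copy \<Rightarrow> 'a banach_copy" is "(+)" .
lift_definition minus_banach_copy :: "'a banach_copy \<Rightarrow> 'a banach_copy \<Rightarrow> 'a banach_copy" is "(-)" .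
lift_definition uminus_banach_copy :: "'a banach_copy \<Rightarrow> 'a banach_copy" is uminus .
lift_definition scaleR_banach_copy :: "real \<Rightarrow> 'a banach_copy \<Rightarrow> 'a banach_copy" is scaleR .

instance
  by (standard; transfer; simp add: algebra_simps)

end

instantiation banach_copy :: (real_inner) real_inner
begin

lift_definition norm_banach_copy :: "'a banach_copy \<Rightarrow> real" is norm .
lift_definition inner_banach_copy :: "'a banach_copy \<Rightarrow> 'a banach_copy \<Rightarrow> real" is inner .
definition "sgn (x :: 'a banach_copy) = x /\<^sub>R norm x"
definition "dist (x :: 'a banach_copy) y = norm (x - y)"
definition "(uniformity :: ('a banach_copy \<times> 'a banach_copy) filter)
  = (INF e\<in>{0<..}. principal {(x, y). dist x y < e})"
definition "open (U :: 'a banach_copy set)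
  \<longleftrightarrow> (\<forall>x\<in>U. \<forall>\<^sub>F (x', y) in uniformity. x' = x \<longrightarrow> y \<in> U)"

instance
proof
  fix x y z :: "'a banach_copy" and a :: real and U :: "'a banach_copy set"
  show "inner x y = inner y x" by (transfer; rule inner_commute)
  show "inner (x + y) z = inner x z + inner y z" by (transfer; rule inner_add_left)
  show "inner (a *\<^sub>R x) y = a * inner x y" "0 \<le> inner x x" "(inner x x = 0) = (x = 0)"
    by (transfer; simp)+
  show "norm x = sqrt (inner x x)" by (transfer; rule norm_eq_sqrt_inner)
qed (rule sgn_banach_copy_def dist_banach_copy_def uniformity_banach_copy_def open_banach_copy_def)+

end

lemma norm_of_copy [simp]: "norm (of_copy x) = norm x"
  by (transfer; rule refl)

lemma norm_to_copy [simp]: "norm (to_copy x) = norm x"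
  by (transfer; rule refl)

lemma of_to_copy [simp]: "of_copy (to_copy x) = x"
  by (rule to_copy_inverse) simp

lemma to_of_copy [simp]: "to_copy (of_copy x) = x"
  by (rule of_copy_inverse)

lemma bounded_linear_of_copy: "bounded_linear of_copy"
  by (rule bounded_linear_intro[of _ 1]; transfer; simp)

lemma bounded_linear_to_copy: "bounded_linear to_copy"
  by (rule bounded_linear_intro[of _ 1]; transfer; simp)

lemma inner_to_copy: "to_copy x \<bullet> to_copy y = x \<bullet> y"
  by (transfer; rule refl)

instance banach_copy :: ("{real_inner, complete_space}") complete_space
proof
  fix X :: "nat \<Rightarrow> 'a banach_copy"
  assume X: "Cauchy X"
  have "Cauchy (\<lambda>n. of_copy (X n))"
    using bounded_linear.Cauchy[OF bounded_linear_of_copy X] .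
  then obtain l where "(\<lambda>n. of_copy (X n)) \<longlonglongrightarrow> l"
    using Cauchy_convergent_iff convergent_def by blast
  from bounded_linear.tendsto[OF bounded_linear_to_copy this] show "convergent X"
    by (auto simp: convergent_def)
qed

instance banach_copy :: ("{real_inner, complete_space}") banach ..

instance banach_copy :: ("{real_inner, second_countable_topology}") second_countable_topology
proof
  obtain B :: "'a set set" where B: "countable B" "topological_basis B"
    using ex_countable_basis by blast
  let ?B = "(\<lambda>U. of_copy -` U) ` B"
  have cont: "continuous_on UNIV (of_copy :: 'a banach_copy \<Rightarrow> 'a)" "continuous_on UNIV (to_copy :: 'a \<Rightarrow> 'a banach_copy)"
    using linear_continuous_on bounded_linear_of_copy bounded_linear_to_copy by blast+
  have "topological_basis ?B"
  proof (rule topological_basisI)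
    fix U assume "U \<in> ?B"
    then show "open U"
      using cont(1) topological_basis_open[OF B(2)] by (auto intro: open_vimage)
  next
    fix V and x :: "'a banach_copy" assume V: "open V" "x \<in> V"
    have "open (to_copy -` V)" using V(1) cont(2) by (rule open_vimage)
    moreover have "of_copy x \<in> to_copy -` V" using V(2) by simp
    ultimately obtain U where U: "U \<in> B" "of_copy x \<in> U" "U \<subseteq> to_copy -` V"
      using B(2) topological_basisE by blast
    have "of_copy -` U \<subseteq> V"
    proof
      fix y :: "'a banach_copy" assume "y \<in> of_copy -` U"
      then have "to_copy (of_copy y) \<in> V" using U(3) by blast
      then show "y \<in> V" by simp
    qed
    then show "\<exists>B'\<in>?B. x \<in> B' \<and> B' \<subseteq> V" using U by (intro bexI[of _ "of_copy -` U"]) auto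
  qed
  then show "\<exists>B::'a banach_copy set set. countable B \<and> open = generate_topology B"
    using B(1) topological_basis_imp_subbasis by (intro exI[of _ ?B]) auto
qed

subsection \<open>Paths with integrable derivative\<close>

lemma continuous_on_imp_borel_measurable_lebesgue_on:
  fixes f :: "real \<Rightarrow> 'a::real_normed_vector"
  assumes "continuous_on {a..b} f"
  shows "f \<in> borel_measurable (lebesgue_on {a..b})"
proof -
  have "(\<lambda>x. indicator {a..b} x *\<^sub>R f x) \<in> borel_measurable borel"
    by (rule borel_measurable_continuous_on_indicator) (use assms in auto)
  then have "(\<lambda>x. indicator {a..b} x *\<^sub>R f x) \<in> borel_measurable lebesgue"
    by (intro measurable_completion) simp
  then show ?thesis by (subst borel_measurable_restrict_space_iff) auto
qed

text \<open>Integrability of \<open>w\<close> is expressed through its norm, since the usual properties of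
  \<open>set_integrable\<close> are not available outside of the sort \<open>banach\<close>.\<close>

definition ac_path :: "real \<Rightarrow> (real \<Rightarrow> 'a::{real_normed_vector, second_countable_topology}) \<Rightarrow> (real \<Rightarrow> 'a) \<Rightarrow> bool" where
  "ac_path T x w \<longleftrightarrow> abs_cont_on {0..T} x \<and>
     (AE t in lebesgue_on {0..T}. (x has_vector_derivative w t) (at t within {0..T})) \<and>
     w \<in> borel_measurable (lebesgue_on {0..T}) \<and> integrable (lebesgue_on {0..T}) (\<lambda>t. norm (w t))"

lemma set_integrable_iff_norm_integrable:
  fixes w :: "real \<Rightarrow> 'a::{banach, second_countable_topology}"
  shows "set_integrable lebesgue {0..T} w \<longleftrightarrow>
    w \<in> borel_measurable (lebesgue_on {0..T}) \<and> integrable (lebesgue_on {0..T}) (\<lambda>t. norm (w t))"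
proof -
  have "set_integrable lebesgue {0..T} w \<longleftrightarrow> integrable (lebesgue_on {0..T}) w"
    by (rule set_integrable_eq) simp
  then show ?thesis
    using integrable_norm_iff[of w "lebesgue_on {0..T}"] borel_measurable_integrable[of "lebesgue_on {0..T}" w]
    by blast
qed

lemma ac_path_indefinite_integral:
  fixes w :: "real \<Rightarrow> 'a::{banach, second_countable_topology}"
  shows "set_integrable lebesgue {0..T} w \<Longrightarrow> ac_path T (\<lambda>t. c + (LINT s:{0..t}|lebesgue. w s)) w"
  unfolding ac_path_def
  by (intro conjI abs_cont_on_indefinite_integral AE_has_vector_derivative_indefinite_integral)
    (simp_all only: set_integrable_iff_norm_integrable)

lemma ac_path_cong:
  assumes x: "ac_path T x w" and eq: "\<And>t. t \<in> {0..T} \<Longrightarrow> y t = x t"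
  shows "ac_path T y w"
  unfolding ac_path_def
proof (intro conjI)
  show "abs_cont_on {0..T} y"
    by (rule abs_cont_on_comparison[of _ x x _ 1]) (use x eq in \<open>auto simp: ac_path_def\<close>)
  have "AE t in lebesgue_on {0..T}. t \<in> space (lebesgue_on {0..T})" by (rule AE_space)
  moreover have "AE t in lebesgue_on {0..T}. (x has_vector_derivative w t) (at t within {0..T})"
    using x by (simp add: ac_path_def)
  ultimately show "AE t in lebesgue_on {0..T}. (y has_vector_derivative w t) (at t within {0..T})"
  proof eventually_elim
    case (elim t)
    then have "t \<in> {0..T}" by (simp add: space_restrict_space)
    show ?case
      by (rule has_vector_derivative_transform[of t _ y x]) (use \<open>t \<in> {0..T}\<close> elim eq in simp_all)
  qed
qed (use x in \<open>auto simp: ac_path_def\<close>)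

lemma ac_path_diff:
  assumes x: "ac_path T x w" and y: "ac_path T y v"
  shows "ac_path T (\<lambda>t. x t - y t) (\<lambda>t. w t - v t)"
  unfolding ac_path_def
proof (intro conjI)
  show "abs_cont_on {0..T} (\<lambda>t. x t - y t)"
  proof (rule abs_cont_on_comparison[of _ x y _ 1])
    fix a b
    have *: "x b - y b - (x a - y a) = (x b - x a) - (y b - y a)" by simp
    show "norm (x b - y b - (x a - y a)) \<le> 1 * (norm (x b - x a) + norm (y b - y a))"
      unfolding * mult_1 by (rule norm_triangle_ineq4)
  qed (use x y in \<open>auto simp: ac_path_def\<close>)
  have "AE t in lebesgue_on {0..T}. (x has_vector_derivative w t) (at t within {0..T})"
    "AE t in lebesgue_on {0..T}. (y has_vector_derivative v t) (at t within {0..T})"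
    using x y by (auto simp: ac_path_def)
  then show "AE t in lebesgue_on {0..T}. ((\<lambda>t. x t - y t) has_vector_derivative w t - v t) (at t within {0..T})"
    by eventually_elim (rule has_vector_derivative_diff)
  show "integrable (lebesgue_on {0..T}) (\<lambda>t. norm (w t - v t))"
    by (rule Bochner_Integration.integrable_bound[of _ "\<lambda>t. norm (w t) + norm (v t)"])
      (use x y in \<open>auto simp: ac_path_def intro!: norm_triangle_ineq4\<close>)
qed (use x y in \<open>auto simp: ac_path_def\<close>)

lemma ac_path_const: "ac_path T (\<lambda>t. c) (\<lambda>t. 0)"
  unfolding ac_path_def
proof (intro conjI)
  show "abs_cont_on {0..T} (\<lambda>t. c)"
    unfolding abs_cont_on_def
    by (intro allI impI exI[of _ "1::real"] conjI) (simp_all add: case_prod_unfold)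
qed auto

lemma ac_path_continuous_on: "ac_path T x w \<Longrightarrow> continuous_on {0..T} x"
  by (simp add: ac_path_def abs_cont_on_imp_continuous_on)

lemma ac_path_bounded:
  assumes "ac_path T x w"
  shows "\<exists>B\<ge>0. \<forall>t\<in>{0..T}. norm (x t) \<le> B"
proof -
  have "compact (x ` {0..T})"
    by (intro compact_continuous_image ac_path_continuous_on[OF assms]) auto
  then obtain B where "\<forall>y\<in>x ` {0..T}. norm y \<le> B"
    using compact_imp_bounded bounded_iff by blast
  then show ?thesis by (intro exI[of _ "max B 0"]) auto
qed

lemma borel_measurable_bilinear:
  fixes f :: "'d \<Rightarrow> 'a::{real_normed_vector, second_countable_topology}"
    and g :: "'d \<Rightarrow> 'b::{real_normed_vector, second_countable_topology}"
    and pr :: "'a \<Rightarrow> 'b \<Rightarrow> 'c::real_normed_vector"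
  assumes pr: "bounded_bilinear pr" and f: "f \<in> borel_measurable M" and g: "g \<in> borel_measurable M"
  shows "(\<lambda>t. pr (f t) (g t)) \<in> borel_measurable M"
proof (rule borel_measurable_continuous_Pair[OF f g])
  show "continuous_on UNIV (\<lambda>x. pr (fst x) (snd x))"
    by (intro bounded_bilinear.continuous_on[OF pr] continuous_intros)
qed

lemma integrable_norm_bilinear_bounded:
  fixes f :: "real \<Rightarrow> 'a::{real_normed_vector, second_countable_topology}"
    and g :: "real \<Rightarrow> 'b::{real_normed_vector, second_countable_topology}"
    and pr :: "'a \<Rightarrow> 'b \<Rightarrow> 'c::{real_normed_vector, second_countable_topology}"
  assumes pr: "bounded_bilinear pr" and f: "f \<in> borel_measurable (lebesgue_on {0..T})"
    and B: "\<And>t. t \<in> {0..T} \<Longrightarrow> norm (f t) \<le> B"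
    and g: "g \<in> borel_measurable (lebesgue_on {0..T})" "integrable (lebesgue_on {0..T}) (\<lambda>t. norm (g t))"
  shows "integrable (lebesgue_on {0..T}) (\<lambda>t. norm (pr (f t) (g t)))"
proof -
  interpret bounded_bilinear pr by (rule pr)
  obtain K where K: "K \<ge> 0" "\<And>a b. norm (pr a b) \<le> norm a * norm b * K" using nonneg_bounded by blast
  show ?thesis
  proof (rule Bochner_Integration.integrable_bound)
    show "integrable (lebesgue_on {0..T}) (\<lambda>t. B * K * norm (g t))" using g by simp
    show "(\<lambda>t. norm (pr (f t) (g t))) \<in> borel_measurable (lebesgue_on {0..T})"
      using borel_measurable_bilinear[OF pr f g(1)] by simp
    show "AE t in lebesgue_on {0..T}. norm (norm (pr (f t) (g t))) \<le> norm (B * K * norm (g t))"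
    proof (rule AE_I2)
      fix t assume "t \<in> space (lebesgue_on {0..T})"
      then have t: "t \<in> {0..T}" by (simp add: space_restrict_space)
      have B0: "B \<ge> 0" using B[OF t] norm_ge_zero order_trans by blast
      have "norm (pr (f t) (g t)) \<le> norm (f t) * norm (g t) * K" by (rule K)
      also have "\<dots> \<le> B * norm (g t) * K" using B[OF t] K(1) by (intro mult_right_mono) auto
      finally show "norm (norm (pr (f t) (g t))) \<le> norm (B * K * norm (g t))"
        using B0 K(1) by (simp add: abs_mult mult_ac)
    qed
  qed
qed

text \<open>One product rule for three uses: the energy x \<bullet> x, pairings with a fixed vector,
  and the rescaled path exp (\<omega> t) u t.\<close>

lemma ac_path_bilinear:
  fixes f :: "real \<Rightarrow> 'a::{real_normed_vector, second_countable_topology}"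
    and g :: "real \<Rightarrow> 'b::{real_normed_vector, second_countable_topology}"
    and pr :: "'a \<Rightarrow> 'b \<Rightarrow> 'c::{real_normed_vector, second_countable_topology}"
  assumes pr: "bounded_bilinear pr" and f: "ac_path T f f'" and g: "ac_path T g g'"
  shows "ac_path T (\<lambda>t. pr (f t) (g t)) (\<lambda>t. pr (f t) (g' t) + pr (f' t) (g t))"
  unfolding ac_path_def
proof (intro conjI)
  interpret bounded_bilinear pr by (rule pr)
  obtain K where K: "K \<ge> 0" "\<And>a b. norm (pr a b) \<le> norm a * norm b * K" using nonneg_bounded by blast
  obtain B1 where B1: "B1 \<ge> 0" "\<And>t. t \<in> {0..T} \<Longrightarrow> norm (f t) \<le> B1" using ac_path_bounded[OF f] by blast
  obtain B2 where B2: "B2 \<ge> 0" "\<And>t. t \<in> {0..T} \<Longrightarrow> norm (g t) \<le> B2" using ac_path_bounded[OF g] by blast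
  show "abs_cont_on {0..T} (\<lambda>t. pr (f t) (g t))"
  proof (rule abs_cont_on_comparison[of _ f g _ "K * (B1 + B2)"])
    fix a b assume ab: "a \<in> {0..T}" "b \<in> {0..T}"
    have "pr (f b) (g b) - pr (f a) (g a) = pr (f b - f a) (g b) + pr (f a) (g b - g a)"
      by (simp add: diff_left diff_right)
    then have "norm (pr (f b) (g b) - pr (f a) (g a)) \<le> norm (pr (f b - f a) (g b)) + norm (pr (f a) (g b - g a))"
      by (simp add: norm_triangle_ineq)
    also have "\<dots> \<le> norm (f b - f a) * norm (g b) * K + norm (f a) * norm (g b - g a) * K"
      by (intro add_mono K)
    also have "\<dots> \<le> norm (f b - f a) * (B1 + B2) * K + (B1 + B2) * norm (g b - g a) * K"
      using B1 B2 ab K by (intro add_mono mult_right_mono mult_left_mono) (auto intro: add_increasing add_increasing2)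
    finally show "norm (pr (f b) (g b) - pr (f a) (g a)) \<le> K * (B1 + B2) * (norm (f b - f a) + norm (g b - g a))"
      by (simp add: algebra_simps)
  qed (use f g in \<open>auto simp: ac_path_def\<close>)
  have "AE t in lebesgue_on {0..T}. (f has_vector_derivative f' t) (at t within {0..T})"
    "AE t in lebesgue_on {0..T}. (g has_vector_derivative g' t) (at t within {0..T})"
    using f g by (auto simp: ac_path_def)
  then show "AE t in lebesgue_on {0..T}. ((\<lambda>t. pr (f t) (g t)) has_vector_derivative
      pr (f t) (g' t) + pr (f' t) (g t)) (at t within {0..T})"
    by eventually_elim (rule has_vector_derivative)
  have fm: "f \<in> borel_measurable (lebesgue_on {0..T})" and gm: "g \<in> borel_measurable (lebesgue_on {0..T})"
    using f g by (auto intro!: continuous_on_imp_borel_measurable_lebesgue_on ac_path_continuous_on)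
  have f'm: "f' \<in> borel_measurable (lebesgue_on {0..T})" "integrable (lebesgue_on {0..T}) (\<lambda>t. norm (f' t))"
    and g'm: "g' \<in> borel_measurable (lebesgue_on {0..T})" "integrable (lebesgue_on {0..T}) (\<lambda>t. norm (g' t))"
    using f g by (auto simp: ac_path_def)
  have 1: "(\<lambda>t. pr (f t) (g' t)) \<in> borel_measurable (lebesgue_on {0..T})"
    by (rule borel_measurable_bilinear[OF pr fm g'm(1)])
  have 2: "(\<lambda>t. pr (f' t) (g t)) \<in> borel_measurable (lebesgue_on {0..T})"
    by (rule borel_measurable_bilinear[OF pr f'm(1) gm])
  have 3: "integrable (lebesgue_on {0..T}) (\<lambda>t. norm (pr (f t) (g' t)))"
    by (rule integrable_norm_bilinear_bounded[OF pr fm B1(2) g'm])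
  have 4: "integrable (lebesgue_on {0..T}) (\<lambda>t. norm (pr (f' t) (g t)))"
    by (rule integrable_norm_bilinear_bounded[OF flip gm B2(2) f'm])
  show m: "(\<lambda>t. pr (f t) (g' t) + pr (f' t) (g t)) \<in> borel_measurable (lebesgue_on {0..T})"
    using 1 2 by (rule borel_measurable_add)
  show "integrable (lebesgue_on {0..T}) (\<lambda>t. norm (pr (f t) (g' t) + pr (f' t) (g t)))"
    by (rule Bochner_Integration.integrable_bound[OF Bochner_Integration.integrable_add[OF 3 4]])
      (use m in \<open>auto intro!: norm_triangle_ineq\<close>)
qed

lemma ac_path_integral_real:
  fixes x :: "real \<Rightarrow> real"
  assumes x: "ac_path T x w" and t: "t \<in> {0..T}"
  shows "(LINT s:{0..t}|lebesgue. w s) = x t - x 0"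
proof -
  have "AE s in lebesgue. s \<in> {0..T} \<longrightarrow> (x has_vector_derivative w s) (at s within {0..T})"
    using x unfolding ac_path_def by (subst (asm) AE_restrict_space_iff) auto
  then have "AE s in lebesgue. s \<in> {0..t} \<longrightarrow> (x has_vector_derivative w s) (at s within {0..t})"
    by eventually_elim (use t has_vector_derivative_within_subset in fastforce)
  then have "AE s in lebesgue_on {0..t}. (x has_vector_derivative w s) (at s within {0..t})"
    by (subst AE_restrict_space_iff) auto
  then have "(w has_integral (x t - x 0)) {0..t}"
    using abs_cont_on_subset[of "{0..T}" x "{0..t}"] x t unfolding ac_path_def
    by (intro has_integral_vector_derivative_abs_cont) auto
  moreover have "set_integrable lebesgue {0..t} w"
    by (rule set_integrable_subset[of lebesgue "{0..T}"])
      (use x t in \<open>auto simp: ac_path_def set_integrable_iff_norm_integrable\<close>)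
  ultimately show ?thesis
    using set_lebesgue_integral_eq_integral(2) integral_unique by metis
qed

lemma set_integral_bounded_linear:
  fixes L :: "'a::{real_normed_vector, second_countable_topology} \<Rightarrow> 'b::{real_normed_vector, second_countable_topology}"
  assumes L: "bounded_linear L" and w: "set_integrable M A w"
  shows "set_integrable M A (\<lambda>s. L (w s))"
    and "(LINT s:A|M. L (w s)) = L (LINT s:A|M. w s)"
proof -
  interpret bounded_linear L by (rule L)
  have eq: "(\<lambda>s. indicat_real A s *\<^sub>R L (w s)) = (\<lambda>s. L (indicat_real A s *\<^sub>R w s))"
    by (simp add: scaleR)
  show "set_integrable M A (\<lambda>s. L (w s))"
    using w unfolding set_integrable_def eq by (rule integrable_bounded_linear[OF L])
  show "(LINT s:A|M. L (w s)) = L (LINT s:A|M. w s)"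
    using w unfolding set_integrable_def set_lebesgue_integral_def eq by (rule integral_bounded_linear[OF L])
qed

lemma ac_path_isometry:
  fixes L :: "'a::{real_normed_vector, second_countable_topology} \<Rightarrow> 'b::{real_normed_vector, second_countable_topology}"
  assumes L: "bounded_linear L" "\<And>x. norm (L x) = norm x" and x: "ac_path T x w"
  shows "ac_path T (\<lambda>t. L (x t)) (\<lambda>t. L (w t))"
  unfolding ac_path_def
proof (intro conjI)
  interpret bounded_linear L by (rule L)
  show "abs_cont_on {0..T} (\<lambda>t. L (x t))"
    by (rule abs_cont_on_comparison[of _ x x _ 1])
      (use x L(2) in \<open>auto simp: ac_path_def simp flip: diff\<close>)
  have "AE t in lebesgue_on {0..T}. (x has_vector_derivative w t) (at t within {0..T})"
    using x by (auto simp: ac_path_def)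
  then show "AE t in lebesgue_on {0..T}. ((\<lambda>t. L (x t)) has_vector_derivative L (w t)) (at t within {0..T})"
    by eventually_elim (rule has_vector_derivative)
  show "(\<lambda>t. L (w t)) \<in> borel_measurable (lebesgue_on {0..T})"
    using x by (intro borel_measurable_continuous_on[OF linear_continuous_on[OF L(1)]]) (auto simp: ac_path_def)
qed (use x L(2) in \<open>auto simp: ac_path_def\<close>)

text \<open>Integrability is obtained in the Banach copy and carried back; the value is identified
  by pairing with each vector \<open>h\<close>, which reduces it to the fundamental theorem for real
  functions.\<close>

lemma ac_path_integral:
  fixes x :: "real \<Rightarrow> 'a::{real_inner, complete_space, second_countable_topology}"
  assumes x: "ac_path T x w" and t: "t \<in> {0..T}"
  shows "set_integrable lebesgue {0..t} w" and "(LINT s:{0..t}|lebesgue. w s) = x t - x 0"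
proof -
  have "set_integrable lebesgue {0..T} (\<lambda>s. to_copy (w s))"
    using ac_path_isometry[OF bounded_linear_to_copy norm_to_copy x]
    unfolding ac_path_def set_integrable_iff_norm_integrable by blast
  then have "set_integrable lebesgue {0..t} (\<lambda>s. to_copy (w s))"
    by (rule set_integrable_subset) (use t in auto)
  from set_integral_bounded_linear(1)[OF bounded_linear_of_copy this]
  show wi: "set_integrable lebesgue {0..t} w" by simp
  have "(LINT s:{0..t}|lebesgue. w s) \<bullet> h = (x t - x 0) \<bullet> h" for h
  proof -
    have "ac_path T (\<lambda>t. x t \<bullet> h) (\<lambda>t. w t \<bullet> h)"
      using ac_path_bilinear[OF bounded_bilinear_inner x ac_path_const[of T h]] by simp
    from ac_path_integral_real[OF this t] show ?thesis
      using set_integral_bounded_linear(2)[OF bounded_linear_inner_left wi, of h] by (simp add: inner_diff_left)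
  qed
  then show "(LINT s:{0..t}|lebesgue. w s) = x t - x 0" using vector_eq_rdot by blast
qed

text \<open>The derivative of |x|^2 is 2 x \<bullet> w; the dissipation estimates and the value of
  the functional all rest on this identity.\<close>

lemma ac_path_energy:
  fixes x :: "real \<Rightarrow> 'a::{real_inner, second_countable_topology}"
  assumes x: "ac_path T x w" and t: "t \<in> {0..T}"
  shows "set_integrable lebesgue {0..T} (\<lambda>s. x s \<bullet> w s)"
    and "2 * (LINT s:{0..t}|lebesgue. x s \<bullet> w s) = (norm (x t))\<^sup>2 - (norm (x 0))\<^sup>2"
proof -
  have *: "ac_path T (\<lambda>t. x t \<bullet> x t) (\<lambda>t. 2 * (x t \<bullet> w t))"
    using ac_path_bilinear[OF bounded_bilinear_inner x x] by (simp add: inner_commute)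
  then have "set_integrable lebesgue {0..T} (\<lambda>s. 2 * (x s \<bullet> w s))"
    unfolding ac_path_def set_integrable_iff_norm_integrable by blast
  then show "set_integrable lebesgue {0..T} (\<lambda>s. x s \<bullet> w s)" by simp
  show "2 * (LINT s:{0..t}|lebesgue. x s \<bullet> w s) = (norm (x t))\<^sup>2 - (norm (x 0))\<^sup>2"
    using ac_path_integral_real[OF * t] by (simp add: power2_norm_eq_inner)
qed

lemma ac_path_exp: "ac_path T (\<lambda>t. exp (\<omega> * t)) (\<lambda>t. \<omega> * exp (\<omega> * t :: real))"
proof -
  have int: "set_integrable lebesgue {0..t} (\<lambda>t. \<omega> * exp (\<omega> * t))" for t
    by (rule absolutely_integrable_continuous_real) (intro continuous_intros)
  show ?thesis
  proof (rule ac_path_cong[OF ac_path_indefinite_integral[OF int, of T 1]])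
    fix t assume t: "t \<in> {0..T}"
    have "((\<lambda>t. \<omega> * exp (\<omega> * t)) has_integral (exp (\<omega> * t) - exp (\<omega> * 0))) {0..t}"
      using t by (intro fundamental_theorem_of_calculus)
        (auto intro!: derivative_eq_intros simp flip: has_real_derivative_iff_has_vector_derivative)
    then show "exp (\<omega> * t) = 1 + (LINT s:{0..t}|lebesgue. \<omega> * exp (\<omega> * s))"
      unfolding set_lebesgue_integral_eq_integral(2)[OF int, of t] by (simp only: integral_unique mult_zero_right exp_zero)
  qed
qed

subsection \<open>Explicit Euler paths\<close>

lemma set_integral_Ico_eq_Icc:
  fixes w :: "real \<Rightarrow> 'a::{banach, second_countable_topology}"
  assumes w: "set_integrable lebesgue {a..b} w"
  shows "(LINT s:{a..<b}|lebesgue. w s) = (LINT s:{a..b}|lebesgue. w s)"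
  unfolding set_lebesgue_integral_def
proof (rule integral_cong_AE)
  show "(\<lambda>s. indicat_real {a..b} s *\<^sub>R w s) \<in> borel_measurable lebesgue"
    using w unfolding set_integrable_def by (rule borel_measurable_integrable)
  have "set_integrable lebesgue {a..<b} w"
    by (rule set_integrable_subset[OF w]) auto
  then show "(\<lambda>s. indicat_real {a..<b} s *\<^sub>R w s) \<in> borel_measurable lebesgue"
    unfolding set_integrable_def by (rule borel_measurable_integrable)
  show "AE s in lebesgue. indicat_real {a..<b} s *\<^sub>R w s = indicat_real {a..b} s *\<^sub>R w s"
    unfolding eventually_ae_filter_negligible
    by (intro exI[of _ "{b}"]) (auto simp: indicator_def)
qed

lemma set_integral_Icc_refl:
  fixes w :: "real \<Rightarrow> 'a::{banach, second_countable_topology}"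
  assumes w: "set_integrable lebesgue {a..b} w" and "a \<le> b"
  shows "(LINT s:{a..a}|lebesgue. w s) = 0"
proof -
  have "set_integrable lebesgue {a..a} w"
    by (rule set_integrable_subset[OF w]) (use \<open>a \<le> b\<close> in auto)
  from set_integral_Ico_eq_Icc[OF this] show ?thesis by (simp add: set_lebesgue_integral_def)
qed

lemma set_integral_nonneg_real:
  fixes f :: "real \<Rightarrow> real"
  assumes "\<And>t. t \<in> A \<Longrightarrow> 0 \<le> f t"
  shows "0 \<le> (LINT s:A|lebesgue. f s)"
  unfolding set_lebesgue_integral_def
  by (rule Bochner_Integration.integral_nonneg) (use assms in \<open>auto simp: indicator_def\<close>)

lemma set_integral_Icc_mono:
  fixes f :: "real \<Rightarrow> real"
  assumes f: "set_integrable lebesgue {0..T} f" and f0: "\<And>t. t \<in> {0..T} \<Longrightarrow> 0 \<le> f t"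
    and a: "0 \<le> a" "a \<le> T"
  shows "(LINT s:{0..a}|lebesgue. f s) \<le> (LINT s:{0..T}|lebesgue. f s)"
proof -
  have "0 \<le> (LINT s:{a..T}|lebesgue. f s)"
    by (rule set_integral_nonneg_real) (use f0 a in auto)
  then show ?thesis using set_integral_Icc_split[OF f a] by simp
qed

lemma set_integrable_linear_growth:
  fixes w :: "real \<Rightarrow> 'a::{banach, second_countable_topology}"
  assumes w: "w \<in> borel_measurable (lebesgue_on {0..T})"
    and \<gamma>: "set_integrable lebesgue {0..T} \<gamma>"
    and le: "AE t in lebesgue_on {0..T}. norm (w t) \<le> \<gamma> t"
  shows "set_integrable lebesgue {0..T} w"
proof -
  have "integrable (lebesgue_on {0..T}) \<gamma>" using \<gamma> by (simp add: set_integrable_eq)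
  then have "integrable (lebesgue_on {0..T}) w"
    by (rule Bochner_Integration.integrable_bound[OF _ w])
      (use le in eventually_elim, auto intro: order_trans[OF _ abs_ge_self])
  then show ?thesis by (simp add: set_integrable_eq)
qed

lemma set_integral_norm_le_AE:
  fixes w :: "real \<Rightarrow> 'a::{banach, second_countable_topology}"
  assumes w: "set_integrable lebesgue {0..T} w" and \<gamma>: "set_integrable lebesgue {0..T} \<gamma>"
    and le: "AE t in lebesgue_on {0..T}. norm (w t) \<le> \<gamma> t" and ab: "0 \<le> a" "b \<le> T"
  shows "norm (LINT s:{a..b}|lebesgue. w s) \<le> (LINT s:{a..b}|lebesgue. \<gamma> s)"
proof -
  have "norm (LINT s:{a..b}|lebesgue. w s) \<le> (LINT s:{a..b}|lebesgue. norm (w s))"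
    by (rule set_integral_norm_le)
  also have "\<dots> \<le> (LINT s:{a..b}|lebesgue. \<gamma> s)"
  proof (rule set_integral_mono_AE)
    show "set_integrable lebesgue {a..b} (\<lambda>s. norm (w s))"
      by (rule set_integrable_subset[OF set_integrable_norm[OF w]]) (use ab in auto)
    show "set_integrable lebesgue {a..b} \<gamma>"
      by (rule set_integrable_subset[OF \<gamma>]) (use ab in auto)
    have "AE t in lebesgue. t \<in> {0..T} \<longrightarrow> norm (w t) \<le> \<gamma> t"
      using le by (subst (asm) AE_restrict_space_iff) auto
    then show "AE x\<in>{a..b} in lebesgue. norm (w x) \<le> \<gamma> x"
      by eventually_elim (use ab in auto)
  qed
  finally show ?thesis .
qed

text \<open>Over a step only the state is frozen; time keeps running inside the integral, because
  \<open>G\<close> is merely measurable in time. The conclusion forgets the grid: \<open>a\<close>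
  is the last node up to \<open>t\<close>, so \<open>v\<close> solves the equation with a delay of
  at most one step, and the bound \<open>R\<close> does not depend on \<open>N\<close>.\<close>

lemma explicit_euler_path:
  fixes G :: "real \<Rightarrow> 'a \<Rightarrow> 'a::{banach, second_countable_topology}"
  assumes T: "T > 0" and N: "N > 0"
    and meas: "\<And>u. u \<in> borel_measurable (lebesgue_on {0..T}) \<Longrightarrow>
      (\<lambda>t. G t (u t)) \<in> borel_measurable (lebesgue_on {0..T})"
    and C: "C \<ge> 0" and \<beta>: "set_integrable lebesgue {0..T} \<beta>" and \<beta>0: "\<And>t. t \<in> {0..T} \<Longrightarrow> 0 \<le> \<beta> t"
    and growth: "AE t in lebesgue_on {0..T}. \<forall>x. norm (G t x) \<le> C * norm x + \<beta> t"
    and R: "R = exp (C * T) * (norm x0 + (LINT s:{0..T}|lebesgue. \<beta> s))"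
  shows "\<exists>v. v \<in> borel_measurable (lebesgue_on {0..T}) \<and> (\<forall>t\<in>{0..T}. norm (v t) \<le> R) \<and>
     (\<forall>t\<in>{0..T}. \<exists>a\<in>{0..t}. t - a \<le> T / real N \<and> v t = x0 - (LINT s:{0..a}|lebesgue. G s (v s)))"
proof -
  define h where "h = T / real N"
  have h: "h > 0" and Nh: "real N * h = T" using T N by (auto simp: h_def)
  define p where "p = rec_nat x0 (\<lambda>i y. y - (LINT s:{real i * h..real (Suc i) * h}|lebesgue. G s y))"
  have p0: "p 0 = x0" and pS: "p (Suc i) = p i - (LINT s:{real i * h..real (Suc i) * h}|lebesgue. G s (p i))" for i
    by (simp_all add: p_def)
  define v where "v t = p (nat \<lfloor>t / h\<rfloor>)" for t
  have vm: "v \<in> borel_measurable (lebesgue_on {0..T})"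
  proof -
    have "(\<lambda>t::real. nat \<lfloor>t / h\<rfloor>) \<in> measurable borel (count_space UNIV)" by measurable
    then have "v \<in> borel_measurable borel"
      unfolding v_def by (rule measurable_compose) simp
    then show ?thesis by (intro measurable_restrict_space1 measurable_completion) simp
  qed
  have int_bound: "set_integrable lebesgue {0..T} (\<lambda>s. c + \<beta> s)" for c
    by (intro set_integral_add \<beta> set_integrable_const_lebesgue)
  have growth_const: "AE t in lebesgue_on {0..T}. norm (G t y) \<le> C * norm y + \<beta> t" for y
    using growth by eventually_elim auto
  have Gy: "set_integrable lebesgue {0..T} (\<lambda>s. G s y)" for y
    by (rule set_integrable_linear_growth[OF meas int_bound growth_const]) simp
  define b where "b i = (LINT s:{0..real i * h}|lebesgue. \<beta> s)" for i :: nat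
  have ih: "real i * h \<le> T" if "i \<le> N" for i
    using that h Nh by (metis mult_right_mono of_nat_le_iff less_imp_le)
  have b_nonneg: "0 \<le> b i" if "i \<le> N" for i
    unfolding b_def by (rule set_integral_nonneg_real) (use \<beta>0 ih[OF that] in auto)
  \<comment> \<open>Discrete Gronwall inequality: one step multiplies the norm by at most 1 + C h
    \<le> exp (C h) and adds the integral of \<open>\<beta>\<close> over the step.\<close>
  have p_bound: "norm (p i) \<le> exp (C * (real i * h)) * (norm x0 + b i)" if "i \<le> N" for i
    using that
  proof (induction i)
    case 0
    then show ?case by (simp add: p0 b_nonneg)
  next
    case (Suc i)
    have S: "real (Suc i) * h \<le> T" using ih[of "Suc i"] Suc.prems by simp
    have le: "real i * h \<le> real (Suc i) * h" using h by (intro mult_right_mono) auto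
    have i0: "0 \<le> real i * h" using h by simp
    define d where "d = (LINT s:{real i * h..real (Suc i) * h}|lebesgue. \<beta> s)"
    have bS: "b (Suc i) = b i + d"
      unfolding b_def d_def
      by (rule set_integral_Icc_split[OF set_integrable_subset[OF \<beta>]]) (use S le i0 in auto)
    have d0: "d \<ge> 0" unfolding d_def
      by (rule set_integral_nonneg_real) (use \<beta>0 i0 S in auto)
    have "norm (LINT s:{real i * h..real (Suc i) * h}|lebesgue. G s (p i))
        \<le> (LINT s:{real i * h..real (Suc i) * h}|lebesgue. C * norm (p i) + \<beta> s)"
      by (rule set_integral_norm_le_AE[OF Gy int_bound growth_const i0 S])
    also have "\<dots> = (LINT s:{real i * h..real (Suc i) * h}|lebesgue. C * norm (p i)) + d"
      unfolding d_def
      by (rule set_integral_add(2)[OF set_integrable_const_lebesgue set_integrable_subset[OF \<beta>]])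
        (use S i0 in auto)
    also have "\<dots> = h * (C * norm (p i)) + d"
      by (subst set_integral_const_lebesgue[OF le]) (simp add: algebra_simps)
    finally have "norm (p (Suc i)) \<le> norm (p i) + (h * (C * norm (p i)) + d)"
      unfolding pS by (intro norm_triangle_le_diff add_left_mono)
    also have "\<dots> = (1 + C * h) * norm (p i) + d" by (simp add: algebra_simps)
    also have "\<dots> \<le> exp (C * h) * (exp (C * (real i * h)) * (norm x0 + b i)) + exp (C * (real (Suc i) * h)) * d"
    proof (rule add_mono)
      show "(1 + C * h) * norm (p i) \<le> exp (C * h) * (exp (C * (real i * h)) * (norm x0 + b i))"
        using Suc by (intro mult_mono exp_ge_add_one_self) auto
      have "1 \<le> exp (C * (real (Suc i) * h))" using C h by simp
      then show "d \<le> exp (C * (real (Suc i) * h)) * d" using d0 by (simp add: mult_le_cancel_right1)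
    qed
    also have "exp (C * h) * (exp (C * (real i * h)) * (norm x0 + b i)) = exp (C * (real (Suc i) * h)) * (norm x0 + b i)"
      by (simp add: algebra_simps flip: exp_add)
    also have "exp (C * (real (Suc i) * h)) * (norm x0 + b i) + exp (C * (real (Suc i) * h)) * d
        = exp (C * (real (Suc i) * h)) * (norm x0 + b (Suc i))"
      by (simp add: bS distrib_left)
    finally show ?case .
  qed
  have index: "nat \<lfloor>t / h\<rfloor> \<le> N" "real (nat \<lfloor>t / h\<rfloor>) * h \<le> t" "t - real (nat \<lfloor>t / h\<rfloor>) * h \<le> h" if "t \<in> {0..T}" for t
  proof -
    have t0: "0 \<le> t / h" using that h by simp
    then have eq: "real (nat \<lfloor>t / h\<rfloor>) = of_int \<lfloor>t / h\<rfloor>" by simp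
    have "real (nat \<lfloor>t / h\<rfloor>) \<le> t / h" unfolding eq by simp
    then show 1: "real (nat \<lfloor>t / h\<rfloor>) * h \<le> t" using h by (simp add: pos_le_divide_eq)
    have "t / h < real (nat \<lfloor>t / h\<rfloor>) + 1" unfolding eq by linarith
    then show "t - real (nat \<lfloor>t / h\<rfloor>) * h \<le> h" using h by (simp add: pos_divide_less_eq algebra_simps)
    have "real (nat \<lfloor>t / h\<rfloor>) * h \<le> real N * h" using 1 that Nh by simp
    then show "nat \<lfloor>t / h\<rfloor> \<le> N" using h by (simp add: mult_le_cancel_right)
  qed
  have v_bound: "norm (v t) \<le> R" if t: "t \<in> {0..T}" for t
  proof -
    let ?i = "nat \<lfloor>t / h\<rfloor>"
    have "norm (v t) \<le> exp (C * (real ?i * h)) * (norm x0 + b ?i)"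
      unfolding v_def by (rule p_bound[OF index(1)[OF t]])
    also have "\<dots> \<le> exp (C * T) * (norm x0 + (LINT s:{0..T}|lebesgue. \<beta> s))"
    proof (intro mult_mono add_left_mono)
      show "exp (C * (real ?i * h)) \<le> exp (C * T)"
        using C ih[OF index(1)[OF t]] by (simp add: mult_left_mono)
      show "b ?i \<le> (LINT s:{0..T}|lebesgue. \<beta> s)"
        unfolding b_def by (rule set_integral_Icc_mono[OF \<beta> \<beta>0]) (use h ih[OF index(1)[OF t]] in auto)
    qed (use b_nonneg[OF index(1)[OF t]] in auto)
    finally show ?thesis by (simp add: R)
  qed
  have "AE t in lebesgue_on {0..T}. norm (G t (v t)) \<le> C * R + \<beta> t"
    using growth AE_space
  proof eventually_elim
    case (elim t)
    then have "norm (v t) \<le> R" by (intro v_bound) (simp add: space_restrict_space)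
    then have "C * norm (v t) \<le> C * R" using C by (rule mult_left_mono)
    moreover have "norm (G t (v t)) \<le> C * norm (v t) + \<beta> t" using elim by blast
    ultimately show ?case by linarith
  qed
  then have Gv: "set_integrable lebesgue {0..T} (\<lambda>s. G s (v s))"
    by (rule set_integrable_linear_growth[OF meas[OF vm] int_bound])
  have node: "p i = x0 - (LINT s:{0..real i * h}|lebesgue. G s (v s))" if "i \<le> N" for i
    using that
  proof (induction i)
    case 0
    show ?case using set_integral_Icc_refl[OF Gv] T by (simp add: p0)
  next
    case (Suc i)
    have S: "real (Suc i) * h \<le> T" using ih[of "Suc i"] Suc.prems by simp
    have le: "real i * h \<le> real (Suc i) * h" using h by (intro mult_right_mono) auto
    have i0: "0 \<le> real i * h" using h by simp
    let ?J = "{real i * h..real (Suc i) * h}" and ?J' = "{real i * h..<real (Suc i) * h}"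
    have sub: "?J \<subseteq> {0..T}" using S i0 by auto
    \<comment> \<open>At the right endpoint \<open>v\<close> already has its next value, so the step
      is taken half-open; the missing endpoint is a null set.\<close>
    have "v s = p i" if "s \<in> ?J'" for s
    proof -
      have "\<lfloor>s / h\<rfloor> = int i"
        using that h by (intro floor_unique) (auto simp: pos_le_divide_eq pos_divide_less_eq algebra_simps)
      then show ?thesis by (simp add: v_def)
    qed
    then have "(LINT s:?J'|lebesgue. G s (v s)) = (LINT s:?J'|lebesgue. G s (p i))"
      by (intro set_lebesgue_integral_cong) auto
    then have "(LINT s:?J|lebesgue. G s (v s)) = (LINT s:?J|lebesgue. G s (p i))"
      using set_integral_Ico_eq_Icc[OF set_integrable_subset[OF Gv _ sub]]
        set_integral_Ico_eq_Icc[OF set_integrable_subset[OF Gy _ sub]] by simp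
    moreover have "(LINT s:{0..real (Suc i) * h}|lebesgue. G s (v s))
        = (LINT s:{0..real i * h}|lebesgue. G s (v s)) + (LINT s:?J|lebesgue. G s (v s))"
      by (rule set_integral_Icc_split[OF set_integrable_subset[OF Gv]]) (use S le i0 in auto)
    ultimately show ?case using Suc by (simp add: pS)
  qed
  show ?thesis
  proof (intro exI[of _ v] conjI ballI)
    fix t assume t: "t \<in> {0..T}"
    show "\<exists>a\<in>{0..t}. t - a \<le> T / real N \<and> v t = x0 - (LINT s:{0..a}|lebesgue. G s (v s))"
    proof (intro bexI[of _ "real (nat \<lfloor>t / h\<rfloor>) * h"] conjI)
      show "v t = x0 - (LINT s:{0..real (nat \<lfloor>t / h\<rfloor>) * h}|lebesgue. G s (v s))"
        using node[OF index(1)[OF t]] by (simp only: v_def)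
    qed (use index[OF t] h in \<open>auto simp flip: h_def\<close>)
  qed (use vm v_bound in auto)
qed

subsection \<open>Monotone evolution equations\<close>

text \<open>Each step path \<open>v k\<close> is paired with the absolutely continuous path
  \<open>z k\<close> that has derivative \<open>- G s (v k s)\<close>. Monotonicity holds along the
  \<open>v k\<close>, so in the energy identity for \<open>z j - z k\<close> only the gaps between
  \<open>z\<close> and \<open>v\<close> contribute, and |z j - z k|^2 is bounded by a multiple of
  \<open>e j + e k\<close>.\<close>

lemma monotone_evolution_solution_banach:
  fixes G :: "real \<Rightarrow> 'a \<Rightarrow> 'a::{real_inner, banach, second_countable_topology}"
  assumes T: "T > 0"
    and meas: "\<And>u. u \<in> borel_measurable (lebesgue_on {0..T}) \<Longrightarrow>
      (\<lambda>t. G t (u t)) \<in> borel_measurable (lebesgue_on {0..T})"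
    and C: "C \<ge> 0" and \<beta>: "set_integrable lebesgue {0..T} \<beta>" and \<beta>0: "\<And>t. t \<in> {0..T} \<Longrightarrow> 0 \<le> \<beta> t"
    and growth: "AE t in lebesgue_on {0..T}. \<forall>x. norm (G t x) \<le> C * norm x + \<beta> t"
    and mono: "\<And>t x y. t \<in> {0..T} \<Longrightarrow> 0 \<le> (G t x - G t y) \<bullet> (x - y)"
    and demi: "\<And>t X x h. t \<in> {0..T} \<Longrightarrow> X \<longlonglongrightarrow> x \<Longrightarrow> (\<lambda>k. G t (X k) \<bullet> h) \<longlonglongrightarrow> G t x \<bullet> h"
  shows "\<exists>u. ac_path T u (\<lambda>t. - G t (u t)) \<and> u 0 = x0"
proof -
  define R where "R = exp (C * T) * (norm x0 + (LINT s:{0..T}|lebesgue. \<beta> s))"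
  \<comment> \<open>One integrable bound for \<open>G\<close> along all paths of norm at most
    \<open>R\<close>, uniform in the step size.\<close>
  define \<gamma> where "\<gamma> t = C * R + \<beta> t" for t
  have \<gamma>: "set_integrable lebesgue {0..T} \<gamma>"
    unfolding \<gamma>_def by (intro set_integral_add \<beta> set_integrable_const_lebesgue)
  have "0 \<le> (LINT s:{0..T}|lebesgue. \<beta> s)"
    by (rule set_integral_nonneg_real) (use \<beta>0 in auto)
  then have R0: "0 \<le> R" by (simp add: R_def)
  have \<gamma>0: "0 \<le> \<gamma> t" if "t \<in> {0..T}" for t using C R0 \<beta>0[OF that] by (simp add: \<gamma>_def)
  define \<Gamma> where "\<Gamma> = (LINT s:{0..T}|lebesgue. \<gamma> s)"
  have \<Gamma>0: "0 \<le> \<Gamma>" unfolding \<Gamma>_def by (rule set_integral_nonneg_real) (use \<gamma>0 in auto)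
  have dom: "AE t in lebesgue_on {0..T}. norm (G t (v t)) \<le> \<gamma> t" if "\<And>t. t \<in> {0..T} \<Longrightarrow> norm (v t) \<le> R" for v
    using growth AE_space
  proof eventually_elim
    case (elim t)
    then have "norm (v t) \<le> R" by (intro that) (simp add: space_restrict_space)
    then have "C * norm (v t) \<le> C * R" using C by (rule mult_left_mono)
    moreover have "norm (G t (v t)) \<le> C * norm (v t) + \<beta> t" using elim by blast
    ultimately show ?case by (simp add: \<gamma>_def)
  qed
  have "\<forall>k. \<exists>v. v \<in> borel_measurable (lebesgue_on {0..T}) \<and> (\<forall>t\<in>{0..T}. norm (v t) \<le> R) \<and>
     (\<forall>t\<in>{0..T}. \<exists>a\<in>{0..t}. t - a \<le> T / real (Suc k) \<and> v t = x0 - (LINT s:{0..a}|lebesgue. G s (v s)))"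
    by (intro allI explicit_euler_path[OF T _ meas C \<beta> \<beta>0 growth R_def]) auto
  from choice[OF this] obtain v where v: "\<forall>k. v k \<in> borel_measurable (lebesgue_on {0..T}) \<and>
     (\<forall>t\<in>{0..T}. norm (v k t) \<le> R) \<and> (\<forall>t\<in>{0..T}. \<exists>a\<in>{0..t}. t - a \<le> T / real (Suc k) \<and>
       v k t = x0 - (LINT s:{0..a}|lebesgue. G s (v k s)))" ..
  then have vm: "\<And>k. v k \<in> borel_measurable (lebesgue_on {0..T})"
    and vR: "\<And>k t. t \<in> {0..T} \<Longrightarrow> norm (v k t) \<le> R"
    and ve: "\<And>k t. t \<in> {0..T} \<Longrightarrow> \<exists>a\<in>{0..t}. t - a \<le> T / real (Suc k) \<and> v k t = x0 - (LINT s:{0..a}|lebesgue. G s (v k s))"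
    by blast+
  have Gd: "AE t in lebesgue_on {0..T}. norm (G t (v k t)) \<le> \<gamma> t" for k
    by (rule dom[OF vR])
  have Gi: "set_integrable lebesgue {0..T} (\<lambda>s. G s (v k s))" for k
    by (rule set_integrable_linear_growth[OF meas[OF vm] \<gamma> Gd])
  define z where "z k t = x0 + (LINT s:{0..t}|lebesgue. - G s (v k s))" for k t
  have Gi': "set_integrable lebesgue {0..T} (\<lambda>s. - G s (v k s))" for k
    using set_integrable_scaleR_right[of "-1" lebesgue "{0..T}" "\<lambda>s. G s (v k s)"] Gi by simp
  have z_eq: "z k t = x0 - (LINT s:{0..t}|lebesgue. G s (v k s))" if "t \<in> {0..T}" for k t
    unfolding z_def
    by (subst set_integral_uminus[OF set_integrable_subset[OF Gi]]) (use that in auto)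
  have zp: "ac_path T (z k) (\<lambda>s. - G s (v k s))" for k
    unfolding z_def by (rule ac_path_indefinite_integral[OF Gi'])
  define e where "e k = (SUP t\<in>{0..T}. norm (z k t - v k t))" for k
  \<comment> \<open>\<open>v k t\<close> is the value of \<open>z k\<close> at the last node
    \<open>a\<close>, so the gap is an integral over at most one step; it is uniformly small by
    absolute continuity of the integral of \<open>\<gamma>\<close>.\<close>
  have zv: "\<exists>a. 0 \<le> a \<and> a \<le> t \<and> t - a \<le> T / real (Suc k) \<and> norm (z k t - v k t) \<le> (LINT s:{a..t}|lebesgue. \<gamma> s)"
    if t: "t \<in> {0..T}" for k t
  proof -
    obtain a where a: "a \<in> {0..t}" "t - a \<le> T / real (Suc k)" "v k t = x0 - (LINT s:{0..a}|lebesgue. G s (v k s))"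
      using ve[OF t] by blast
    have "(LINT s:{0..t}|lebesgue. G s (v k s)) = (LINT s:{0..a}|lebesgue. G s (v k s)) + (LINT s:{a..t}|lebesgue. G s (v k s))"
      by (rule set_integral_Icc_split[OF set_integrable_subset[OF Gi]]) (use a t in auto)
    then have "norm (z k t - v k t) = norm (LINT s:{a..t}|lebesgue. G s (v k s))"
      unfolding z_eq[OF t] a(3) by (simp add: norm_minus_commute)
    also have "\<dots> \<le> (LINT s:{a..t}|lebesgue. \<gamma> s)"
      by (rule set_integral_norm_le_AE[OF Gi \<gamma> Gd]) (use a t in auto)
    finally show ?thesis using a by auto
  qed
  have bdd: "bdd_above ((\<lambda>t. norm (z k t - v k t)) ` {0..T})" for k
  proof (rule bdd_aboveI2)
    fix t assume t: "t \<in> {0..T}"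
    obtain a where a: "0 \<le> a" "a \<le> t" "norm (z k t - v k t) \<le> (LINT s:{a..t}|lebesgue. \<gamma> s)"
      using zv[OF t] by blast
    have "0 \<le> (LINT s:{0..a}|lebesgue. \<gamma> s)" by (rule set_integral_nonneg_real) (use \<gamma>0 a t in auto)
    moreover have "(LINT s:{0..t}|lebesgue. \<gamma> s) = (LINT s:{0..a}|lebesgue. \<gamma> s) + (LINT s:{a..t}|lebesgue. \<gamma> s)"
      by (rule set_integral_Icc_split[OF set_integrable_subset[OF \<gamma>]]) (use a t in auto)
    moreover have "(LINT s:{0..t}|lebesgue. \<gamma> s) \<le> \<Gamma>"
      unfolding \<Gamma>_def by (rule set_integral_Icc_mono[OF \<gamma> \<gamma>0]) (use t in auto)
    ultimately show "norm (z k t - v k t) \<le> \<Gamma>" using a(3) by linarith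
  qed
  have e_ge: "norm (z k t - v k t) \<le> e k" if "t \<in> {0..T}" for k t
    unfolding e_def by (rule cSUP_upper[OF that bdd])
  have e0: "0 \<le> e k" for k using order_trans[OF norm_ge_zero e_ge[of 0 k]] T by simp
  have e_lim: "e \<longlonglongrightarrow> 0"
  proof (rule LIMSEQ_I)
    fix r :: real assume r: "r > 0"
    have "integrable lebesgue (\<lambda>s. indicat_real {0..T} s *\<^sub>R \<gamma> s)"
      using \<gamma> by (simp add: set_integrable_def)
    from integral_small_if_measure_small[OF this, of "r / 2"] r
    obtain d where d: "d > 0" and small: "\<And>A. A \<in> sets lebesgue \<Longrightarrow> emeasure lebesgue A < ennreal d \<Longrightarrow>
        (LINT s:A|lebesgue. \<bar>indicat_real {0..T} s *\<^sub>R \<gamma> s\<bar>) < r / 2" by auto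
    obtain n where n: "T / real (Suc n) < d"
      using reals_Archimedean[of "d / T"] T d by (auto simp: field_simps)
    have "norm (e k - 0) < r" if k: "k \<ge> n" for k
    proof -
      have "e k \<le> r / 2"
        unfolding e_def
      proof (rule cSUP_least)
        show "{0..T} \<noteq> {}" using T by auto
        fix t assume t: "t \<in> {0..T}"
        obtain a where a: "0 \<le> a" "a \<le> t" "t - a \<le> T / real (Suc k)" "norm (z k t - v k t) \<le> (LINT s:{a..t}|lebesgue. \<gamma> s)"
          using zv[OF t] by blast
        have "T / real (Suc k) \<le> T / real (Suc n)" using k T by (intro divide_left_mono) auto
        then have "emeasure lebesgue {a..t} < ennreal d"
          using a n by (simp add: ennreal_less_iff)
        then have "(LINT s:{a..t}|lebesgue. \<bar>indicat_real {0..T} s *\<^sub>R \<gamma> s\<bar>) < r / 2" by (rule small[rotated]) simp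
        moreover have "(LINT s:{a..t}|lebesgue. \<bar>indicat_real {0..T} s *\<^sub>R \<gamma> s\<bar>) = (LINT s:{a..t}|lebesgue. \<gamma> s)"
          by (rule set_lebesgue_integral_cong) (use a t \<gamma>0 in auto)
        ultimately show "norm (z k t - v k t) \<le> r / 2" using a(4) by linarith
      qed
      then show ?thesis using e0[of k] r by simp
    qed
    then show "\<exists>no. \<forall>n\<ge>no. norm (e n - 0) < r" by blast
  qed
  have z0: "z k 0 = x0" for k
    unfolding z_def using set_integral_Icc_refl[OF Gi'] T by simp
  have cauchy_le: "(norm (z j t - z k t))\<^sup>2 \<le> 4 * \<Gamma> * e j + 4 * \<Gamma> * e k" if t: "t \<in> {0..T}" for j k t
  proof -
    let ?w = "\<lambda>s. - G s (v j s) - - G s (v k s)"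
    have p: "ac_path T (\<lambda>t. z j t - z k t) ?w" by (rule ac_path_diff[OF zp zp])
    have "(norm (z j t - z k t))\<^sup>2 = 2 * (LINT s:{0..t}|lebesgue. (z j s - z k s) \<bullet> ?w s)"
      using ac_path_energy(2)[OF p t] z0 by simp
    also have "(LINT s:{0..t}|lebesgue. (z j s - z k s) \<bullet> ?w s) \<le> (LINT s:{0..t}|lebesgue. 2 * (e j + e k) * \<gamma> s)"
    proof (rule set_integral_mono_AE)
      show "set_integrable lebesgue {0..t} (\<lambda>s. (z j s - z k s) \<bullet> ?w s)"
        by (rule set_integrable_subset[OF ac_path_energy(1)[OF p t]]) (use t in auto)
      show "set_integrable lebesgue {0..t} (\<lambda>s. 2 * (e j + e k) * \<gamma> s)"
        by (intro set_integrable_mult_right set_integrable_subset[OF \<gamma>]) (use t in auto)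
      have "AE s in lebesgue. s \<in> {0..T} \<longrightarrow> norm (G s (v j s)) \<le> \<gamma> s"
        "AE s in lebesgue. s \<in> {0..T} \<longrightarrow> norm (G s (v k s)) \<le> \<gamma> s"
        using Gd[of j] Gd[of k] by (simp_all add: AE_restrict_space_iff)
      then show "AE s\<in>{0..t} in lebesgue. (z j s - z k s) \<bullet> ?w s \<le> 2 * (e j + e k) * \<gamma> s"
      proof eventually_elim
        case (elim s)
        show ?case
        proof
          assume "s \<in> {0..t}"
          then have s: "s \<in> {0..T}" using t by auto
          define g where "g = G s (v j s) - G s (v k s)"
          define q where "q = (z j s - v j s) - (z k s - v k s)"
          \<comment> \<open>Each \<open>z\<close> is written as \<open>v\<close> plus its gap: the
            \<open>v\<close> part has the sign given by monotonicity, and the remainder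
            \<open>q\<close> is small.\<close>
          have "(z j s - z k s) \<bullet> ?w s = - (g \<bullet> (v j s - v k s)) - g \<bullet> q"
            unfolding g_def q_def by (simp add: inner_diff_left inner_diff_right inner_commute algebra_simps)
          also have "\<dots> \<le> norm g * norm q"
            using mono[OF s, of "v j s" "v k s"] norm_cauchy_schwarz[of "- g" q] unfolding g_def[symmetric] by simp
          also have "\<dots> \<le> (2 * \<gamma> s) * (e j + e k)"
          proof (rule mult_mono)
            show "norm g \<le> 2 * \<gamma> s"
              using norm_triangle_ineq4[of "G s (v j s)" "G s (v k s)"] elim s unfolding g_def by auto
            show "norm q \<le> e j + e k"
              using norm_triangle_ineq4[of "z j s - v j s" "z k s - v k s"] e_ge[OF s, of j] e_ge[OF s, of k]
              unfolding q_def by linarith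
          qed (use \<gamma>0[OF s] in auto)
          finally show "(z j s - z k s) \<bullet> ?w s \<le> 2 * (e j + e k) * \<gamma> s" by (simp add: mult_ac)
        qed
      qed
    qed
    also have "\<dots> \<le> 2 * (e j + e k) * \<Gamma>"
      unfolding \<Gamma>_def set_integral_mult_right
      by (intro mult_left_mono set_integral_Icc_mono[OF \<gamma> \<gamma>0]) (use t e0 in auto)
    finally show ?thesis by (simp add: algebra_simps)
  qed
  have "\<exists>l. (\<lambda>k. z k t) \<longlonglongrightarrow> l" if t: "t \<in> {0..T}" for t
  proof -
    have "(\<lambda>k. 4 * \<Gamma> * e k) \<longlonglongrightarrow> 0" using tendsto_mult_right_zero[OF e_lim, of "4 * \<Gamma>"] by simp
    from Cauchy_if_norm_diff_square_le[OF cauchy_le[OF t] this] show ?thesis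
      using Cauchy_convergent_iff convergent_def by blast
  qed
  then obtain u where zu: "\<And>t. t \<in> {0..T} \<Longrightarrow> (\<lambda>k. z k t) \<longlonglongrightarrow> u t" by metis
  have vu: "(\<lambda>k. v k t) \<longlonglongrightarrow> u t" if t: "t \<in> {0..T}" for t
  proof -
    have "(\<lambda>k. z k t - v k t) \<longlonglongrightarrow> 0"
      by (rule Lim_null_comparison[OF _ e_lim]) (use e_ge[OF t] in auto)
    from tendsto_diff[OF zu[OF t] this] show ?thesis by simp
  qed
  have um: "u \<in> borel_measurable (lebesgue_on {0..T})"
    by (rule borel_measurable_LIMSEQ_metric[OF vm]) (use vu in \<open>simp add: space_restrict_space\<close>)
  have uR: "norm (u t) \<le> R" if t: "t \<in> {0..T}" for t
    using tendsto_norm[OF vu[OF t]] by (rule LIMSEQ_le_const2) (use vR[OF t] in auto)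
  have Gu: "AE t in lebesgue_on {0..T}. norm (G t (u t)) \<le> \<gamma> t" by (rule dom[OF uR])
  have Gui: "set_integrable lebesgue {0..T} (\<lambda>s. G s (u s))"
    by (rule set_integrable_linear_growth[OF meas[OF um] \<gamma> Gu])
  have Gui': "set_integrable lebesgue {0..T} (\<lambda>s. - G s (u s))"
    using set_integrable_scaleR_right[of "-1" lebesgue "{0..T}" "\<lambda>s. G s (u s)"] Gui by simp
  have u_eq: "u t = x0 + (LINT s:{0..t}|lebesgue. - G s (u s))" if t: "t \<in> {0..T}" for t
  proof -
    have sub: "set_integrable lebesgue {0..t} f" if "set_integrable lebesgue {0..T} f" for f :: "real \<Rightarrow> 'a"
      by (rule set_integrable_subset[OF that]) (use t in auto)
    \<comment> \<open>\<open>G s (v k s)\<close> converges only weakly, so dominated convergence is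
      applied to its pairings with \<open>h\<close>.\<close>
    have "u t \<bullet> h = (x0 + (LINT s:{0..t}|lebesgue. - G s (u s))) \<bullet> h" for h
    proof -
      have "(\<lambda>k. LINT s|lebesgue. indicat_real {0..t} s *\<^sub>R (- G s (v k s) \<bullet> h)) \<longlonglongrightarrow>
          (LINT s|lebesgue. indicat_real {0..t} s *\<^sub>R (- G s (u s) \<bullet> h))"
      proof (rule integral_dominated_convergence[where w = "\<lambda>s. indicat_real {0..T} s *\<^sub>R (\<gamma> s * norm h)"])
        have "set_integrable lebesgue {0..t} (\<lambda>s. - G s (u s) \<bullet> h)"
          by (rule set_integral_bounded_linear(1)[OF bounded_linear_inner_left sub[OF Gui']])
        then show "(\<lambda>s. indicat_real {0..t} s *\<^sub>R (- G s (u s) \<bullet> h)) \<in> borel_measurable lebesgue"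
          unfolding set_integrable_def by (rule borel_measurable_integrable)
        have "set_integrable lebesgue {0..t} (\<lambda>s. - G s (v k s) \<bullet> h)" for k
          by (rule set_integral_bounded_linear(1)[OF bounded_linear_inner_left sub[OF Gi']])
        then show "(\<lambda>s. indicat_real {0..t} s *\<^sub>R (- G s (v k s) \<bullet> h)) \<in> borel_measurable lebesgue" for k
          unfolding set_integrable_def by (rule borel_measurable_integrable)
        show "integrable lebesgue (\<lambda>s. indicat_real {0..T} s *\<^sub>R (\<gamma> s * norm h))"
          using set_integrable_mult_left[of "norm h" lebesgue "{0..T}" \<gamma>] \<gamma> unfolding set_integrable_def by simp
        show "AE s in lebesgue. (\<lambda>k. indicat_real {0..t} s *\<^sub>R (- G s (v k s) \<bullet> h)) \<longlonglongrightarrow> indicat_real {0..t} s *\<^sub>R (- G s (u s) \<bullet> h)"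
        proof (rule AE_I2)
          fix s
          show "(\<lambda>k. indicat_real {0..t} s *\<^sub>R (- G s (v k s) \<bullet> h)) \<longlonglongrightarrow> indicat_real {0..t} s *\<^sub>R (- G s (u s) \<bullet> h)"
          proof (cases "s \<in> {0..t}")
            case True
            then have s: "s \<in> {0..T}" using t by auto
            show ?thesis
              using tendsto_minus[OF demi[OF s vu[OF s], of h]] True by simp
          qed simp
        qed
        have "AE s in lebesgue. s \<in> {0..T} \<longrightarrow> norm (G s (v k s)) \<le> \<gamma> s" for k
          using Gd[of k] by (simp add: AE_restrict_space_iff)
        then show "AE s in lebesgue. norm (indicat_real {0..t} s *\<^sub>R (- G s (v k s) \<bullet> h)) \<le> indicat_real {0..T} s *\<^sub>R (\<gamma> s * norm h)" for k
        proof (rule AE_mp, intro AE_I2 impI)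
          fix s assume s: "s \<in> {0..T} \<longrightarrow> norm (G s (v k s)) \<le> \<gamma> s"
          show "norm (indicat_real {0..t} s *\<^sub>R (- G s (v k s) \<bullet> h)) \<le> indicat_real {0..T} s *\<^sub>R (\<gamma> s * norm h)"
          proof (cases "s \<in> {0..t}")
            case True
            then have sT: "s \<in> {0..T}" using t by auto
            have "\<bar>G s (v k s) \<bullet> h\<bar> \<le> norm (G s (v k s)) * norm h" by (rule Cauchy_Schwarz_ineq2)
            also have "\<dots> \<le> \<gamma> s * norm h" using s sT by (intro mult_right_mono) auto
            finally show ?thesis using True sT by simp
          next
            case False
            then show ?thesis using \<gamma>0[of s] by (auto simp: indicator_def)
          qed
        qed
      qed
      then have lim: "(\<lambda>k. (LINT s:{0..t}|lebesgue. - G s (v k s)) \<bullet> h) \<longlonglongrightarrow> (LINT s:{0..t}|lebesgue. - G s (u s)) \<bullet> h"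
        unfolding set_lebesgue_integral_def[symmetric]
        by (simp only: set_integral_bounded_linear(2)[OF bounded_linear_inner_left sub[OF Gi']]
            set_integral_bounded_linear(2)[OF bounded_linear_inner_left sub[OF Gui']])
      have "(\<lambda>k. z k t \<bullet> h) \<longlonglongrightarrow> (x0 + (LINT s:{0..t}|lebesgue. - G s (u s))) \<bullet> h"
        unfolding z_def inner_add_left by (intro tendsto_add tendsto_const lim)
      moreover have "(\<lambda>k. z k t \<bullet> h) \<longlonglongrightarrow> u t \<bullet> h"
        by (intro tendsto_inner zu t tendsto_const)
      ultimately show ?thesis using LIMSEQ_unique by blast
    qed
    then show ?thesis using vector_eq_rdot by blast
  qed
  have path: "ac_path T u (\<lambda>t. - G t (u t))"
    by (rule ac_path_cong[OF ac_path_indefinite_integral[OF Gui', of x0]]) (use u_eq in auto)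
  have "u 0 = x0"
    using zu[of 0] T by (simp add: z0 LIMSEQ_const_iff)
  then show ?thesis using path by blast
qed

lemma monotone_evolution_solution:
  fixes G :: "real \<Rightarrow> 'a \<Rightarrow> 'a::{real_inner, complete_space, second_countable_topology}"
  assumes T: "T > 0"
    and meas: "\<And>u. u \<in> borel_measurable (lebesgue_on {0..T}) \<Longrightarrow>
      (\<lambda>t. G t (u t)) \<in> borel_measurable (lebesgue_on {0..T})"
    and C: "C \<ge> 0" and \<beta>: "set_integrable lebesgue {0..T} \<beta>" and \<beta>0: "\<And>t. t \<in> {0..T} \<Longrightarrow> 0 \<le> \<beta> t"
    and growth: "AE t in lebesgue_on {0..T}. \<forall>x. norm (G t x) \<le> C * norm x + \<beta> t"
    and mono: "\<And>t x y. t \<in> {0..T} \<Longrightarrow> 0 \<le> (G t x - G t y) \<bullet> (x - y)"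
    and demi: "\<And>t X x h. t \<in> {0..T} \<Longrightarrow> X \<longlonglongrightarrow> x \<Longrightarrow> (\<lambda>k. G t (X k) \<bullet> h) \<longlonglongrightarrow> G t x \<bullet> h"
  shows "\<exists>u. ac_path T u (\<lambda>t. - G t (u t)) \<and> u 0 = x0"
proof -
  interpret tc: bounded_linear "to_copy :: 'a \<Rightarrow> 'a banach_copy" by (rule bounded_linear_to_copy)
  interpret oc: bounded_linear "of_copy :: 'a banach_copy \<Rightarrow> 'a" by (rule bounded_linear_of_copy)
  have inner_tc: "to_copy a \<bullet> b = a \<bullet> of_copy b" for a :: 'a and b
    using inner_to_copy[of a "of_copy b"] by simp
  have "\<exists>u. ac_path T u (\<lambda>t. - to_copy (G t (of_copy (u t)))) \<and> u 0 = to_copy x0"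
  proof (rule monotone_evolution_solution_banach[OF T _ C \<beta> \<beta>0])
    fix u :: "real \<Rightarrow> 'a banach_copy" assume "u \<in> borel_measurable (lebesgue_on {0..T})"
    then have "(\<lambda>t. of_copy (u t)) \<in> borel_measurable (lebesgue_on {0..T})"
      by (rule borel_measurable_continuous_on[OF linear_continuous_on[OF bounded_linear_of_copy]])
    from meas[OF this] show "(\<lambda>t. to_copy (G t (of_copy (u t)))) \<in> borel_measurable (lebesgue_on {0..T})"
      by (rule borel_measurable_continuous_on[OF linear_continuous_on[OF bounded_linear_to_copy]])
  next
    show "AE t in lebesgue_on {0..T}. \<forall>x. norm (to_copy (G t (of_copy x))) \<le> C * norm x + \<beta> t"
      using growth
    proof eventually_elim
      case (elim t)
      show ?case
      proof
        fix x show "norm (to_copy (G t (of_copy x))) \<le> C * norm x + \<beta> t"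
          using elim[rule_format, of "of_copy x"] by simp
      qed
    qed
  next
    fix t x y assume t: "t \<in> {0..T}"
    show "0 \<le> (to_copy (G t (of_copy x)) - to_copy (G t (of_copy y))) \<bullet> (x - y)"
      using mono[OF t, of "of_copy x" "of_copy y"] by (simp add: inner_tc flip: tc.diff oc.diff)
  next
    fix t X x h assume t: "t \<in> {0..T}" and X: "X \<longlonglongrightarrow> (x :: 'a banach_copy)"
    show "(\<lambda>k. to_copy (G t (of_copy (X k))) \<bullet> h) \<longlonglongrightarrow> to_copy (G t (of_copy x)) \<bullet> h"
      unfolding inner_tc by (rule demi[OF t oc.tendsto[OF X]])
  qed
  then obtain u where u: "ac_path T u (\<lambda>t. - to_copy (G t (of_copy (u t))))" and u0: "u 0 = to_copy x0" by blast
  have "ac_path T (\<lambda>t. of_copy (u t)) (\<lambda>t. of_copy (- to_copy (G t (of_copy (u t)))))"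
    by (rule ac_path_isometry[OF bounded_linear_of_copy norm_of_copy u])
  then show ?thesis
    using u0 by (intro exI[of _ "\<lambda>t. of_copy (u t)"]) (simp add: oc.neg)
qed

subsection \<open>Convex Gateaux differentiable functions\<close>

locale gateaux_convex =
  fixes F :: "'a::{real_inner, complete_space} \<Rightarrow> real" and g :: "'a \<Rightarrow> 'a"
  assumes convex: "\<And>x y r. 0 \<le> r \<Longrightarrow> r \<le> 1 \<Longrightarrow> F ((1 - r) *\<^sub>R x + r *\<^sub>R y) \<le> (1 - r) * F x + r * F y"
    and gradient: "\<And>x h. ((\<lambda>r. (F (x + r *\<^sub>R h) - F x) / r) \<longlongrightarrow> g x \<bullet> h) (at 0)"
begin

lemma gradient_right: "((\<lambda>r. (F (x + r *\<^sub>R h) - F x) / r) \<longlongrightarrow> g x \<bullet> h) (at_right 0)"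
  using gradient filterlim_at_split by blast

lemma subgradient: "F x + g x \<bullet> (y - x) \<le> F y"
proof -
  have "g x \<bullet> (y - x) \<le> F y - F x"
  proof (rule tendsto_upperbound[OF gradient_right])
    have "(F (x + r *\<^sub>R (y - x)) - F x) / r \<le> F y - F x" if "0 < r" "r < 1" for r
    proof -
      define A where "A = F (x + r *\<^sub>R (y - x))"
      have "A \<le> (1 - r) * F x + r * F y"
        using convex[of r x y] that by (simp add: A_def algebra_simps)
      then have "A - F x \<le> (F y - F x) * r" by (simp add: algebra_simps)
      then have "(A - F x) / r \<le> F y - F x" using that by (simp only: pos_divide_le_eq)
      then show ?thesis by (simp only: A_def)
    qed
    then show "\<forall>\<^sub>F r in at_right 0. (F (x + r *\<^sub>R (y - x)) - F x) / r \<le> F y - F x"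
      by (auto simp: eventually_at_right_field intro!: exI[of _ "1::real"])
  qed simp
  then show ?thesis by simp
qed

lemma gradient_monotone: "0 \<le> (g x - g y) \<bullet> (x - y)"
  using subgradient[of x y] subgradient[of y x]
  by (simp add: inner_diff_left inner_diff_right)

text \<open>By the subgradient inequality \<open>F\<close> is the supremum of its affine tangents,
  hence lower semicontinuous.\<close>

lemma closed_sublevel: "closed {x. F x \<le> k}"
  unfolding closed_sequential_limits
proof (intro allI impI, elim conjE)
  fix X l assume X: "\<forall>n. X n \<in> {x. F x \<le> k}" and lim: "X \<longlonglongrightarrow> l"
  have "(\<lambda>n. F l + g l \<bullet> (X n - l)) \<longlonglongrightarrow> F l + g l \<bullet> (l - l)"
    by (intro tendsto_intros lim)
  moreover have "F l + g l \<bullet> (X n - l) \<le> k" for n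
    using subgradient[of l "X n"] X by (simp add: order_trans)
  ultimately show "l \<in> {x. F x \<le> k}" using LIMSEQ_le_const2 by fastforce
qed

text \<open>Baire's theorem: the closed sublevel sets of integer height cover the space, so one of
  them has interior points.\<close>

lemma bounded_above_on_some_ball: "\<exists>x0 e k. e > 0 \<and> (\<forall>x\<in>ball x0 e. F x \<le> k)"
proof (rule ccontr)
  assume no: "\<not> ?thesis"
  let ?S = "\<lambda>k::nat. {x. F x \<le> real k}"
  have "Met_TC.mtopology interior_of \<Union>(range ?S) = {}"
  proof (rule Met_TC.metric_Baire_category_alt)
    show "Met_TC.mcomplete TYPE('a)"
      using complete_UNIV by (simp add: mcomplete_iff_complete)
    fix A assume "A \<in> range ?S"
    then obtain k where A: "A = ?S k" by blast
    have "interior A = {}"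
    proof (rule ccontr)
      assume "interior A \<noteq> {}"
      then obtain x0 where "x0 \<in> interior A" by blast
      then obtain e where "e > 0" "ball x0 e \<subseteq> A" using mem_interior by blast
      then show False using no A by blast
    qed
    then show "closedin Met_TC.mtopology A \<and> Met_TC.mtopology interior_of A = {}"
      using closed_sublevel[of "real k"] by (simp add: A closed_closedin[symmetric] euclidean_interior_of)
  qed simp
  moreover have "\<Union>(range ?S) = UNIV"
  proof -
    have "x \<in> \<Union>(range ?S)" for x using real_arch_simple[of "F x"] by auto
    then show ?thesis by blast
  qed
  ultimately show False by (simp add: euclidean_interior_of)
qed

text \<open>Convexity moves the bound from the ball around \<open>x0\<close> to any
  \<open>x\<close>: each \<open>y\<close> near \<open>x\<close> is the midpoint of the fixed point 2
  x - x0 and of a point near \<open>x0\<close>.\<close>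

lemma locally_bounded_above: "\<exists>d>0. \<exists>M. \<forall>y\<in>ball x d. F y \<le> M"
proof -
  obtain x0 e k where e: "e > 0" and k: "\<And>y. y \<in> ball x0 e \<Longrightarrow> F y \<le> k"
    using bounded_above_on_some_ball by blast
  have "F y \<le> (F (2 *\<^sub>R x - x0) + k) / 2" if "y \<in> ball x (e / 2)" for y
  proof -
    let ?w = "x0 + 2 *\<^sub>R (y - x)"
    have "norm (2 *\<^sub>R (y - x)) < e" using that by (simp add: dist_norm norm_minus_commute)
    then have "?w \<in> ball x0 e" by (simp add: dist_norm)
    then have "F ?w \<le> k" by (rule k)
    moreover have y: "y = (1 - 1/2) *\<^sub>R (2 *\<^sub>R x - x0) + (1/2) *\<^sub>R ?w"
      by (simp add: scaleR_diff_right scaleR_add_right)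
    have "F ((1 - 1/2) *\<^sub>R (2 *\<^sub>R x - x0) + (1/2) *\<^sub>R ?w) \<le> (1 - 1/2) * F (2 *\<^sub>R x - x0) + (1/2) * F ?w"
      by (rule convex) auto
    then have "F y \<le> (1 - 1/2) * F (2 *\<^sub>R x - x0) + (1/2) * F ?w"
      by (simp only: y[symmetric])
    ultimately show ?thesis by simp
  qed
  then show ?thesis using e
    by (intro exI[of _ "e / 2"] conjI exI[of _ "(F (2 *\<^sub>R x - x0) + k) / 2"]) auto
qed

text \<open>Convex functions which are lower semicontinuous, here as suprema of affine functions, are
  continuous on a complete space by Baire's theorem.\<close>

lemma isCont_F: "isCont F x"
proof -
  obtain d M where d: "d > 0" and M: "\<And>y. y \<in> ball x d \<Longrightarrow> F y \<le> M"
    using locally_bounded_above by blast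
  \<comment> \<open>The subgradient inequality at \<open>y\<close>, tested with a step of length d /
    2 in the direction of \<open>g y\<close>, stays in the ball of radius \<open>d\<close>, so (d /
    2) |g y| \<le> M - F y. The tangent at \<open>x\<close> bounds \<open>F y\<close> from below by
    F x - |g x| d.\<close>
  define L where "L = (M - F x + norm (g x) * d) / (d / 2)"
  have gL: "norm (g y) \<le> L" if y: "y \<in> ball x (d / 2)" for y
  proof (cases "g y = 0")
    case True
    have "F x \<le> M" using M[of x] d by simp
    then show ?thesis using True d by (simp add: L_def)
  next
    case False
    let ?u = "(d / 2 / norm (g y)) *\<^sub>R g y"
    have nu: "norm ?u = d / 2" using False d by simp
    have "dist x (y + ?u) < d"
      using y dist_triangle_less_add[of x y "d / 2" "y + ?u" "d"] nu norm_triangle_ineq4[of "x - y" ?u] d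
      by (simp add: dist_norm algebra_simps)
    then have "F (y + ?u) \<le> M" by (intro M) simp
    moreover have "F y + g y \<bullet> ?u \<le> F (y + ?u)" using subgradient[of y "y + ?u"] by simp
    moreover have "g y \<bullet> ?u = d / 2 * norm (g y)"
      using False by (simp add: power2_norm_eq_inner[symmetric] power2_eq_square)
    moreover have "F x - norm (g x) * d \<le> F y"
    proof -
      have "norm (y - x) \<le> d" using y d by (simp add: dist_norm norm_minus_commute)
      then have "norm (g x) * norm (y - x) \<le> norm (g x) * d" by (rule mult_left_mono) simp
      moreover have "- (norm (g x) * norm (y - x)) \<le> g x \<bullet> (y - x)"
        using Cauchy_Schwarz_ineq2[of "g x" "y - x"] by linarith
      ultimately show ?thesis using subgradient[of x y] by linarith
    qed
    ultimately have "norm (g y) * (d / 2) \<le> M - F x + norm (g x) * d" by (simp add: algebra_simps)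
    then show ?thesis using d unfolding L_def by (simp add: pos_le_divide_eq)
  qed
  have Lip: "norm (F y - F x) \<le> L * norm (y - x)" if y: "y \<in> ball x (d / 2)" for y
  proof -
    have "\<bar>g x \<bullet> (y - x)\<bar> \<le> norm (g x) * norm (y - x)" by (rule Cauchy_Schwarz_ineq2)
    moreover have "norm (g x) * norm (y - x) \<le> L * norm (y - x)"
      using gL[of x] d by (intro mult_right_mono) auto
    moreover have "\<bar>g y \<bullet> (x - y)\<bar> \<le> norm (g y) * norm (x - y)" by (rule Cauchy_Schwarz_ineq2)
    moreover have "norm (g y) * norm (x - y) \<le> L * norm (y - x)"
      unfolding norm_minus_commute[of x y] using gL[OF y] by (intro mult_right_mono) auto
    ultimately show ?thesis using subgradient[of x y] subgradient[of y x] by simp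
  qed
  have "((\<lambda>y. L * norm (y - x)) \<longlongrightarrow> L * norm (x - x)) (at x)"
    by (intro tendsto_intros)
  then have "((\<lambda>y. L * norm (y - x)) \<longlongrightarrow> 0) (at x)" by simp
  moreover have "\<forall>\<^sub>F y in at x. norm (F y - F x) \<le> L * norm (y - x)"
    using Lip d unfolding eventually_at by (intro exI[of _ "d / 2"]) (auto simp: dist_commute)
  ultimately have "((\<lambda>y. F y - F x) \<longlongrightarrow> 0) (at x)" by (rule Lim_null_comparison[rotated])
  then show ?thesis by (simp add: isCont_def LIM_zero_iff)
qed

lemma tendsto_F: "X \<longlonglongrightarrow> x \<Longrightarrow> (\<lambda>k. F (X k)) \<longlonglongrightarrow> F x"
  using isCont_F isCont_tendsto_compose by blast

text \<open>Some difference quotient at \<open>x\<close> with a fixed step \<open>r\<close> is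
  already below \<open>b\<close>. By continuity of \<open>F\<close> the quotients at
  \<open>X k\<close> with the same step eventually are too, and by convexity they dominate g (X k)
  \<bullet> h.\<close>

lemma demicontinuous_upper:
  assumes X: "X \<longlonglongrightarrow> x" and b: "g x \<bullet> h < b"
  shows "\<forall>\<^sub>F k in sequentially. g (X k) \<bullet> h < b"
proof -
  have "\<forall>\<^sub>F r in at_right 0. (F (x + r *\<^sub>R h) - F x) / r < b"
    by (rule order_tendstoD(2)[OF gradient_right b])
  then obtain e where e: "e > 0" and eb: "\<And>r. 0 < r \<Longrightarrow> r < e \<Longrightarrow> (F (x + r *\<^sub>R h) - F x) / r < b"
    unfolding eventually_at_right_field by auto
  define r where "r = e / 2"
  have r: "0 < r" "(F (x + r *\<^sub>R h) - F x) / r < b" using e eb[of r] by (auto simp: r_def)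
  have "(\<lambda>k. (F (X k + r *\<^sub>R h) - F (X k)) / r) \<longlonglongrightarrow> (F (x + r *\<^sub>R h) - F x) / r"
    using r(1) by (intro tendsto_divide tendsto_diff tendsto_F tendsto_add X tendsto_const) auto
  then have "\<forall>\<^sub>F k in sequentially. (F (X k + r *\<^sub>R h) - F (X k)) / r < b"
    using r(2) order_tendstoD(2) by blast
  then show ?thesis
  proof eventually_elim
    case (elim k)
    have "r * (g (X k) \<bullet> h) \<le> F (X k + r *\<^sub>R h) - F (X k)"
      using subgradient[of "X k" "X k + r *\<^sub>R h"] by simp
    then have "g (X k) \<bullet> h \<le> (F (X k + r *\<^sub>R h) - F (X k)) / r"
      using r(1) by (simp add: pos_le_divide_eq mult.commute)
    then show ?case using elim by simp
  qed
qed

lemma demicontinuous: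
  assumes X: "X \<longlonglongrightarrow> x"
  shows "(\<lambda>k. g (X k) \<bullet> h) \<longlonglongrightarrow> g x \<bullet> h"
proof (rule order_tendstoI)
  fix b assume "g x \<bullet> h < b"
  then show "\<forall>\<^sub>F k in sequentially. g (X k) \<bullet> h < b" by (rule demicontinuous_upper[OF X])
next
  fix b assume "b < g x \<bullet> h"
  then have "g x \<bullet> (- h) < - b" by simp
  from demicontinuous_upper[OF X this] show "\<forall>\<^sub>F k in sequentially. b < g (X k) \<bullet> h"
    by eventually_elim simp
qed

lemma norm_gradient_le:
  assumes K: "K > 0" and ab: "0 \<le> a" "0 \<le> b"
    and up: "\<And>y. F y - F 0 \<le> K * (norm y)\<^sup>2 + b" and low: "\<And>y. - a \<le> F y - F 0"
  shows "norm (g x) \<le> 4 * K * norm x + sqrt (8 * K * (a + b))"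
proof -
  \<comment> \<open>The subgradient inequality is tested at x + s g x. After |x + s g x|^2 \<le> 2
    |x|^2 + 2 s^2 |g x|^2, the coefficient s - 2 K s^2 of |g x|^2 is largest at s = 1 / (4 K), with
    value 1 / (8 K).\<close>
  define s where "s = 1 / (4 * K)"
  let ?G = "(norm (g x))\<^sup>2" and ?X = "(norm x)\<^sup>2"
  have "F x + s * ?G \<le> F (x + s *\<^sub>R g x)"
    using subgradient[of x "x + s *\<^sub>R g x"] by (simp add: power2_norm_eq_inner)
  also have "\<dots> \<le> F 0 + K * (norm (x + s *\<^sub>R g x))\<^sup>2 + b" using up[of "x + s *\<^sub>R g x"] by simp
  finally have "s * ?G \<le> K * (norm (x + s *\<^sub>R g x))\<^sup>2 + (a + b)" using low[of x] by linarith
  also have "(norm (x + s *\<^sub>R g x))\<^sup>2 \<le> 2 * ?X + 2 * (s\<^sup>2 * ?G)"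
  proof -
    have "0 \<le> (norm (x + (- s) *\<^sub>R g x))\<^sup>2" by simp
    then have "0 \<le> ?X + 2 * (- s) * (x \<bullet> g x) + (- s)\<^sup>2 * ?G" by (simp only: norm_add_scaleR_square)
    then show ?thesis unfolding norm_add_scaleR_square by (simp add: algebra_simps)
  qed
  then have "K * (norm (x + s *\<^sub>R g x))\<^sup>2 + (a + b) \<le> K * (2 * ?X + 2 * (s\<^sup>2 * ?G)) + (a + b)"
    using K by simp
  finally have "s * ?G \<le> K * (2 * ?X + 2 * (s\<^sup>2 * ?G)) + (a + b)" by simp
  then have "(s - 2 * K * s\<^sup>2) * ?G \<le> 2 * K * ?X + (a + b)" by (simp add: algebra_simps)
  moreover have "s - 2 * K * s\<^sup>2 = 1 / (8 * K)"
    using K unfolding s_def by (simp add: power2_eq_square field_simps)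
  ultimately have "?G / (8 * K) \<le> 2 * K * ?X + (a + b)" by simp
  then have "?G \<le> (4 * K)\<^sup>2 * ?X + 8 * K * (a + b)"
    using K by (simp add: pos_divide_le_eq power2_eq_square algebra_simps)
  also have "\<dots> = (4 * K * norm x)\<^sup>2 + (sqrt (8 * K * (a + b)))\<^sup>2"
    using K ab by (simp add: power_mult_distrib)
  also have "\<dots> \<le> (4 * K * norm x + sqrt (8 * K * (a + b)))\<^sup>2"
    using K ab by (simp add: power2_sum)
  finally show ?thesis
    by (rule power2_le_imp_le) (use K ab in auto)
qed

lemma inner_gradient_ge: "F x - F 0 \<le> g x \<bullet> x"
  using subgradient[of x 0] by simp

text \<open>A subgradient lies below every directional derivative; as the latter is linear in the
  direction, the choice h = p - g x gives equality. This makes the subdifferential in the integral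
  equation single-valued.\<close>

lemma subgradient_unique:
  assumes "\<And>y. F x + p \<bullet> (y - x) \<le> F y"
  shows "p = g x"
proof -
  have "p \<bullet> h \<le> g x \<bullet> h" for h
  proof (rule tendsto_lowerbound[OF gradient_right])
    have "p \<bullet> h \<le> (F (x + r *\<^sub>R h) - F x) / r" if "r > 0" for r
      using assms[of "x + r *\<^sub>R h"] that by (simp add: pos_le_divide_eq mult.commute)
    then show "\<forall>\<^sub>F r in at_right 0. p \<bullet> h \<le> (F (x + r *\<^sub>R h) - F x) / r"
      by (auto simp: eventually_at_right_field intro!: exI[of _ "1::real"])
  qed simp
  from this[of "p - g x"] have "(p - g x) \<bullet> (p - g x) \<le> 0" by (simp add: inner_diff_left)
  then have "(p - g x) \<bullet> (p - g x) = 0" by (intro antisym) auto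
  then show ?thesis by simp
qed

lemma subdifferential_eq: "subdifferential (\<lambda>x. ereal (F x)) x = {g x}"
  using subgradient subgradient_unique by (auto simp: subdifferential_def)

end

lemma gateaux_convex_gradient_exists:
  fixes f :: "'a::{real_inner, complete_space} \<Rightarrow> ereal"
  assumes conv: "ereal_convex f" and gat: "\<And>x. gateaux_differentiable_at f x"
  shows "\<exists>g. gateaux_convex (\<lambda>x. real_of_ereal (f x)) g"
proof -
  define F where "F x = real_of_ereal (f x)" for x
  have f: "f x = ereal (F x)" for x
    using gat[of x] by (auto simp: gateaux_differentiable_at_def F_def ereal_real')
  have "\<exists>g. \<forall>h. ((\<lambda>r. (F (x + r *\<^sub>R h) - F x) / r) \<longlongrightarrow> g \<bullet> h) (at 0)" for x
  proof -
    obtain D where D: "bounded_linear D"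
      and lim: "\<And>h. ((\<lambda>r. (f (x + r *\<^sub>R h) - f x) / ereal r) \<longlongrightarrow> ereal (D h)) (at 0)"
      using gat[of x] unfolding gateaux_differentiable_at_def by blast
    obtain g where g: "\<And>h. D h = g \<bullet> h" using riesz_representation[OF D] by blast
    have "((\<lambda>r. (F (x + r *\<^sub>R h) - F x) / r) \<longlongrightarrow> g \<bullet> h) (at 0)" for h
    proof -
      have "\<forall>\<^sub>F r in at 0. (f (x + r *\<^sub>R h) - f x) / ereal r = ereal ((F (x + r *\<^sub>R h) - F x) / r)"
        by (auto simp: eventually_at_filter f)
      from tendsto_cong[THEN iffD1, OF this lim[of h]] show ?thesis by (simp add: g)
    qed
    then show ?thesis by blast
  qed
  then obtain g where g: "\<And>x h. ((\<lambda>r. (F (x + r *\<^sub>R h) - F x) / r) \<longlongrightarrow> g x \<bullet> h) (at 0)" by metis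
  have "F ((1 - r) *\<^sub>R x + r *\<^sub>R y) \<le> (1 - r) * F x + r * F y" if "0 \<le> r" "r \<le> 1" for x y r
    using conv that unfolding ereal_convex_def f by auto
  then have "gateaux_convex F g" using g by unfold_locales
  then show ?thesis unfolding F_def by blast
qed

text \<open>Pettis' theorem for a separable inner product space: by \<open>norm_iff\<close> a closed
  ball is a countable intersection of half-spaces, so distances to fixed points are measurable, and
  every open set is a countable union of balls.\<close>

lemma borel_measurable_if_weakly_measurable:
  fixes f :: "'d \<Rightarrow> 'a::{real_inner, second_countable_topology}"
  assumes weak: "\<And>h. (\<lambda>t. f t \<bullet> h) \<in> borel_measurable M"
  shows "f \<in> borel_measurable M"
proof -
  obtain Q :: "'a set" where Q: "countable Q" "\<And>X. open X \<Longrightarrow> X \<noteq> {} \<Longrightarrow> \<exists>d\<in>Q. d \<in> X"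
    using countable_dense_setE by blast
  have near: "\<exists>q\<in>Q. dist y q < e" if "e > 0" for y e
    using Q(2)[of "ball y e"] that by auto
  have "Q \<noteq> {}" using near[of 1 0] by auto
  then obtain e :: "nat \<Rightarrow> 'a" where e: "range e = Q"
    using range_from_nat_into[OF _ Q(1)] by blast
  have norm_iff: "norm y \<le> s \<longleftrightarrow> (\<forall>q\<in>Q. y \<bullet> q \<le> s * norm q)" if s: "s \<ge> 0" for y :: 'a and s
  proof
    assume y: "norm y \<le> s"
    show "\<forall>q\<in>Q. y \<bullet> q \<le> s * norm q"
    proof
      fix q
      have "y \<bullet> q \<le> norm y * norm q" by (rule norm_cauchy_schwarz)
      also have "\<dots> \<le> s * norm q" using y by (rule mult_right_mono) simp
      finally show "y \<bullet> q \<le> s * norm q" .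
    qed
  next
    assume le: "\<forall>q\<in>Q. y \<bullet> q \<le> s * norm q"
    have "closed {z. y \<bullet> z \<le> s * norm z}"
      by (intro closed_Collect_le continuous_intros)
    moreover have "Q \<subseteq> {z. y \<bullet> z \<le> s * norm z}" using le by auto
    moreover have "y \<in> closure Q" using near by (fastforce simp: closure_approachable dist_commute)
    ultimately have "y \<bullet> y \<le> s * norm y" using closure_minimal by blast
    then have "norm y * norm y \<le> s * norm y" by (simp add: power2_norm_eq_inner flip: power2_eq_square)
    then show "norm y \<le> s" using s by (cases "y = 0") auto
  qed
  have nm: "(\<lambda>t. norm (f t - x)) \<in> borel_measurable M" for x
    unfolding borel_measurable_iff_le
  proof
    fix s
    show "{t \<in> space M. norm (f t - x) \<le> s} \<in> sets M"
    proof (cases "s \<ge> 0")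
      case True
      have "{t \<in> space M. \<forall>n. f t \<bullet> e n - x \<bullet> e n \<le> s * norm (e n)} \<in> sets M"
      proof (rule sets.sets_Collect_countable_All)
        fix n
        have "(\<lambda>t. f t \<bullet> e n - x \<bullet> e n) \<in> borel_measurable M" using weak by simp
        then show "{t \<in> space M. f t \<bullet> e n - x \<bullet> e n \<le> s * norm (e n)} \<in> sets M" by measurable
      qed
      moreover have "(\<forall>q\<in>Q. f t \<bullet> q - x \<bullet> q \<le> s * norm q) \<longleftrightarrow> (\<forall>n. f t \<bullet> e n - x \<bullet> e n \<le> s * norm (e n))" for t
        using e by (metis rangeE rangeI)
      ultimately have "{t \<in> space M. \<forall>q\<in>Q. f t \<bullet> q - x \<bullet> q \<le> s * norm q} \<in> sets M" by simp
      then show ?thesis using norm_iff[OF True] by (simp add: inner_diff_left)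
    next
      case False
      then have "\<not> norm (f t - x) \<le> s" for t using norm_ge_zero[of "f t - x"] by linarith
      then have "{t \<in> space M. norm (f t - x) \<le> s} = {}" by blast
      then show ?thesis by (simp only: sets.empty_sets)
    qed
  qed
  show ?thesis
  proof (rule borel_measurableI)
    fix S :: "'a set" assume S: "open S"
    define I where "I = {(q, r). q \<in> Q \<and> r \<in> \<rat> \<and> ball q r \<subseteq> S}"
    have cI: "countable I"
      by (rule countable_subset[OF _ countable_SIGMA[OF Q(1) countable_rat]]) (auto simp: I_def)
    have "\<exists>(q, r)\<in>I. y \<in> ball q r" if y: "y \<in> S" for y
    proof -
      obtain e where e: "e > 0" "ball y e \<subseteq> S" using openE[OF S y] .
      obtain r where r: "r \<in> \<rat>" "0 < r" "r < e / 2" using Rats_dense_in_real[of 0 "e / 2"] e by auto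
      obtain q where q: "q \<in> Q" "dist y q < r" using near[OF r(2)] by blast
      have "ball q r \<subseteq> ball y e"
      proof
        fix z assume "z \<in> ball q r"
        then show "z \<in> ball y e" using dist_triangle[of y z q] q r by auto
      qed
      then have "(q, r) \<in> I" using q r e by (auto simp: I_def)
      then show ?thesis using q by (auto simp: dist_commute)
    qed
    then have S_eq: "S = (\<Union>p\<in>I. ball (fst p) (snd p))" unfolding I_def by fastforce
    have eq: "f -` S \<inter> space M = (\<Union>p\<in>I. {t \<in> space M. norm (f t - fst p) < snd p})"
    proof -
      have "f t \<in> S \<longleftrightarrow> (\<exists>p\<in>I. norm (f t - fst p) < snd p)" for t
        by (subst S_eq) (simp add: dist_norm norm_minus_commute)
      then show ?thesis by blast
    qed
    have "{t \<in> space M. norm (f t - fst p) < snd p} \<in> sets M" for p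
      using nm[of "fst p"] by measurable
    then show "f -` S \<inter> space M \<in> sets M"
      unfolding eq by (intro sets.countable_UN'[OF cI]) blast
  qed
qed

subsection \<open>Pointwise bounds from bounds on integral functionals\<close>

text \<open>The value \<open>d 0 = 0\<close> lets a running maximization along the sequence start at
  the zero path, where the normalized potential vanishes.\<close>

lemma dense_sequence_from_zero:
  "\<exists>d :: nat \<Rightarrow> 'a::{real_normed_vector, second_countable_topology}.
     d 0 = 0 \<and> (\<forall>x. \<exists>r. (\<lambda>k::nat. d (r k)) \<longlonglongrightarrow> x)"
proof -
  obtain Q :: "'a set" where Q: "countable Q" "\<And>X. open X \<Longrightarrow> X \<noteq> {} \<Longrightarrow> \<exists>q\<in>Q. q \<in> X"
    using countable_dense_setE by blast
  have "Q \<noteq> {}" using Q(2)[of UNIV] by auto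
  define d where "d i = (case i of 0 \<Rightarrow> 0 | Suc j \<Rightarrow> from_nat_into Q j)" for i
  have Qd: "\<exists>i. d i = q" if q: "q \<in> Q" for q
  proof -
    obtain j where "from_nat_into Q j = q" using from_nat_into_surj[OF Q(1) q] by blast
    then show ?thesis by (intro exI[of _ "Suc j"]) (simp add: d_def)
  qed
  have "\<exists>r. (\<lambda>k::nat. d (r k)) \<longlonglongrightarrow> x" for x
  proof -
    have "\<exists>i. dist (d i) x < 1 / real (Suc k)" for k
    proof -
      obtain q where q: "q \<in> Q" "q \<in> ball x (1 / real (Suc k))"
        using Q(2)[of "ball x (1 / real (Suc k))"] by auto
      obtain i where "d i = q" using Qd[OF q(1)] by blast
      then show ?thesis using q(2) by (intro exI[of _ i]) (simp add: dist_commute)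
    qed
    then obtain r where r: "\<And>k. dist (d (r k)) x < 1 / real (Suc k)" by metis
    have le: "dist (d (r k)) x \<le> inverse (real (Suc k))" for k
      using r[of k] by (simp only: inverse_eq_divide less_imp_le)
    have "(\<lambda>k. dist (d (r k)) x) \<longlonglongrightarrow> 0"
      by (rule tendsto_sandwich[OF always_eventually always_eventually tendsto_const LIMSEQ_inverse_real_of_nat])
        (simp_all add: le del: of_nat_Suc)
    then have "(\<lambda>k. d (r k)) \<longlonglongrightarrow> x" by (subst tendsto_dist_iff)
    then show ?thesis by blast
  qed
  then show ?thesis by (intro exI[of _ d]) (simp add: d_def)
qed

lemma integrable_const_lebesgue_on: "integrable (lebesgue_on {0..T::real}) (\<lambda>_. c :: real)"
  using set_integrable_const_lebesgue[of 0 T c] by (simp add: set_integrable_eq)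

lemma L2_paths_bounded:
  assumes x: "x \<in> borel_measurable (lebesgue_on {0..T})" and b: "\<And>t. t \<in> {0..T} \<Longrightarrow> norm (x t) \<le> b"
  shows "x \<in> L2_paths T"
proof -
  have "integrable (lebesgue_on {0..T}) (\<lambda>t. (norm (x t))\<^sup>2)"
  proof (rule Bochner_Integration.integrable_bound[OF integrable_const_lebesgue_on])
    show "(\<lambda>t. (norm (x t))\<^sup>2) \<in> borel_measurable (lebesgue_on {0..T})" using x by simp
    show "AE t in lebesgue_on {0..T}. norm ((norm (x t))\<^sup>2) \<le> norm (b\<^sup>2)"
      by (rule AE_I2) (use b in \<open>auto simp: space_restrict_space intro: power_mono\<close>)
  qed
  then show ?thesis using x by (simp add: L2_paths_def)
qed

text \<open>A finite integral of \<open>\<sigma>\<close> along every path in a ball, negative on its boundary, forces a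
  pointwise bound: a measurable choice \<open>y j\<close> of a maximizer among the first points of \<open>d\<close> cannot
  leave the ball, as cutting it off in time would produce a path on the boundary along which
  \<open>\<sigma>\<close> is nonnegative.\<close>

lemma integrable_countable_bound:
  fixes \<sigma> :: "real \<Rightarrow> 'a::{real_normed_vector, second_countable_topology} \<Rightarrow> real" and d :: "nat \<Rightarrow> 'a"
  assumes T: "T > 0" and d0: "d 0 = 0" and \<sigma>0: "\<And>t. \<sigma> t 0 = 0"
    and int: "\<And>x. x \<in> L2_paths T \<Longrightarrow> integrable (lebesgue_on {0..T}) (\<lambda>t. \<sigma> t (x t))"
    and R: "R > 0"
    and bd: "\<And>x. x \<in> L2_paths T \<Longrightarrow> (\<integral>t. (norm (x t))\<^sup>2 \<partial>lebesgue_on {0..T}) \<le> R \<Longrightarrow>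
        (\<integral>t. \<sigma> t (x t) \<partial>lebesgue_on {0..T}) \<le> B"
    and neg: "\<And>x. x \<in> L2_paths T \<Longrightarrow> (\<integral>t. (norm (x t))\<^sup>2 \<partial>lebesgue_on {0..T}) = R \<Longrightarrow>
        (\<integral>t. \<sigma> t (x t) \<partial>lebesgue_on {0..T}) < 0"
  shows "\<exists>\<beta>. integrable (lebesgue_on {0..T}) \<beta> \<and> (\<forall>t. 0 \<le> \<beta> t) \<and>
      (AE t in lebesgue_on {0..T}. \<forall>i. \<sigma> t (d i) \<le> \<beta> t)"
proof -
  let ?M = "lebesgue_on {0..T}"
  \<comment> \<open>\<open>y j t\<close> maximizes \<open>\<sigma> t\<close> over d 0, ..., d j. It
    takes finitely many values on measurable sets, so it is a bounded measurable path and may be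
    inserted into the hypotheses.\<close>
  define y where "y = rec_nat (\<lambda>t. 0) (\<lambda>j z t. if \<sigma> t (z t) < \<sigma> t (d (Suc j)) then d (Suc j) else z t)"
  have y0: "y 0 t = 0" and yS: "y (Suc j) t = (if \<sigma> t (y j t) < \<sigma> t (d (Suc j)) then d (Suc j) else y j t)" for j t
    by (simp_all add: y_def)
  have yb: "y j \<in> borel_measurable ?M \<and> (\<exists>b. \<forall>t. norm (y j t) \<le> b)" for j
  proof (induction j)
    case 0
    have "y 0 = (\<lambda>t. 0)" by (rule ext) (rule y0)
    then show ?case by (intro conjI exI[of _ 0]) auto
  next
    case (Suc j)
    then obtain b where ym: "y j \<in> borel_measurable ?M" and b: "\<And>t. norm (y j t) \<le> b" by blast
    have 1: "(\<lambda>t. \<sigma> t (y j t)) \<in> borel_measurable ?M"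
      by (intro borel_measurable_integrable int L2_paths_bounded[OF ym b])
    have 2: "(\<lambda>t. \<sigma> t (d (Suc j))) \<in> borel_measurable ?M"
      by (intro borel_measurable_integrable int L2_paths_bounded[of "\<lambda>_. d (Suc j)" T "norm (d (Suc j))"]) auto
    have "y (Suc j) = (\<lambda>t. if \<sigma> t (y j t) < \<sigma> t (d (Suc j)) then d (Suc j) else y j t)"
      by (rule ext) (rule yS)
    moreover have "(\<lambda>t. if \<sigma> t (y j t) < \<sigma> t (d (Suc j)) then d (Suc j) else y j t) \<in> borel_measurable ?M"
      using 1 2 ym by measurable
    moreover have "norm (y (Suc j) t) \<le> max b (norm (d (Suc j)))" for t
      using b[of t] by (auto simp: yS)
    ultimately show ?case by metis
  qed
  then have ym: "\<And>j. y j \<in> borel_measurable ?M" by blast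
  have yL: "y j \<in> L2_paths T" for j
    using yb[of j] L2_paths_bounded[of "y j" T] by blast
  have mono: "\<sigma> t (y j t) \<le> \<sigma> t (y (Suc j) t)" for j t by (simp add: yS)
  have pos: "0 \<le> \<sigma> t (y j t)" for j t
  proof (induction j)
    case (Suc j)
    then show ?case using mono[of t j] by linarith
  qed (simp add: y0 \<sigma>0)
  have max: "\<sigma> t (d j) \<le> \<sigma> t (y j t)" for j t
    by (cases j) (auto simp: y0 yS d0)
  have N: "(\<integral>t. (norm (y j t))\<^sup>2 \<partial>?M) \<le> R" for j
  proof (rule ccontr)
    assume gt: "\<not> ?thesis"
    define q where "q t = (norm (y j t))\<^sup>2" for t
    have qi: "integrable ?M q" using yL[of j] by (simp add: L2_paths_def q_def[abs_def])
    then have qh: "q integrable_on {0..T}" by (simp add: integrable_on_lebesgue_on)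
    \<comment> \<open>The L2 mass up to time \<open>s\<close> is continuous in \<open>s\<close>, so
      some cut-off has mass exactly \<open>R\<close>; after it the path is 0, where
      \<open>\<sigma>\<close> vanishes.\<close>
    have "continuous_on {0..T} (\<lambda>s. integral {0..s} q)" by (rule indefinite_integral_continuous_1[OF qh])
    moreover have "integral {0..T} q > R"
      using gt lebesgue_integral_eq_integral[OF qi] by (simp add: q_def[abs_def])
    ultimately obtain s where s: "0 \<le> s" "s \<le> T" "integral {0..s} q = R"
      using IVT'[of "\<lambda>s. integral {0..s} q" 0 R T] R T by auto
    define x where "x t = (if t \<le> s then y j t else 0)" for t
    obtain b where b: "\<And>t. norm (y j t) \<le> b" using yb by blast
    have xm: "x \<in> borel_measurable ?M"
      unfolding x_def
    proof (rule measurable_If[OF ym[of j]])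
      show "{t \<in> space ?M. t \<le> s} \<in> sets ?M"
        by (auto simp: sets_restrict_space space_restrict_space image_iff intro!: bexI[of _ "{..s}"])
    qed simp
    have xL: "x \<in> L2_paths T"
      by (rule L2_paths_bounded[OF xm, of "max b 0"]) (use b in \<open>auto simp: x_def le_max_iff_disj\<close>)
    then have "(\<integral>t. (norm (x t))\<^sup>2 \<partial>?M) = integral {0..T} (\<lambda>t. (norm (x t))\<^sup>2)"
      by (intro lebesgue_integral_eq_integral) (auto simp: L2_paths_def)
    also have "\<dots> = integral {0..T} (\<lambda>t. if t \<in> {0..s} then q t else 0)"
      by (rule Henstock_Kurzweil_Integration.integral_cong) (auto simp: x_def q_def)
    also have "\<dots> = integral {0..s} q"
      using s by (subst Henstock_Kurzweil_Integration.integral_restrict_Int) (simp add: Int_absorb1)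
    finally have "(\<integral>t. \<sigma> t (x t) \<partial>?M) < 0" using s by (intro neg[OF xL]) simp
    moreover have "0 \<le> (\<integral>t. \<sigma> t (x t) \<partial>?M)"
      by (rule Bochner_Integration.integral_nonneg) (auto simp: x_def pos \<sigma>0)
    ultimately show False by simp
  qed
  \<comment> \<open>All paths \<open>y j\<close> stay in the ball, so their integrals are bounded by
    \<open>B\<close>, and monotone convergence bounds the integral of the supremum.\<close>
  define X where "X t = (SUP j. ennreal (\<sigma> t (y j t)))" for t
  have \<sigma>i: "integrable ?M (\<lambda>t. \<sigma> t (y j t))" for j by (rule int[OF yL])
  have \<sigma>m: "(\<lambda>t. ennreal (\<sigma> t (y j t))) \<in> borel_measurable ?M" for j
    using borel_measurable_integrable[OF \<sigma>i] by simp
  have Xm: "X \<in> borel_measurable ?M" unfolding X_def by (intro borel_measurable_SUP \<sigma>m) simp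
  have "(\<integral>\<^sup>+t. X t \<partial>?M) = (SUP j. \<integral>\<^sup>+t. ennreal (\<sigma> t (y j t)) \<partial>?M)"
    unfolding X_def
    by (rule nn_integral_monotone_convergence_SUP)
      (auto simp: incseq_Suc_iff le_fun_def mono ennreal_leI intro!: \<sigma>m)
  also have "\<dots> \<le> ennreal B"
  proof (rule SUP_least)
    fix j
    have "(\<integral>\<^sup>+t. ennreal (\<sigma> t (y j t)) \<partial>?M) = ennreal (\<integral>t. \<sigma> t (y j t) \<partial>?M)"
      by (rule nn_integral_eq_integral[OF \<sigma>i]) (simp add: pos)
    also have "\<dots> \<le> ennreal B" by (intro ennreal_leI bd yL N)
    finally show "(\<integral>\<^sup>+t. ennreal (\<sigma> t (y j t)) \<partial>?M) \<le> ennreal B" .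
  qed
  finally have Xfin: "(\<integral>\<^sup>+t. X t \<partial>?M) < \<infinity>" by (simp add: order_le_less_trans)
  have Xae: "AE t in ?M. X t \<noteq> \<infinity>" using nn_integral_PInf_AE[OF Xm] Xfin by auto
  define \<beta> where "\<beta> t = enn2real (X t)" for t
  have "integrable ?M \<beta>"
  proof (rule integrableI_nonneg)
    show "\<beta> \<in> borel_measurable ?M" unfolding \<beta>_def using Xm by simp
    have "(\<integral>\<^sup>+t. ennreal (\<beta> t) \<partial>?M) \<le> (\<integral>\<^sup>+t. X t \<partial>?M)"
      by (intro nn_integral_mono) (simp add: \<beta>_def ennreal_enn2real_if)
    then show "(\<integral>\<^sup>+t. ennreal (\<beta> t) \<partial>?M) < \<infinity>" using Xfin by (rule order_le_less_trans)
  qed (simp add: \<beta>_def)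
  moreover have "AE t in ?M. \<forall>i. \<sigma> t (d i) \<le> \<beta> t"
    using Xae
  proof eventually_elim
    case (elim t)
    show ?case
    proof
      fix i
      have "ennreal (\<sigma> t (y i t)) \<le> X t" unfolding X_def by (rule SUP_upper) simp
      then have "enn2real (ennreal (\<sigma> t (y i t))) \<le> \<beta> t"
        unfolding \<beta>_def using elim by (intro enn2real_mono) (auto simp: top.not_eq_extremum)
      then show "\<sigma> t (d i) \<le> \<beta> t" using max[of t i] pos[of t i] by simp
    qed
  qed
  ultimately show ?thesis by (intro exI[of _ \<beta>]) (auto simp: \<beta>_def)
qed

lemma measurable_along_path:
  assumes \<phi>: "(\<lambda>(t, x). \<phi> t x) \<in> borel_measurable (M \<Otimes>\<^sub>M borel)" and x: "x \<in> borel_measurable M"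
  shows "(\<lambda>t. \<phi> t (x t)) \<in> borel_measurable M"
proof -
  have "(\<lambda>t. (t, x t)) \<in> M \<rightarrow>\<^sub>M M \<Otimes>\<^sub>M borel" using x by simp
  from measurable_compose[OF this \<phi>] show ?thesis by simp
qed

text \<open>Reduces the supremum to a countable one, which makes the conjugate at 0 measurable in
  time.\<close>

lemma conjugate_at_zero:
  fixes F :: "'a::real_inner \<Rightarrow> real"
  assumes f: "\<And>x. f x = ereal (F x)"
    and cont: "\<And>X x. X \<longlonglongrightarrow> x \<Longrightarrow> (\<lambda>k. F (X k)) \<longlonglongrightarrow> F x"
    and dense: "\<And>x. \<exists>r. (\<lambda>k::nat. d (r k)) \<longlonglongrightarrow> x"
  shows "conjugate f 0 = (SUP i. ereal (- F (d i)))"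
proof (rule antisym)
  show "conjugate f 0 \<le> (SUP i. ereal (- F (d i)))"
    unfolding conjugate_def
  proof (rule SUP_least)
    fix x
    obtain r where "(\<lambda>k. d (r k)) \<longlonglongrightarrow> x" using dense by blast
    then have "(\<lambda>k. ereal (- F (d (r k)))) \<longlonglongrightarrow> ereal (- F x)" by (simp add: cont tendsto_minus)
    then have "ereal (- F x) \<le> (SUP i. ereal (- F (d i)))"
      by (rule LIMSEQ_le_const2) (auto intro!: SUP_upper)
    then show "ereal (x \<bullet> 0) - f x \<le> (SUP i. ereal (- F (d i)))" by (simp add: f)
  qed
  show "(SUP i. ereal (- F (d i))) \<le> conjugate f 0"
    unfolding conjugate_def
    by (rule SUP_least, rule SUP_upper2[where i = "d _"]) (auto simp: f)
qed

text \<open>The conjugate at 0 is minus the infimum of \<open>\<phi> t\<close>, so the integrand is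
  nonnegative and, having a finite integral along the zero path, finite almost everywhere there.
  Subtracting the functional at the zero path removes the conjugate; that value lies between 0 and
  \<open>C2\<close>, which is why only the lower bound loses a constant.\<close>

lemma potential_growth:
  fixes \<phi> :: "real \<Rightarrow> 'a::{real_inner, second_countable_topology} \<Rightarrow> ereal" and F :: "real \<Rightarrow> 'a \<Rightarrow> real"
  assumes meas: "(\<lambda>(t, x). \<phi> t x) \<in> borel_measurable (lebesgue_on {0..T} \<Otimes>\<^sub>M borel)"
    and F: "\<And>t x. t \<in> {0..T} \<Longrightarrow> \<phi> t x = ereal (F t x)"
    and cont: "\<And>t X x. t \<in> {0..T} \<Longrightarrow> X \<longlonglongrightarrow> x \<Longrightarrow> (\<lambda>k. F t (X k)) \<longlonglongrightarrow> F t x"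
    and C2: "C2 > 0"
    and growth: "\<forall>x\<in>L2_paths T.
        ereal (C1 * (L2_norm T x powr m - 1))
          \<le> ereal_integral (lebesgue_on {0..T}) (\<lambda>t. \<phi> t (x t) + conjugate (\<phi> t) 0) \<and>
        ereal_integral (lebesgue_on {0..T}) (\<lambda>t. \<phi> t (x t) + conjugate (\<phi> t) 0)
          \<le> ereal (C2 * (1 + L2_norm T x powr n))"
    and x: "x \<in> L2_paths T"
  shows "integrable (lebesgue_on {0..T}) (\<lambda>t. F t (x t) - F t 0)"
    and "C1 * (L2_norm T x powr m - 1) - C2 \<le> (\<integral>t. F t (x t) - F t 0 \<partial>lebesgue_on {0..T})"
    and "(\<integral>t. F t (x t) - F t 0 \<partial>lebesgue_on {0..T}) \<le> C2 * (1 + L2_norm T x powr n)"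
proof -
  let ?M = "lebesgue_on {0..T}"
  obtain d :: "nat \<Rightarrow> 'a" where d: "\<And>x. \<exists>r. (\<lambda>k::nat. d (r k)) \<longlonglongrightarrow> x"
    using dense_sequence_from_zero by blast
  define c where "c t = conjugate (\<phi> t) 0" for t
  have Fm: "(\<lambda>t. F t (y t)) \<in> borel_measurable ?M" if "y \<in> borel_measurable ?M" for y
  proof -
    have "(\<lambda>t. real_of_ereal (\<phi> t (y t))) \<in> borel_measurable ?M"
      using measurable_along_path[OF meas that] by simp
    then show ?thesis
      by (subst measurable_cong[where g = "\<lambda>t. real_of_ereal (\<phi> t (y t))"]) (auto simp: F)
  qed
  have cm: "c \<in> borel_measurable ?M"
  proof -
    have "(\<lambda>t. SUP i. ereal (- F t (d i))) \<in> borel_measurable ?M"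
      using Fm[of "\<lambda>_. d _"] by (intro borel_measurable_SUP) auto
    moreover have "c t = (SUP i. ereal (- F t (d i)))" if "t \<in> {0..T}" for t
      unfolding c_def by (rule conjugate_at_zero[OF F[OF that] cont[OF that] d])
    ultimately show ?thesis
      by (subst measurable_cong[where g = "\<lambda>t. SUP i. ereal (- F t (d i))"]) auto
  qed
  have c_ge: "ereal (- F t y) \<le> c t" if "t \<in> {0..T}" for t y
    unfolding c_def conjugate_def by (rule SUP_upper2[of y]) (auto simp: F[OF that])
  define W where "W y t = ereal (F t (y t)) + c t" for y t
  have W0: "0 \<le> W y t" if "t \<in> {0..T}" for y t
    using c_ge[OF that, of "y t"] unfolding W_def by (cases "c t") auto
  define J where "J y = (\<integral>\<^sup>+t. e2ennreal (W y t) \<partial>?M)" for y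
  have J: "ereal_integral ?M (\<lambda>t. \<phi> t (y t) + conjugate (\<phi> t) 0) = enn2ereal (J y)" for y
  proof -
    have "(\<integral>\<^sup>+t. e2ennreal (\<phi> t (y t) + conjugate (\<phi> t) 0) \<partial>?M) = J y"
      unfolding J_def by (rule nn_integral_cong) (simp add: W_def c_def F)
    moreover have "(\<integral>\<^sup>+t. e2ennreal (- (\<phi> t (y t) + conjugate (\<phi> t) 0)) \<partial>?M) = (\<integral>\<^sup>+t. 0 \<partial>?M)"
    proof (rule nn_integral_cong)
      fix t assume "t \<in> space ?M"
      then have t: "t \<in> {0..T}" by simp
      have "\<phi> t (y t) + conjugate (\<phi> t) 0 = W y t" by (simp add: W_def c_def F[OF t])
      then show "e2ennreal (- (\<phi> t (y t) + conjugate (\<phi> t) 0)) = 0"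
        using W0[OF t, of y] by (simp add: e2ennreal_neg)
    qed
    ultimately show ?thesis by (simp add: ereal_integral_def zero_ennreal.rep_eq)
  qed
  have zero: "(\<lambda>_. 0) \<in> L2_paths T" by (rule L2_paths_bounded[of _ _ 0]) auto
  have up: "enn2ereal (J y) \<le> ereal (C2 * (1 + L2_norm T y powr n))" if "y \<in> L2_paths T" for y
    using growth that J by metis
  have low: "ereal (C1 * (L2_norm T y powr m - 1)) \<le> enn2ereal (J y)" if "y \<in> L2_paths T" for y
    using growth that J by metis
  have Jfin: "J y < \<infinity>" if "y \<in> L2_paths T" for y
  proof -
    have "enn2ereal (J y) < \<infinity>" using up[OF that] by (rule order_le_less_trans) simp
    then show ?thesis by (simp add: less_ennreal.rep_eq)
  qed
  have Wm: "(\<lambda>t. W y t) \<in> borel_measurable ?M" if "y \<in> borel_measurable ?M" for y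
    unfolding W_def using Fm[OF that] cm by simp
  have ym: "y \<in> borel_measurable ?M" if "y \<in> L2_paths T" for y using that by (simp add: L2_paths_def)
  have "AE t in ?M. e2ennreal (W (\<lambda>_. 0) t) \<noteq> \<infinity>"
    by (rule nn_integral_PInf_AE) (use Wm[of "\<lambda>_. 0"] Jfin[OF zero] in \<open>auto simp: J_def\<close>)
  moreover have "AE t in ?M. t \<in> space ?M" by (rule AE_space)
  ultimately have cfin: "AE t in ?M. t \<in> {0..T} \<and> c t = ereal (real_of_ereal (c t))"
  proof eventually_elim
    case (elim t)
    then have t: "t \<in> {0..T}" by simp
    have "c t \<noteq> \<infinity>"
    proof
      assume "c t = \<infinity>"
      then have "W (\<lambda>_. 0) t = \<infinity>" by (simp add: W_def)
      then show False using elim by simp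
    qed
    moreover have "c t \<noteq> -\<infinity>" using c_ge[OF t, of 0] by auto
    ultimately show ?case using t by (cases "c t") auto
  qed
  define k where "k t = real_of_ereal (c t)" for t
  have km: "k \<in> borel_measurable ?M" unfolding k_def using cm by simp
  have main: "integrable ?M (\<lambda>t. F t (y t) + k t) \<and> 0 \<le> (\<integral>t. F t (y t) + k t \<partial>?M) \<and>
      enn2ereal (J y) = ereal (\<integral>t. F t (y t) + k t \<partial>?M)" if y: "y \<in> L2_paths T" for y
  proof -
    have ae: "AE t in ?M. 0 \<le> F t (y t) + k t \<and> e2ennreal (W y t) = ennreal (F t (y t) + k t)"
      using cfin
    proof eventually_elim
      case (elim t)
      then have t: "t \<in> {0..T}" and c: "c t = ereal (k t)" by (auto simp: k_def)
      have "W y t = ereal (F t (y t) + k t)" by (simp add: W_def c)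
      then show ?case using W0[OF t, of y] by simp
    qed
    then have pos: "AE t in ?M. 0 \<le> F t (y t) + k t" by eventually_elim simp
    have Jeq: "J y = (\<integral>\<^sup>+t. ennreal (F t (y t) + k t) \<partial>?M)"
      unfolding J_def by (rule nn_integral_cong_AE) (use ae in eventually_elim, simp)
    have i: "integrable ?M (\<lambda>t. F t (y t) + k t)"
      by (rule integrableI_nonneg[OF _ pos]) (use Fm[OF ym[OF y]] km Jfin[OF y] Jeq in auto)
    have nn: "0 \<le> (\<integral>t. F t (y t) + k t \<partial>?M)" by (rule integral_nonneg_AE[OF pos])
    have "J y = ennreal (\<integral>t. F t (y t) + k t \<partial>?M)"
      unfolding Jeq by (rule nn_integral_eq_integral[OF i pos])
    then show ?thesis using i nn by (simp add: enn2ereal_ennreal)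
  qed
  \<comment> \<open>Since \<open>0 powr n = 0\<close>, the upper growth bound at the zero path is
    just \<open>C2\<close>.\<close>
  have k0: "(\<integral>t. F t 0 + k t \<partial>?M) \<le> C2"
  proof -
    have "L2_norm T (\<lambda>_. 0 :: 'a) = 0" by (simp add: L2_norm_def)
    then show ?thesis using up[OF zero] main[OF zero] by simp
  qed
  have eq: "(\<lambda>t. F t (x t) - F t 0) = (\<lambda>t. (F t (x t) + k t) - (F t 0 + k t))" by (simp add: algebra_simps)
  have ix: "integrable ?M (\<lambda>t. F t (x t) + k t)" and i0: "integrable ?M (\<lambda>t. F t 0 + k t)"
    using main[OF x] main[OF zero] by auto
  show "integrable ?M (\<lambda>t. F t (x t) - F t 0)"
    unfolding eq by (rule Bochner_Integration.integrable_diff[OF ix i0])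
  have "(\<integral>t. F t (x t) - F t 0 \<partial>?M) = (\<integral>t. F t (x t) + k t \<partial>?M) - (\<integral>t. F t 0 + k t \<partial>?M)"
    unfolding eq by (rule Bochner_Integration.integral_diff[OF ix i0])
  then show "C1 * (L2_norm T x powr m - 1) - C2 \<le> (\<integral>t. F t (x t) - F t 0 \<partial>?M)"
    and "(\<integral>t. F t (x t) - F t 0 \<partial>?M) \<le> C2 * (1 + L2_norm T x powr n)"
    using low[OF x] up[OF x] main[OF x] main[OF zero] k0 by auto
qed

text \<open>Each growth inequality fixes the sign of a quadratic comparison on one L2 sphere, where
  the power of the norm is a plain number whatever the exponent.
  \<open>integrable_countable_bound\<close> turns this sign into a pointwise bound along a dense
  sequence, and continuity extends it to all points.\<close>

lemma potential_quadratic_bounds: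
  fixes F :: "real \<Rightarrow> 'a::{real_inner, second_countable_topology} \<Rightarrow> real"
  assumes T: "T > 0" and m: "m > 0" and n: "n > 0" and C1: "C1 > 0" and C2: "C2 > 0"
    and cont: "\<And>t X x. t \<in> {0..T} \<Longrightarrow> X \<longlonglongrightarrow> x \<Longrightarrow> (\<lambda>k. F t (X k)) \<longlonglongrightarrow> F t x"
    and int: "\<And>x. x \<in> L2_paths T \<Longrightarrow> integrable (lebesgue_on {0..T}) (\<lambda>t. F t (x t) - F t 0)"
    and low: "\<And>x. x \<in> L2_paths T \<Longrightarrow>
      C1 * (L2_norm T x powr m - 1) - C2 \<le> (\<integral>t. F t (x t) - F t 0 \<partial>lebesgue_on {0..T})"
    and up: "\<And>x. x \<in> L2_paths T \<Longrightarrow>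
      (\<integral>t. F t (x t) - F t 0 \<partial>lebesgue_on {0..T}) \<le> C2 * (1 + L2_norm T x powr n)"
  shows "\<exists>K>0. \<exists>c>0. \<exists>a b. integrable (lebesgue_on {0..T}) a \<and> integrable (lebesgue_on {0..T}) b \<and>
    (\<forall>t. 0 \<le> a t) \<and> (\<forall>t. 0 \<le> b t) \<and>
    (AE t in lebesgue_on {0..T}. \<forall>x. c * (norm x)\<^sup>2 - a t \<le> F t x - F t 0 \<and> F t x - F t 0 \<le> K * (norm x)\<^sup>2 + b t)"
proof -
  let ?M = "lebesgue_on {0..T}"
  obtain d :: "nat \<Rightarrow> 'a" where d0: "d 0 = 0" and d: "\<And>x. \<exists>r. (\<lambda>k::nat. d (r k)) \<longlonglongrightarrow> x"
    using dense_sequence_from_zero by blast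
  have L2i: "integrable ?M (\<lambda>t. (norm (x t))\<^sup>2)" if "x \<in> L2_paths T" for x :: "real \<Rightarrow> 'a"
    using that by (simp add: L2_paths_def)
  have N0: "0 \<le> (\<integral>t. (norm (x t))\<^sup>2 \<partial>?M)" for x :: "real \<Rightarrow> 'a"
    by (rule Bochner_Integration.integral_nonneg) simp
  \<comment> \<open>On the unit sphere the upper growth bound is 2 C2, so K > 2 C2 makes the
    integral of F t x - F t 0 - K |x|^2 negative there.\<close>
  define K where "K = 2 * C2 + 1"
  have K: "K > 0" using C2 by (simp add: K_def)
  have "\<exists>\<beta>. integrable ?M \<beta> \<and> (\<forall>t. 0 \<le> \<beta> t) \<and>
      (AE t in ?M. \<forall>i. (F t (d i) - F t 0) - K * (norm (d i))\<^sup>2 \<le> \<beta> t)"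
  proof (rule integrable_countable_bound[where R = 1 and B = "2 * C2"])
    fix x :: "real \<Rightarrow> 'a" assume x: "x \<in> L2_paths T"
    show "integrable ?M (\<lambda>t. (F t (x t) - F t 0) - K * (norm (x t))\<^sup>2)"
      using int[OF x] L2i[OF x] by simp
    have eq: "(\<integral>t. (F t (x t) - F t 0) - K * (norm (x t))\<^sup>2 \<partial>?M)
        = (\<integral>t. F t (x t) - F t 0 \<partial>?M) - K * (\<integral>t. (norm (x t))\<^sup>2 \<partial>?M)"
      using int[OF x] L2i[OF x] by simp
    have le: "(\<integral>t. F t (x t) - F t 0 \<partial>?M) \<le> 2 * C2" if "(\<integral>t. (norm (x t))\<^sup>2 \<partial>?M) \<le> 1"
    proof -
      have "0 \<le> L2_norm T x" "L2_norm T x \<le> 1" using that N0[of x] by (auto simp: L2_norm_def)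
      then have "L2_norm T x powr n \<le> 1 powr n" using n by (intro powr_mono2) auto
      then have "C2 * (1 + L2_norm T x powr n) \<le> C2 * 2" using C2 by (intro mult_left_mono) auto
      then show ?thesis using up[OF x] by simp
    qed
    show "(\<integral>t. (F t (x t) - F t 0) - K * (norm (x t))\<^sup>2 \<partial>?M) \<le> 2 * C2"
      if "(\<integral>t. (norm (x t))\<^sup>2 \<partial>?M) \<le> 1"
      using le[OF that] mult_nonneg_nonneg[OF less_imp_le[OF K] N0[of x]] unfolding eq by linarith
    show "(\<integral>t. (F t (x t) - F t 0) - K * (norm (x t))\<^sup>2 \<partial>?M) < 0"
      if "(\<integral>t. (norm (x t))\<^sup>2 \<partial>?M) = 1"
      using le that unfolding eq by (simp add: K_def)
  qed (use T d0 in auto)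
  then obtain b where b: "integrable ?M b" "\<And>t. 0 \<le> b t"
    and bAE: "AE t in ?M. \<forall>i. (F t (d i) - F t 0) - K * (norm (d i))\<^sup>2 \<le> b t" by blast
  \<comment> \<open>The radius at which the lower growth bound equals 2. With c = 1 / Q^2 the
    quadratic term contributes 1 on that sphere, so the comparison is at most 1 - 2 < 0.\<close>
  define Q where "Q = ((C2 + 2) / C1 + 1) powr (1 / m)"
  have q: "(C2 + 2) / C1 + 1 > 0" using C1 C2 by (intro add_pos_pos divide_pos_pos) auto
  then have Q0: "Q > 0" by (simp add: Q_def)
  from q have "Q powr m = (C2 + 2) / C1 + 1" using m by (simp add: Q_def powr_powr)
  then have Qm: "C1 * (Q powr m - 1) - C2 = 2" using C1 by (simp add: field_simps)
  define c where "c = 1 / Q\<^sup>2"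
  have c: "c > 0" using Q0 by (simp add: c_def)
  \<comment> \<open>The bound \<open>1 + C1 + C2\<close> holds on the whole ball: the quadratic term
    is at most 1 there, and the lower growth bound is at least - C1 - C2 because powers are
    nonnegative.\<close>
  have "\<exists>\<beta>. integrable ?M \<beta> \<and> (\<forall>t. 0 \<le> \<beta> t) \<and>
      (AE t in ?M. \<forall>i. c * (norm (d i))\<^sup>2 - (F t (d i) - F t 0) \<le> \<beta> t)"
  proof (rule integrable_countable_bound[where R = "Q\<^sup>2" and B = "1 + C1 + C2"])
    fix x :: "real \<Rightarrow> 'a" assume x: "x \<in> L2_paths T"
    show "integrable ?M (\<lambda>t. c * (norm (x t))\<^sup>2 - (F t (x t) - F t 0))"
      using int[OF x] L2i[OF x] by simp
    have eq: "(\<integral>t. c * (norm (x t))\<^sup>2 - (F t (x t) - F t 0) \<partial>?M)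
        = c * (\<integral>t. (norm (x t))\<^sup>2 \<partial>?M) - (\<integral>t. F t (x t) - F t 0 \<partial>?M)"
      using int[OF x] L2i[OF x] by simp
    show "(\<integral>t. c * (norm (x t))\<^sup>2 - (F t (x t) - F t 0) \<partial>?M) \<le> 1 + C1 + C2"
      if "(\<integral>t. (norm (x t))\<^sup>2 \<partial>?M) \<le> Q\<^sup>2"
    proof -
      have "c * (\<integral>t. (norm (x t))\<^sup>2 \<partial>?M) \<le> c * Q\<^sup>2" using that c by (intro mult_left_mono) auto
      also have "\<dots> = 1" using Q0 by (simp add: c_def)
      finally have "c * (\<integral>t. (norm (x t))\<^sup>2 \<partial>?M) \<le> 1" .
      moreover have "- C1 \<le> C1 * (L2_norm T x powr m - 1)"
        using mult_left_mono[of 0 "L2_norm T x powr m" C1] C1 by (simp add: algebra_simps)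
      ultimately show ?thesis using low[OF x] unfolding eq by linarith
    qed
    show "(\<integral>t. c * (norm (x t))\<^sup>2 - (F t (x t) - F t 0) \<partial>?M) < 0"
      if N: "(\<integral>t. (norm (x t))\<^sup>2 \<partial>?M) = Q\<^sup>2"
    proof -
      have "L2_norm T x = Q" using Q0 by (simp add: L2_norm_def N)
      then have "2 \<le> (\<integral>t. F t (x t) - F t 0 \<partial>?M)" using low[OF x] Qm by simp
      moreover have "c * (\<integral>t. (norm (x t))\<^sup>2 \<partial>?M) = 1" using Q0 by (simp add: N c_def)
      ultimately show ?thesis unfolding eq by linarith
    qed
  qed (use T d0 Q0 in auto)
  then obtain a where a: "integrable ?M a" "\<And>t. 0 \<le> a t"
    and aAE: "AE t in ?M. \<forall>i. c * (norm (d i))\<^sup>2 - (F t (d i) - F t 0) \<le> a t" by blast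
  have "AE t in ?M. \<forall>x. c * (norm x)\<^sup>2 - a t \<le> F t x - F t 0 \<and> F t x - F t 0 \<le> K * (norm x)\<^sup>2 + b t"
    using aAE bAE AE_space
  proof eventually_elim
    case (elim t)
    then have t: "t \<in> {0..T}" by simp
    show ?case
    proof
      fix x
      obtain r where r: "(\<lambda>k::nat. d (r k)) \<longlonglongrightarrow> x" using d by blast
      have F: "(\<lambda>k. F t (d (r k)) - F t 0) \<longlonglongrightarrow> F t x - F t 0"
        by (intro tendsto_diff cont[OF t r] tendsto_const)
      have N: "(\<lambda>k. (norm (d (r k)))\<^sup>2) \<longlonglongrightarrow> (norm x)\<^sup>2" by (intro tendsto_intros r)
      have "c * (norm x)\<^sup>2 - (F t x - F t 0) \<le> a t"
        using tendsto_diff[OF tendsto_mult[OF tendsto_const[of c] N] F]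
        by (rule LIMSEQ_le_const2) (use elim in auto)
      moreover have "(F t x - F t 0) - K * (norm x)\<^sup>2 \<le> b t"
        using tendsto_diff[OF F tendsto_mult[OF tendsto_const[of K] N]]
        by (rule LIMSEQ_le_const2) (use elim in auto)
      ultimately show "c * (norm x)\<^sup>2 - a t \<le> F t x - F t 0 \<and> F t x - F t 0 \<le> K * (norm x)\<^sup>2 + b t" by linarith
    qed
  qed
  then show ?thesis using K c a b by blast
qed

subsection \<open>Properties of the functional\<close>

lemma borel_measurable_lebesgue_on_AE:
  fixes f :: "real \<Rightarrow> 'a::{real_inner, second_countable_topology}"
  assumes f: "f \<in> borel_measurable (lebesgue_on {0..T})" and eq: "AE t in lebesgue_on {0..T}. f t = g t"
  shows "g \<in> borel_measurable (lebesgue_on {0..T})"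
proof (rule borel_measurable_if_weakly_measurable)
  fix h
  let ?f = "\<lambda>t. indicat_real {0..T} t *\<^sub>R (f t \<bullet> h)" and ?g = "\<lambda>t. indicat_real {0..T} t *\<^sub>R (g t \<bullet> h)"
  have "(\<lambda>t. f t \<bullet> h) \<in> borel_measurable (lebesgue_on {0..T})" using f by simp
  then have "?f \<in> borel_measurable lebesgue" by (subst (asm) borel_measurable_restrict_space_iff) auto
  moreover have "AE t in lebesgue. t \<in> {0..T} \<longrightarrow> f t = g t"
    using eq by (subst (asm) AE_restrict_space_iff) auto
  then have "AE t in lebesgue. ?f t = ?g t" by eventually_elim (auto simp: indicator_def)
  ultimately have "?g \<in> borel_measurable lebesgue" by (rule borel_measurable_AE)
  then show "(\<lambda>t. g t \<bullet> h) \<in> borel_measurable (lebesgue_on {0..T})"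
    by (subst borel_measurable_restrict_space_iff) auto
qed

lemma L2_paths_integrable_norm:
  fixes x :: "real \<Rightarrow> 'a::{real_normed_vector, second_countable_topology}"
  assumes "x \<in> L2_paths T"
  shows "integrable (lebesgue_on {0..T}) (\<lambda>t. norm (x t))"
proof (rule Bochner_Integration.integrable_bound)
  show "integrable (lebesgue_on {0..T}) (\<lambda>t. 1 + (norm (x t))\<^sup>2)"
    using assms integrable_const_lebesgue_on[of T 1] by (simp add: L2_paths_def)
  have "x \<in> borel_measurable (lebesgue_on {0..T})" using assms by (simp add: L2_paths_def)
  then show "(\<lambda>t. norm (x t)) \<in> borel_measurable (lebesgue_on {0..T})" by simp
  have "r \<le> 1 + r\<^sup>2" for r :: real
  proof -
    have "0 \<le> (r - 1/2)\<^sup>2" by simp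
    then show ?thesis by (simp add: power2_eq_square algebra_simps)
  qed
  then show "AE t in lebesgue_on {0..T}. norm (norm (x t)) \<le> norm (1 + (norm (x t))\<^sup>2)"
    by (intro AE_I2) simp
qed

lemma A2_paths_ac_path:
  assumes "x \<in> A2_paths T"
  shows "ac_path T x (path_deriv T x)"
  using assms L2_paths_integrable_norm[of "path_deriv T x" T]
  by (auto simp: A2_paths_def ac_path_def L2_paths_def vector_derivative_works)

lemma ac_path_path_deriv:
  assumes T: "T > 0" and x: "ac_path T x w"
  shows "AE t in lebesgue_on {0..T}. path_deriv T x t = w t"
proof -
  have "AE t in lebesgue_on {0..T}. (x has_vector_derivative w t) (at t within {0..T})"
    using x by (simp add: ac_path_def)
  moreover have "AE t in lebesgue_on {0..T}. t \<in> space (lebesgue_on {0..T})" by (rule AE_space)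
  ultimately show ?thesis
  proof eventually_elim
    case (elim t)
    then have "t \<in> {0..T}" by simp
    then show ?case
      using vector_derivative_within_cbox[of 0 T t x "w t"] T elim by simp
  qed
qed

lemma ac_path_A2_paths:
  fixes x :: "real \<Rightarrow> 'a::{real_inner, second_countable_topology}"
  assumes T: "T > 0" and x: "ac_path T x w" and w: "w \<in> L2_paths T"
  shows "x \<in> A2_paths T"
proof -
  have ae: "AE t in lebesgue_on {0..T}. w t = path_deriv T x t"
    using ac_path_path_deriv[OF T x] by eventually_elim simp
  have m: "path_deriv T x \<in> borel_measurable (lebesgue_on {0..T})"
    by (rule borel_measurable_lebesgue_on_AE[OF _ ae]) (use w in \<open>simp add: L2_paths_def\<close>)
  have "integrable (lebesgue_on {0..T}) (\<lambda>t. (norm (path_deriv T x t))\<^sup>2)"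
  proof (subst integrable_cong_AE)
    show "AE t in lebesgue_on {0..T}. (norm (path_deriv T x t))\<^sup>2 = (norm (w t))\<^sup>2"
      using ae by eventually_elim simp
  qed (use m w in \<open>auto simp: L2_paths_def\<close>)
  then have "path_deriv T x \<in> L2_paths T" using m by (simp add: L2_paths_def)
  moreover have "AE t in lebesgue_on {0..T}. x differentiable (at t within {0..T})"
    using x unfolding ac_path_def by (auto elim!: eventually_mono intro: differentiableI_vector)
  ultimately show ?thesis using x by (simp add: A2_paths_def ac_path_def)
qed

section \<open>Energy estimates along dissipative paths\<close>

lemma ac_path_norm_nonincreasing:
  fixes x :: "real \<Rightarrow> 'a::{real_inner, second_countable_topology}"
  assumes x: "ac_path T x w" and T: "0 \<le> T" and le: "\<And>t. t \<in> {0..T} \<Longrightarrow> x t \<bullet> w t \<le> 0"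
  shows "norm (x T) \<le> norm (x 0)"
proof -
  have TT: "T \<in> {0..T}" using T by simp
  have "0 \<le> (LINT s:{0..T}|lebesgue. - (x s \<bullet> w s))"
    by (rule set_integral_nonneg_real) (use le in auto)
  then have "(norm (x T))\<^sup>2 \<le> (norm (x 0))\<^sup>2"
    using ac_path_energy(2)[OF x TT] set_integral_uminus[OF ac_path_energy(1)[OF x TT]] by linarith
  then show ?thesis by (rule power2_le_imp_le) simp
qed

text \<open>Dissipation bounds \<open>norm (x t)\<close> from below by \<open>norm (x T)\<close> for all earlier times, so that the
  coercive term gains a factor on the endpoint.\<close>

lemma ac_path_dissipative_endpoint:
  fixes x :: "real \<Rightarrow> 'a::{real_inner, second_countable_topology}"
  assumes x: "ac_path T x w" and T: "T > 0" and c: "c > 0"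
    and a: "set_integrable lebesgue {0..T} a" "\<And>t. 0 \<le> a t"
    and le: "AE t in lebesgue_on {0..T}. x t \<bullet> w t \<le> a t - c * (norm (x t))\<^sup>2"
  shows "(1 + 2 * c * T) * (norm (x T))\<^sup>2 \<le> (norm (x 0))\<^sup>2 + (4 * c * T + 2) * (LINT s:{0..T}|lebesgue. a s)"
proof -
  let ?A = "LINT s:{0..T}|lebesgue. a s"
  have le': "AE t in lebesgue. t \<in> {0..T} \<longrightarrow> x t \<bullet> w t \<le> a t - c * (norm (x t))\<^sup>2"
    using le by (subst (asm) AE_restrict_space_iff) auto
  have TT: "T \<in> {0..T}" using T by simp
  have xw: "set_integrable lebesgue {0..T} (\<lambda>s. x s \<bullet> w s)" by (rule ac_path_energy(1)[OF x TT])
  have low: "(norm (x T))\<^sup>2 - 2 * ?A \<le> (norm (x t))\<^sup>2" if t: "t \<in> {0..T}" for t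
  proof -
    have "(LINT s:{t..T}|lebesgue. x s \<bullet> w s) \<le> (LINT s:{t..T}|lebesgue. a s)"
    proof (rule set_integral_mono_AE)
      show "set_integrable lebesgue {t..T} (\<lambda>s. x s \<bullet> w s)" "set_integrable lebesgue {t..T} a"
        by (rule set_integrable_subset[OF xw] set_integrable_subset[OF a(1)]; use t in auto)+
      show "AE s\<in>{t..T} in lebesgue. x s \<bullet> w s \<le> a s"
        using le'
      proof eventually_elim
        case (elim s)
        have "0 \<le> c * (norm (x s))\<^sup>2" using c by simp
        then show ?case using elim t by force
      qed
    qed
    moreover have "(LINT s:{0..T}|lebesgue. x s \<bullet> w s) = (LINT s:{0..t}|lebesgue. x s \<bullet> w s) + (LINT s:{t..T}|lebesgue. x s \<bullet> w s)"
      by (rule set_integral_Icc_split[OF xw]) (use t in auto)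
    moreover have "?A = (LINT s:{0..t}|lebesgue. a s) + (LINT s:{t..T}|lebesgue. a s)"
      by (rule set_integral_Icc_split[OF a(1)]) (use t in auto)
    moreover have "0 \<le> (LINT s:{0..t}|lebesgue. a s)" by (rule set_integral_nonneg_real) (rule a(2))
    ultimately show ?thesis
      using ac_path_energy(2)[OF x t] ac_path_energy(2)[OF x TT] by linarith
  qed
  let ?r = "(norm (x T))\<^sup>2 - 2 * ?A"
  have "(LINT s:{0..T}|lebesgue. x s \<bullet> w s) \<le> (LINT s:{0..T}|lebesgue. a s - c * ?r)"
  proof (rule set_integral_mono_AE[OF xw])
    show "set_integrable lebesgue {0..T} (\<lambda>s. a s - c * ?r)"
      by (intro set_integral_diff a set_integrable_const_lebesgue)
    show "AE s\<in>{0..T} in lebesgue. x s \<bullet> w s \<le> a s - c * ?r"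
      using le'
    proof eventually_elim
      case (elim s)
      show ?case
      proof
        assume s: "s \<in> {0..T}"
        have "c * ?r \<le> c * (norm (x s))\<^sup>2" using low[OF s] c by (intro mult_left_mono) auto
        then show "x s \<bullet> w s \<le> a s - c * ?r" using elim s by linarith
      qed
    qed
  qed
  also have "\<dots> = ?A - T * (c * ?r)"
    using T by (subst set_integral_diff(2)[OF a(1) set_integrable_const_lebesgue])
      (simp add: set_integral_const_lebesgue algebra_simps)
  finally show ?thesis
    using ac_path_energy(2)[OF x TT] by (simp add: algebra_simps)
qed

section \<open>Extended real integrals and Fenchel duality\<close>

lemma nn_integral_ennreal_real_of_integrable:
  assumes "integrable M (l :: 'a \<Rightarrow> real)"
  shows "enn2ereal (\<integral>\<^sup>+t. ennreal (l t) \<partial>M) - enn2ereal (\<integral>\<^sup>+t. ennreal (- l t) \<partial>M) = ereal (\<integral>t. l t \<partial>M)"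
    and "(\<integral>\<^sup>+t. ennreal (- l t) \<partial>M) < \<infinity>"
proof -
  have fin: "(\<integral>\<^sup>+t. ennreal (f t) \<partial>M) < \<infinity>" if "integrable M f" for f :: "'a \<Rightarrow> real"
  proof -
    have "(\<integral>\<^sup>+t. ennreal (f t) \<partial>M) \<le> (\<integral>\<^sup>+t. ennreal (norm (f t)) \<partial>M)"
      by (intro nn_integral_mono ennreal_leI) simp
    also have "\<dots> < \<infinity>" using that by (simp add: integrable_iff_bounded)
    finally show ?thesis .
  qed
  have p: "(\<integral>\<^sup>+t. ennreal (l t) \<partial>M) < \<infinity>" using fin[OF assms] .
  show n: "(\<integral>\<^sup>+t. ennreal (- l t) \<partial>M) < \<infinity>" using fin[of "\<lambda>t. - l t"] assms by simp
  have e: "enn2ereal x = ereal (enn2real x)" if "x < \<infinity>" for x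
    using that by (cases x) (auto simp: enn2ereal_ennreal)
  show "enn2ereal (\<integral>\<^sup>+t. ennreal (l t) \<partial>M) - enn2ereal (\<integral>\<^sup>+t. ennreal (- l t) \<partial>M) = ereal (\<integral>t. l t \<partial>M)"
    unfolding e[OF p] e[OF n] by (simp add: real_lebesgue_integral_def[OF assms])
qed

text \<open>Only monotonicity of \<open>nn_integral\<close> enters, so the Fenchel-Young bound can
  be integrated without a measurability statement for the conjugate along an arbitrary path. The
  integrable minorant \<open>l\<close> keeps the negative part finite.\<close>

lemma ereal_integral_ge:
  assumes l: "integrable M l" and le: "\<And>t. t \<in> space M \<Longrightarrow> ereal (l t) \<le> f t"
  shows "ereal (\<integral>t. l t \<partial>M) \<le> ereal_integral M f"
proof -
  have "(\<integral>\<^sup>+t. ennreal (l t) \<partial>M) \<le> (\<integral>\<^sup>+t. e2ennreal (f t) \<partial>M)"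
    using e2ennreal_mono[OF le] by (intro nn_integral_mono) simp
  moreover have "(\<integral>\<^sup>+t. e2ennreal (- f t) \<partial>M) \<le> (\<integral>\<^sup>+t. ennreal (- l t) \<partial>M)"
  proof (rule nn_integral_mono)
    fix t assume "t \<in> space M"
    then have "- f t \<le> ereal (- l t)" using le[of t] by (metis ereal_minus_le_minus uminus_ereal.simps(1))
    from e2ennreal_mono[OF this] show "e2ennreal (- f t) \<le> ennreal (- l t)" by simp
  qed
  ultimately show ?thesis
    unfolding ereal_integral_def nn_integral_ennreal_real_of_integrable(1)[OF l, symmetric]
    by (intro ereal_minus_mono) (simp_all add: less_eq_ennreal.rep_eq)
qed

lemma ereal_integral_eq_integral:
  assumes l: "integrable M l" and eq: "AE t in M. f t = ereal (l t)"
  shows "ereal_integral M f = ereal (\<integral>t. l t \<partial>M)"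
proof -
  have "(\<integral>\<^sup>+t. e2ennreal (f t) \<partial>M) = (\<integral>\<^sup>+t. ennreal (l t) \<partial>M)"
    by (rule nn_integral_cong_AE) (use eq in eventually_elim, simp)
  moreover have "(\<integral>\<^sup>+t. e2ennreal (- f t) \<partial>M) = (\<integral>\<^sup>+t. ennreal (- l t) \<partial>M)"
    by (rule nn_integral_cong_AE) (use eq in eventually_elim, simp)
  ultimately show ?thesis
    by (simp add: ereal_integral_def nn_integral_ennreal_real_of_integrable(1)[OF l])
qed

text \<open>The equality case of the Fenchel-Young inequality; it makes the functional vanish at the
  solution.\<close>

lemma conjugate_eq_if_subdifferential:
  assumes "p \<in> subdifferential f x"
  shows "f x + conjugate f p = ereal (x \<bullet> p)"
proof -
  obtain r where r: "f x = ereal r" using assms by (cases "f x") (auto simp: subdifferential_def)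
  have sub: "ereal (r + p \<bullet> (y - x)) \<le> f y" for y
    using assms by (simp add: subdifferential_def r)
  have "conjugate f p = ereal (x \<bullet> p - r)"
    unfolding conjugate_def
  proof (rule antisym)
    show "(SUP y. ereal (y \<bullet> p) - f y) \<le> ereal (x \<bullet> p - r)"
    proof (rule SUP_least)
      fix y
      show "ereal (y \<bullet> p) - f y \<le> ereal (x \<bullet> p - r)"
        using sub[of y] by (cases "f y") (auto simp: inner_diff_right inner_commute)
    qed
    show "ereal (x \<bullet> p - r) \<le> (SUP y. ereal (y \<bullet> p) - f y)"
      by (rule SUP_upper2[of x]) (auto simp: r)
  qed
  then show ?thesis by (simp add: r)
qed

lemma fenchel_young:
  assumes "\<And>y. f y \<noteq> -\<infinity>" and "f x0 < \<infinity>"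
  shows "ereal (x \<bullet> p) \<le> f x + conjugate f p"
proof -
  have ge: "ereal (y \<bullet> p) - f y \<le> conjugate f p" for y
    unfolding conjugate_def by (rule SUP_upper) simp
  show ?thesis
  proof (cases "f x")
    case (real r)
    then show ?thesis using ge[of x] by (cases "conjugate f p") auto
  next
    case PInf
    obtain r0 where "f x0 = ereal r0" using assms by (cases "f x0") auto
    then have "conjugate f p \<noteq> -\<infinity>" using ge[of x0] by auto
    then show ?thesis using PInf by simp
  qed (use assms in auto)
qed

subsection \<open>Unitary groups and the boundary condition\<close>

context
  fixes S :: "real \<Rightarrow> 'a::{real_inner, complete_space, second_countable_topology} \<Rightarrow> 'a"
  assumes group: "C0_unitary_group S"
begin

lemma unitary_linear: "linear (S t)"
  and unitary_inner: "S t x \<bullet> S t y = x \<bullet> y"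
  and unitary_norm: "norm (S t x) = norm x"
  using group by (auto simp: C0_unitary_group_def orthogonal_transformation_def orthogonal_transformation_norm)

lemma unitary_zero: "S 0 x = x"
  and unitary_add: "S (s + t) x = S s (S t x)"
  using group by (auto simp: C0_unitary_group_def)

lemma unitary_inverse: "S t (S (- t) x) = x" "S (- t) (S t x) = x"
  using unitary_add[of t "- t" x] unitary_add[of "- t" t x] by (simp_all add: unitary_zero)

lemma unitary_adjoint: "S (- t) x \<bullet> y = x \<bullet> S t y"
  using unitary_inner[of t "S (- t) x" y] by (simp add: unitary_inverse)

text \<open>Since every \<open>S t\<close> is an isometry, an error in the vector is not amplified,
  and strong continuity in \<open>t\<close> suffices. Joint continuity yields measurability of
  \<open>S\<close> along measurable times and paths.\<close>

lemma unitary_jointly_continuous: "continuous_on UNIV (\<lambda>p. S (fst p) (snd p))"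
  unfolding continuous_on_sequentially
proof (intro allI ballI impI, elim conjE)
  fix X :: "nat \<Rightarrow> real \<times> 'a" and p assume X: "X \<longlonglongrightarrow> p"
  have "(\<lambda>n. norm (snd (X n) - snd p) + norm (S (fst (X n)) (snd p) - S (fst p) (snd p)))
      \<longlonglongrightarrow> norm (snd p - snd p) + norm (S (fst p) (snd p) - S (fst p) (snd p))"
  proof (intro tendsto_intros X)
    have "continuous_on UNIV (\<lambda>t. S t (snd p))" using group by (simp add: C0_unitary_group_def)
    then have "isCont (\<lambda>t. S t (snd p)) (fst p)" by (simp add: continuous_on_eq_continuous_at)
    from isCont_tendsto_compose[OF this tendsto_fst[OF X]]
    show "(\<lambda>n. S (fst (X n)) (snd p)) \<longlonglongrightarrow> S (fst p) (snd p)" .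
  qed
  then have lim: "(\<lambda>n. norm (snd (X n) - snd p) + norm (S (fst (X n)) (snd p) - S (fst p) (snd p))) \<longlonglongrightarrow> 0"
    by simp
  have "norm (S (fst (X n)) (snd (X n)) - S (fst p) (snd p))
      \<le> norm (snd (X n) - snd p) + norm (S (fst (X n)) (snd p) - S (fst p) (snd p))" for n
  proof -
    have "norm (S (fst (X n)) (snd (X n)) - S (fst (X n)) (snd p)) = norm (snd (X n) - snd p)"
      using unitary_norm[of "fst (X n)" "snd (X n) - snd p"] by (simp add: linear_diff[OF unitary_linear])
    then show ?thesis
      using norm_triangle_ineq[of "S (fst (X n)) (snd (X n)) - S (fst (X n)) (snd p)" "S (fst (X n)) (snd p) - S (fst p) (snd p)"]
      by simp
  qed
  then have "(\<lambda>n. S (fst (X n)) (snd (X n)) - S (fst p) (snd p)) \<longlonglongrightarrow> 0"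
    by (intro Lim_null_comparison[OF _ lim]) simp
  then show "((\<lambda>p. S (fst p) (snd p)) \<circ> X) \<longlonglongrightarrow> S (fst p) (snd p)"
    by (simp add: o_def LIM_zero_iff)
qed

lemma unitary_path_measurable:
  assumes "f \<in> borel_measurable M" "x \<in> borel_measurable M"
  shows "(\<lambda>t. S (f t) (x t)) \<in> borel_measurable M"
  using borel_measurable_continuous_Pair[OF assms unitary_jointly_continuous] .

lemma bounded_linear_unitary: "bounded_linear (S t)"
  using unitary_linear unitary_norm
  by (intro bounded_linear_intro[of _ 1]) (auto simp: linear_add linear_scale)

end

text \<open>With q = y - z / 2 one has y = q + z / 2 and z - y = - q + z / 2. The squared norms of
  the two differences therefore differ by 2 (q - q') \<bullet> (z - z'), which is nonnegative
  because \<partial>\<psi> is monotone.\<close>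

lemma reflected_resolvent_nonexpansive:
  fixes \<psi> :: "'a::real_inner \<Rightarrow> ereal"
  assumes z: "y - z /\<^sub>R 2 \<in> subdifferential \<psi> z" and z': "y' - z' /\<^sub>R 2 \<in> subdifferential \<psi> z'"
  shows "norm ((z - y) - (z' - y')) \<le> norm (y - y')"
proof -
  define q where "q = y - z /\<^sub>R 2"
  define q' where "q' = y' - z' /\<^sub>R 2"
  obtain r where r: "\<psi> z = ereal r" using z by (cases "\<psi> z") (auto simp: subdifferential_def)
  obtain r' where r': "\<psi> z' = ereal r'" using z' by (cases "\<psi> z'") (auto simp: subdifferential_def)
  have "\<psi> z + ereal (q \<bullet> (z' - z)) \<le> \<psi> z'" "\<psi> z' + ereal (q' \<bullet> (z - z')) \<le> \<psi> z"
    using z z' unfolding q_def q'_def subdifferential_def by blast+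
  then have "r + q \<bullet> (z' - z) \<le> r'" "r' + q' \<bullet> (z - z') \<le> r" by (simp_all add: r r')
  then have mono: "0 \<le> (q - q') \<bullet> (z - z')" by (simp add: inner_diff_left inner_diff_right)
  have y: "y - y' = (q - q') + (1/2) *\<^sub>R (z - z')" by (simp add: q_def q'_def scaleR_diff_right)
  have zy: "(z - y) - (z' - y') = - (q - q') + (1/2) *\<^sub>R (z - z')"
  proof -
    have "z = (1/2) *\<^sub>R z + (1/2) *\<^sub>R z" "z' = (1/2) *\<^sub>R z' + (1/2) *\<^sub>R z'" by (simp_all flip: scaleR_add_left)
    then show ?thesis by (simp add: q_def q'_def scaleR_diff_right algebra_simps)
  qed
  have "(norm ((z - y) - (z' - y')))\<^sup>2 \<le> (norm (y - y'))\<^sup>2"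
    unfolding y zy norm_add_scaleR_square using mono
    by (simp add: inner_diff_left norm_minus_commute[of q' q])
  then show ?thesis by (rule power2_le_imp_le) simp
qed

text \<open>The boundary condition says that \<open>u 0\<close> is a fixed point of the flow map followed by the
  reflected resolvent (Cayley transform) of \<open>\<partial>\<psi>\<close>.\<close>

lemma boundary_condition_fixed_point:
  fixes P :: "'a::{real_inner, complete_space} \<Rightarrow> 'a"
  assumes bdd: "\<And>x. ereal c \<le> \<psi> x" and conv: "ereal_convex \<psi>" and lsc: "ereal_lsc \<psi>" and dom: "\<psi> x0 < \<infinity>"
    and ne: "\<And>x y. norm (P x - P y) \<le> norm (x - y)"
    and bd: "\<And>x. norm (P x) \<le> q * norm x + M" and q: "q < 1"
  shows "\<exists>x. - ((x + P x) /\<^sub>R 2) \<in> subdifferential \<psi> (x - P x)"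
proof -
  have "\<exists>z. y - z /\<^sub>R 2 \<in> subdifferential \<psi> z" for y
    by (rule subdifferential_resolvent_exists[OF bdd conv lsc dom])
  then obtain Z where Z: "\<And>y. y - Z y /\<^sub>R 2 \<in> subdifferential \<psi> (Z y)" by metis
  \<comment> \<open>The reflected resolvent z - y at y = - P x. A fixed point has z = x - P x, and
    then y - z / 2 = - (x + P x) / 2 is the required subgradient.\<close>
  define F where "F x = Z (- P x) + P x" for x
  have Fne: "norm (F x - F y) \<le> norm (P x - P y)" for x y
  proof -
    have "norm ((Z (- P x) - (- P x)) - (Z (- P y) - (- P y))) \<le> norm (- P x - (- P y))"
      by (rule reflected_resolvent_nonexpansive[OF Z Z])
    also have "\<dots> = norm (P x - P y)" by (simp add: norm_minus_commute)
    finally show ?thesis by (simp add: F_def)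
  qed
  have "\<exists>x. F x = x"
  proof (rule nonexpansive_fixed_point)
    show "norm (F x - F y) \<le> norm (x - y)" for x y using Fne ne order_trans by blast
    \<comment> \<open>The slope \<open>q\<close> survives because \<open>F x\<close> depends on
      \<open>P x\<close> in a nonexpansive way; the values at 0 only enter the additive
      constant.\<close>
    show "norm (F x) \<le> q * norm x + (M + (norm (P 0) + norm (F 0)))" for x
      using Fne[of x 0] norm_triangle_ineq4[of "P x" "P 0"] norm_triangle_sub[of "F x" "F 0"] bd[of x]
      by linarith
  qed (rule q)
  then obtain x where x: "Z (- P x) + P x = x" by (auto simp: F_def)
  then have z: "Z (- P x) = x - P x" by (simp add: eq_diff_eq)
  have "P x = (1/2) *\<^sub>R P x + (1/2) *\<^sub>R P x" by (simp flip: scaleR_add_left)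
  then have "- P x - (x - P x) /\<^sub>R 2 = - ((x + P x) /\<^sub>R 2)"
    by (simp add: algebra_simps)
  then show ?thesis using Z[of "- P x"] unfolding z by (intro exI[of _ x]) simp
qed

subsection \<open>Existence of the path\<close>

theorem theorem3p1:
  fixes S :: "real \<Rightarrow> 'a::{real_inner, complete_space, second_countable_topology} \<Rightarrow> 'a"
    and D :: "'a set" and A :: "'a \<Rightarrow> 'a"
    and \<phi> :: "real \<Rightarrow> 'a \<Rightarrow> ereal" and \<psi> :: "'a \<Rightarrow> ereal"
    and T m n C1 C2 \<omega> :: real
  assumes skew: "skew_adjoint D A"
    and group: "C0_unitary_group S" and gen: "is_generator D A S"
    and T: "T > 0"
    and meas: "(\<lambda>(t, x). \<phi> t x) \<in> borel_measurable (lebesgue_on {0..T} \<Otimes>\<^sub>M borel)"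
    and proper: "\<forall>t\<in>{0..T}. \<forall>x. \<phi> t x \<noteq> -\<infinity>"
    and convex: "\<forall>t\<in>{0..T}. ereal_convex (\<phi> t)"
    and gateaux: "\<forall>t\<in>{0..T}. \<forall>x. gateaux_differentiable_at (\<phi> t) x"
    and exponents: "m > 1" "n > 1" "C1 > 0" "C2 > 0"
    and growth: "\<forall>x\<in>L2_paths T.
        ereal (C1 * (L2_norm T x powr m - 1))
          \<le> ereal_integral (lebesgue_on {0..T}) (\<lambda>t. \<phi> t (x t) + conjugate (\<phi> t) 0) \<and>
        ereal_integral (lebesgue_on {0..T}) (\<lambda>t. \<phi> t (x t) + conjugate (\<phi> t) 0)
          \<le> ereal (C2 * (1 + L2_norm T x powr n))"
    and psi_bdd: "\<exists>c::real. \<forall>x. ereal c \<le> \<psi> x"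
    and psi_convex: "ereal_convex \<psi>" and psi_lsc: "ereal_lsc \<psi>"
    and psi_dom: "0 \<in> eff_domain \<psi>"
  shows "\<exists>u\<in>A2_paths T.
      path_functional T \<omega> S \<phi> \<psi> u = (INF x\<in>A2_paths T. path_functional T \<omega> S \<phi> \<psi> x) \<and>
      (INF x\<in>A2_paths T. path_functional T \<omega> S \<phi> \<psi> x) = 0 \<and>
      (let v = (\<lambda>t. S t (exp (\<omega> * t) *\<^sub>R u t)) in
        (\<exists>g. (\<forall>s\<in>{0..T}. subdifferential (\<phi> s) (v s) = {g s}) \<and>
          (\<forall>t\<in>{0..T}.
             set_integrable lebesgue {0..t} (\<lambda>s. S (t - s) (g s - \<omega> *\<^sub>R v s)) \<and>
             v t = S t (v 0) - (LINT s:{0..t}|lebesgue. S (t - s) (g s - \<omega> *\<^sub>R v s)))) \<and>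
        (v 0 + S (- T) (exp (- \<omega> * T) *\<^sub>R v T)) /\<^sub>R 2
          \<in> uminus ` subdifferential \<psi> (v 0 - S (- T) (exp (- \<omega> * T) *\<^sub>R v T)))"
proof -
  let ?M = "lebesgue_on {0..T}"
  define F where "F t x = real_of_ereal (\<phi> t x)" for t x
  have F: "\<phi> t x = ereal (F t x)" if "t \<in> {0..T}" for t x
    using gateaux that by (auto simp: gateaux_differentiable_at_def F_def ereal_real')
  have F_eq: "\<phi> t = (\<lambda>x. ereal (F t x))" if "t \<in> {0..T}" for t
    by (rule ext) (rule F[OF that])
  have "\<forall>t\<in>{0..T}. \<exists>g. gateaux_convex (F t) g"
    using gateaux_convex_gradient_exists convex gateaux unfolding F_def by blast
  from bchoice[OF this] obtain g where g: "\<And>t. t \<in> {0..T} \<Longrightarrow> gateaux_convex (F t) (g t)" by blast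
  have cont: "\<And>t X x. t \<in> {0..T} \<Longrightarrow> X \<longlonglongrightarrow> x \<Longrightarrow> (\<lambda>k. F t (X k)) \<longlonglongrightarrow> F t x"
    by (rule gateaux_convex.tendsto_F[OF g])
  have "\<exists>K>0. \<exists>c>0. \<exists>a b. integrable ?M a \<and> integrable ?M b \<and>
    (\<forall>t. 0 \<le> a t) \<and> (\<forall>t. 0 \<le> b t) \<and>
    (AE t in ?M. \<forall>x. c * (norm x)\<^sup>2 - a t \<le> F t x - F t 0 \<and> F t x - F t 0 \<le> K * (norm x)\<^sup>2 + b t)"
    using exponents
    by (intro potential_quadratic_bounds[where m = m and n = n and ?C1.0 = C1 and ?C2.0 = C2] T cont
        potential_growth[OF meas F cont _ growth]) auto
  then obtain K c a b where K: "K > 0" and c: "c > 0" and ai: "integrable ?M a" and bi: "integrable ?M b"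
    and a0: "\<And>t. 0 \<le> a t" and b0: "\<And>t. 0 \<le> b t"
    and bounds: "AE t in ?M. \<forall>x. c * (norm x)\<^sup>2 - a t \<le> F t x - F t 0 \<and> F t x - F t 0 \<le> K * (norm x)\<^sup>2 + b t"
    by blast

  \<comment> \<open>The gradient of the transported potential\<close>
  define E where "E t x = exp (\<omega> * t) *\<^sub>R S t x" for t x
  \<comment> \<open>The adjoint of \<open>E t\<close> is exp (\<omega> t) S (- t); with the weight
    exp (- 2 \<omega> t) the chain rule turns \<open>g t\<close> into this gradient of exp (- 2
    \<omega> t) F t (E t x).\<close>
  define G where "G t x = exp (- \<omega> * t) *\<^sub>R S (- t) (g t (E t x))" for t x
  have norm_E: "norm (E t x) = exp (\<omega> * t) * norm x" for t x
    by (simp add: E_def unitary_norm[OF group])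
  have norm_G: "norm (G t x) = exp (- \<omega> * t) * norm (g t (E t x))" for t x
    by (simp add: G_def unitary_norm[OF group])
  have E_diff: "E t (x - y) = E t x - E t y" for t x y
    by (simp add: E_def linear_diff[OF unitary_linear[OF group]] scaleR_diff_right)
  have inner_G: "exp (- \<omega> * t) *\<^sub>R S (- t) p \<bullet> x = exp (- 2 * \<omega> * t) * (p \<bullet> E t x)" for t p x
  proof -
    have "exp (- 2 * \<omega> * t) * exp (\<omega> * t) = exp (- \<omega> * t)" by (simp flip: exp_add)
    then show ?thesis
      by (simp add: E_def unitary_adjoint[OF group] flip: mult.assoc)
  qed
  define e where "e = exp (\<bar>\<omega>\<bar> * T)"
  have e1: "e \<ge> 1" using T by (simp add: e_def)
  have e_ge: "exp (- \<omega> * t) \<le> e" if "t \<in> {0..T}" for t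
  proof -
    have "- \<omega> * t \<le> \<bar>\<omega>\<bar> * t" using that by (intro mult_right_mono) auto
    also have "\<dots> \<le> \<bar>\<omega>\<bar> * T" using that by (intro mult_left_mono) auto
    finally show ?thesis by (simp add: e_def)
  qed
  \<comment> \<open>The constant term of \<open>norm_gradient_le\<close>, with exp (- \<omega> t)
    bounded by \<open>e\<close>. The square root makes \<open>\<beta>\<close> square integrable when
    \<open>a\<close> and \<open>b\<close> are integrable, which later puts the velocity into
    L2.\<close>
  define \<beta> where "\<beta> t = e * sqrt (8 * K * (a t + b t))" for t
  have ab: "integrable ?M (\<lambda>t. a t + b t)" using ai bi by simp
  have \<beta>sq: "(\<beta> t)\<^sup>2 = e\<^sup>2 * (8 * K * (a t + b t))" for t
    using K a0 b0 by (simp add: \<beta>_def power_mult_distrib)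
  have \<beta>m: "\<beta> \<in> borel_measurable ?M" unfolding \<beta>_def using borel_measurable_integrable[OF ab] by simp
  have \<beta>2: "integrable ?M (\<lambda>t. (\<beta> t)\<^sup>2)" unfolding \<beta>sq using ab by simp
  have \<beta>L: "\<beta> \<in> L2_paths T" using \<beta>m \<beta>2 by (simp add: L2_paths_def)
  have \<beta>0: "0 \<le> \<beta> t" for t using K a0 b0 e1 by (simp add: \<beta>_def)
  have \<beta>i: "set_integrable lebesgue {0..T} \<beta>"
    using L2_paths_integrable_norm[OF \<beta>L] \<beta>0 by (simp add: set_integrable_eq)
  have growth_G: "AE t in ?M. \<forall>x. norm (G t x) \<le> 4 * K * norm x + \<beta> t"
    using bounds AE_space
  proof eventually_elim
    case (elim t)
    then have t: "t \<in> {0..T}" by simp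
    show ?case
    proof
      fix x
      have "norm (g t (E t x)) \<le> 4 * K * norm (E t x) + sqrt (8 * K * (a t + b t))"
      proof (rule gateaux_convex.norm_gradient_le[OF g[OF t] K a0 b0])
        fix y
        show "F t y - F t 0 \<le> K * (norm y)\<^sup>2 + b t" using elim by blast
        have "0 \<le> c * (norm y)\<^sup>2" using c by simp
        then show "- a t \<le> F t y - F t 0" using elim by (smt (verit))
      qed
      then have "norm (G t x) \<le> exp (- \<omega> * t) * (4 * K * norm (E t x) + sqrt (8 * K * (a t + b t)))"
        unfolding norm_G by (intro mult_left_mono) auto
      also have "\<dots> = (exp (- \<omega> * t) * exp (\<omega> * t)) * (4 * K * norm x) + exp (- \<omega> * t) * sqrt (8 * K * (a t + b t))"
        unfolding norm_E by (simp only: algebra_simps)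
      also have "exp (- \<omega> * t) * exp (\<omega> * t) = 1" by (simp flip: exp_add)
      also have "exp (- \<omega> * t) * sqrt (8 * K * (a t + b t)) \<le> \<beta> t"
        unfolding \<beta>_def by (intro mult_right_mono e_ge[OF t]) (use K a0 b0 in auto)
      finally show "norm (G t x) \<le> 4 * K * norm x + \<beta> t" by simp
    qed
  qed
  \<comment> \<open>The tangent at \<open>E t x\<close>, evaluated at 0, gives F t (E t x) - F t 0
    \<le> g t (E t x) \<bullet> E t x; the weight turns |E t x|^2 back into |x|^2.\<close>
  have coercive_G: "AE t in ?M. \<forall>x. c * (norm x)\<^sup>2 - e\<^sup>2 * a t \<le> G t x \<bullet> x"
    using bounds AE_space
  proof eventually_elim
    case (elim t)
    then have t: "t \<in> {0..T}" by simp
    show ?case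
    proof
      fix x
      let ?r = "exp (- 2 * \<omega> * t)"
      have r: "?r = (exp (- \<omega> * t))\<^sup>2" by (simp add: power2_eq_square flip: exp_add)
      have "c * (norm (E t x))\<^sup>2 - a t \<le> F t (E t x) - F t 0" using elim by blast
      also have "\<dots> \<le> g t (E t x) \<bullet> E t x" by (rule gateaux_convex.inner_gradient_ge[OF g[OF t]])
      finally have "?r * (c * (norm (E t x))\<^sup>2 - a t) \<le> G t x \<bullet> x"
        unfolding G_def inner_G by (intro mult_left_mono) auto
      moreover have "?r * (norm (E t x))\<^sup>2 = (norm x)\<^sup>2"
        unfolding norm_E r by (simp add: exp_minus flip: power_mult_distrib)
      then have "?r * (c * (norm (E t x))\<^sup>2 - a t) = c * (norm x)\<^sup>2 - ?r * a t"
        by (simp add: right_diff_distrib mult.left_commute)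
      moreover have "?r * a t \<le> e\<^sup>2 * a t"
        unfolding r using e_ge[OF t] a0 by (intro mult_right_mono power_mono) auto
      ultimately show "c * (norm x)\<^sup>2 - e\<^sup>2 * a t \<le> G t x \<bullet> x" by linarith
    qed
  qed
  have mono_G: "0 \<le> (G t x - G t y) \<bullet> (x - y)" if t: "t \<in> {0..T}" for t x y
  proof -
    have "(G t x - G t y) \<bullet> (x - y) = exp (- 2 * \<omega> * t) * ((g t (E t x) - g t (E t y)) \<bullet> (E t x - E t y))"
      unfolding G_def inner_diff_left inner_G E_diff by (simp add: right_diff_distrib)
    then show ?thesis
      using gateaux_convex.gradient_monotone[OF g[OF t], of "E t x" "E t y"] by simp
  qed
  have demi_G: "(\<lambda>k. G t (X k) \<bullet> h) \<longlonglongrightarrow> G t x \<bullet> h" if t: "t \<in> {0..T}" and X: "X \<longlonglongrightarrow> x" for t X x h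
  proof -
    have "(\<lambda>k. E t (X k)) \<longlonglongrightarrow> E t x"
      unfolding E_def by (intro tendsto_intros bounded_linear.tendsto[OF bounded_linear_unitary[OF group]] X)
    from gateaux_convex.demicontinuous[OF g[OF t] this] show ?thesis
      unfolding G_def inner_G by (intro tendsto_mult tendsto_const)
  qed
  have cont_meas: "r \<in> borel_measurable ?M" if "continuous_on {0..T} r" for r :: "real \<Rightarrow> real"
    by (rule continuous_on_imp_borel_measurable_lebesgue_on[OF that])
  have meas_E: "(\<lambda>t. E t (u t)) \<in> borel_measurable ?M" if u: "u \<in> borel_measurable ?M" for u
    unfolding E_def
    by (intro borel_measurable_scaleR unitary_path_measurable[OF group] u cont_meas continuous_intros)
  have meas_g: "(\<lambda>t. g t (v t)) \<in> borel_measurable ?M" if v: "v \<in> borel_measurable ?M" for v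
  proof (rule borel_measurable_if_weakly_measurable)
    fix h
    \<comment> \<open>The pairing with \<open>h\<close> is a limit of difference quotients along the
      steps 1 / (k + 1), each of which is measurable in time.\<close>
    let ?r = "\<lambda>k. inverse (real (Suc k))"
    have Fm: "(\<lambda>t. F t (y t)) \<in> borel_measurable ?M" if "y \<in> borel_measurable ?M" for y
      unfolding F_def using measurable_along_path[OF meas that] by simp
    show "(\<lambda>t. g t (v t) \<bullet> h) \<in> borel_measurable ?M"
    proof (rule borel_measurable_LIMSEQ_real)
      fix k
      have "(\<lambda>t. v t + ?r k *\<^sub>R h) \<in> borel_measurable ?M" using v by simp
      from Fm[OF this] Fm[OF v]
      show "(\<lambda>t. (F t (v t + ?r k *\<^sub>R h) - F t (v t)) / ?r k) \<in> borel_measurable ?M" by simp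
    next
      fix t assume "t \<in> space ?M"
      then have t: "t \<in> {0..T}" by simp
      have "filterlim ?r (at 0) sequentially"
        using LIMSEQ_inverse_real_of_nat by (rule filterlim_atI) simp
      from filterlim_compose[OF gateaux_convex.gradient[OF g[OF t]] this]
      show "(\<lambda>k. (F t (v t + ?r k *\<^sub>R h) - F t (v t)) / ?r k) \<longlonglongrightarrow> g t (v t) \<bullet> h" .
    qed
  qed
  have meas_G: "(\<lambda>t. G t (u t)) \<in> borel_measurable ?M" if u: "u \<in> borel_measurable ?M" for u
    unfolding G_def
    by (intro borel_measurable_scaleR unitary_path_measurable[OF group] meas_g meas_E u
        cont_meas continuous_intros)

  \<comment> \<open>The flow map and its linear bound\<close>
  have "\<forall>x0. \<exists>u. ac_path T u (\<lambda>t. - G t (u t)) \<and> u 0 = x0"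
    using K by (intro allI monotone_evolution_solution[OF T meas_G _ \<beta>i \<beta>0 growth_G mono_G demi_G]) auto
  from choice[OF this] obtain U where U: "\<And>x. ac_path T (U x) (\<lambda>t. - G t (U x t))" and U0: "\<And>x. U x 0 = x"
    by blast
  define P where "P x = U x T" for x
  have P_ne: "norm (P x - P y) \<le> norm (x - y)" for x y
  proof -
    have "norm (U x T - U y T) \<le> norm (U x 0 - U y 0)"
    proof (rule ac_path_norm_nonincreasing[OF ac_path_diff[OF U[of x] U[of y]] less_imp_le[OF T]])
      fix t assume t: "t \<in> {0..T}"
      have "- G t (U x t) - - G t (U y t) = - (G t (U x t) - G t (U y t))" by simp
      then have "(U x t - U y t) \<bullet> (- G t (U x t) - - G t (U y t)) = - ((G t (U x t) - G t (U y t)) \<bullet> (U x t - U y t))"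
        by (simp only: inner_minus_right inner_commute)
      then show "(U x t - U y t) \<bullet> (- G t (U x t) - - G t (U y t)) \<le> 0"
        using mono_G[OF t, of "U x t" "U y t"] by linarith
    qed
    then show ?thesis by (simp only: P_def U0)
  qed
  \<comment> \<open>From here on \<open>A\<close> denotes this constant and no longer the
    operator.\<close>
  define A where "A = (LINT s:{0..T}|lebesgue. e\<^sup>2 * a s)"
  have P_sq: "(1 + 2 * c * T) * (norm (P x))\<^sup>2 \<le> (norm x)\<^sup>2 + (4 * c * T + 2) * A" for x
    unfolding P_def A_def
  proof -
    have "AE t in ?M. U x t \<bullet> - G t (U x t) \<le> e\<^sup>2 * a t - c * (norm (U x t))\<^sup>2"
      using coercive_G
    proof eventually_elim
      case (elim t)
      then have "c * (norm (U x t))\<^sup>2 - e\<^sup>2 * a t \<le> G t (U x t) \<bullet> U x t" by blast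
      then show ?case by (simp add: inner_commute)
    qed
    moreover have "set_integrable lebesgue {0..T} (\<lambda>s. e\<^sup>2 * a s)" using ai by (simp add: set_integrable_eq)
    ultimately show "(1 + 2 * c * T) * (norm (U x T))\<^sup>2 \<le> (norm x)\<^sup>2 + (4 * c * T + 2) * (LINT s:{0..T}|lebesgue. e\<^sup>2 * a s)"
      using ac_path_dissipative_endpoint[OF U[of x] T c, of "\<lambda>s. e\<^sup>2 * a s"] a0 U0[of x] by simp
  qed
  have A0: "A \<ge> 0" unfolding A_def by (rule set_integral_nonneg_real) (use a0 in simp)
  define D' where "D' = 1 + 2 * c * T"
  define A' where "A' = (4 * c * T + 2) * A"
  have D': "D' > 1" using c T by (simp add: D'_def)
  have A': "A' \<ge> 0" using A0 c T by (simp add: A'_def)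
  \<comment> \<open>\<open>P_sq\<close> bounds the squared norm with the factor 1 / D' < 1; its
    square root is the slope, and splitting the square root of the sum leaves the constant
    \<open>sqrt A'\<close>.\<close>
  define q where "q = 1 / sqrt D'"
  have q01: "0 \<le> q" "q < 1" using D' by (simp_all add: q_def)
  have P_bound: "norm (P x) \<le> q * norm x + sqrt A'" for x
  proof -
    have "(norm (P x))\<^sup>2 \<le> ((norm x)\<^sup>2 + A') / D'"
      using P_sq[of x] D' unfolding D'_def[symmetric] A'_def[symmetric] by (simp add: pos_le_divide_eq mult.commute)
    also have "\<dots> = (norm x)\<^sup>2 / D' + A' / D'" by (rule add_divide_distrib)
    also have "A' / D' \<le> A'"
      using mult_left_mono[of 1 D' A'] D' A' by (simp add: pos_divide_le_eq)
    also have "(norm x)\<^sup>2 / D' + A' = (q * norm x)\<^sup>2 + (sqrt A')\<^sup>2"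
      using D' A' by (simp add: q_def power_mult_distrib power_divide)
    also have "\<dots> \<le> (q * norm x + sqrt A')\<^sup>2" using q01 A' by (simp add: power2_sum)
    finally show ?thesis by (rule power2_le_imp_le) (use q01 A' in auto)
  qed
  obtain c\<psi> where c\<psi>: "\<And>x. ereal c\<psi> \<le> \<psi> x" using psi_bdd by blast
  have psi0: "\<psi> 0 < \<infinity>" using psi_dom by (simp add: eff_domain_def)
  have psi_not: "\<psi> x \<noteq> -\<infinity>" for x using c\<psi>[of x] by auto
  obtain x0 where x0: "- ((x0 + P x0) /\<^sub>R 2) \<in> subdifferential \<psi> (x0 - P x0)"
    using boundary_condition_fixed_point[OF c\<psi> psi_convex psi_lsc psi0 P_ne P_bound q01(2)] by blast
  define u where "u = U x0"
  have u: "ac_path T u (\<lambda>t. - G t (u t))" and u0: "u 0 = x0" and uT: "u T = P x0"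
    using U[of x0] U0[of x0] by (simp_all add: u_def P_def)
  have TT: "T \<in> {0..T}" using T by simp
  have um: "u \<in> borel_measurable ?M"
    by (rule continuous_on_imp_borel_measurable_lebesgue_on[OF ac_path_continuous_on[OF u]])
  have GL: "(\<lambda>t. - G t (u t)) \<in> L2_paths T"
  proof -
    obtain B where B: "\<And>t. t \<in> {0..T} \<Longrightarrow> norm (u t) \<le> B" using ac_path_bounded[OF u] by blast
    have "integrable ?M (\<lambda>t. (norm (- G t (u t)))\<^sup>2)"
    proof (rule Bochner_Integration.integrable_bound)
      show "integrable ?M (\<lambda>t. 2 * (4 * K * B)\<^sup>2 + 2 * (\<beta> t)\<^sup>2)"
        using \<beta>2 integrable_const_lebesgue_on[of T "2 * (4 * K * B)\<^sup>2"] by simp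
      show "(\<lambda>t. (norm (- G t (u t)))\<^sup>2) \<in> borel_measurable ?M" using meas_G[OF um] by simp
      show "AE t in ?M. norm ((norm (- G t (u t)))\<^sup>2) \<le> norm (2 * (4 * K * B)\<^sup>2 + 2 * (\<beta> t)\<^sup>2)"
        using growth_G AE_space
      proof eventually_elim
        case (elim t)
        then have t: "t \<in> {0..T}" by simp
        have "norm (G t (u t)) \<le> 4 * K * norm (u t) + \<beta> t" using elim by blast
        also have "\<dots> \<le> 4 * K * B + \<beta> t" using B[OF t] K by simp
        finally have "(norm (G t (u t)))\<^sup>2 \<le> (4 * K * B + \<beta> t)\<^sup>2" by (rule power_mono) simp
        also have "\<dots> \<le> 2 * (4 * K * B)\<^sup>2 + 2 * (\<beta> t)\<^sup>2"
          using zero_le_power2[of "4 * K * B - \<beta> t"] by (simp add: power2_sum power2_diff)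
        finally show ?case by simp
      qed
    qed
    then show ?thesis using meas_G[OF um] by (simp add: L2_paths_def)
  qed
  have uA: "u \<in> A2_paths T" by (rule ac_path_A2_paths[OF T u GL])

  \<comment> \<open>The value of the functional\<close>
  let ?f = "\<lambda>x t. ereal (exp (- 2 * \<omega> * t)) *
      (\<phi> t (exp (\<omega> * t) *\<^sub>R S t (x t)) + conjugate (\<phi> t) (- (exp (\<omega> * t) *\<^sub>R S t (path_deriv T x t))))"
  \<comment> \<open>Expresses the change of energy through the pairing of the arguments of \<psi>
    and of its conjugate, so that the time integral and the boundary terms fit together.\<close>
  have polar: "- (((norm r)\<^sup>2 - (norm p)\<^sup>2) / 2) = - ((p - r) \<bullet> (- ((p + r) /\<^sub>R 2)))" for p r :: 'a
  proof -
    have "(p - r) \<bullet> (p + r) = (norm p)\<^sup>2 - (norm r)\<^sup>2"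
      by (simp add: power2_norm_eq_inner inner_diff_left inner_add_right inner_commute[of r p])
    then show ?thesis by (simp only: inner_minus_right inner_scaleR_right) (simp add: field_simps)
  qed
  have energy: "integrable ?M (\<lambda>t. - (x t \<bullet> w t))"
      "(\<integral>t. - (x t \<bullet> w t) \<partial>?M) = - ((x 0 - x T) \<bullet> (- ((x 0 + x T) /\<^sub>R 2)))"
    if x: "ac_path T x w" for x w :: "real \<Rightarrow> 'a"
  proof -
    have "integrable ?M (\<lambda>t. x t \<bullet> w t)"
      using ac_path_energy(1)[OF x TT] by (simp add: set_integrable_eq)
    then show "integrable ?M (\<lambda>t. - (x t \<bullet> w t))" by simp
    have "(\<integral>t. x t \<bullet> w t \<partial>?M) = (LINT t:{0..T}|lebesgue. x t \<bullet> w t)"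
      by (simp add: set_lebesgue_integral_def integral_restrict_space)
    also have "\<dots> = ((norm (x T))\<^sup>2 - (norm (x 0))\<^sup>2) / 2"
      using ac_path_energy(2)[OF x TT] by simp
    finally show "(\<integral>t. - (x t \<bullet> w t) \<partial>?M) = - ((x 0 - x T) \<bullet> (- ((x 0 + x T) /\<^sub>R 2)))"
      by (simp only: Bochner_Integration.integral_minus polar)
  qed
  \<comment> \<open>The weight cancels the two factors exp (\<omega> t), and \<open>S t\<close>
    preserves inner products; the pointwise Fenchel-Young bound becomes - x \<bullet> x'.\<close>
  have scale: "exp (- 2 * \<omega> * t) * (E t x \<bullet> - E t y) = - (x \<bullet> y)" for t x y
  proof -
    have "exp (- 2 * \<omega> * t) * (exp (\<omega> * t) * exp (\<omega> * t)) = 1" by (simp flip: exp_add)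
    then show ?thesis by (simp add: E_def unitary_inner[OF group] flip: mult.assoc)
  qed
  have nonneg: "0 \<le> path_functional T \<omega> S \<phi> \<psi> x" if x: "x \<in> A2_paths T" for x
  proof -
    let ?w = "path_deriv T x" and ?p = "x 0 - x T" and ?b = "- ((x 0 + x T) /\<^sub>R 2)"
    have ac: "ac_path T x ?w" by (rule A2_paths_ac_path[OF x])
    have "ereal (\<integral>t. - (x t \<bullet> ?w t) \<partial>?M) \<le> ereal_integral ?M (?f x)"
    proof (rule ereal_integral_ge[OF energy(1)[OF ac]])
      fix t assume "t \<in> space ?M"
      then have t: "t \<in> {0..T}" by simp
      have "ereal (E t (x t) \<bullet> - E t (?w t)) \<le> \<phi> t (E t (x t)) + conjugate (\<phi> t) (- E t (?w t))"
        by (rule fenchel_young[of _ 0]) (auto simp: F[OF t])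
      then have "ereal (exp (- 2 * \<omega> * t)) * ereal (E t (x t) \<bullet> - E t (?w t))
          \<le> ereal (exp (- 2 * \<omega> * t)) * (\<phi> t (E t (x t)) + conjugate (\<phi> t) (- E t (?w t)))"
        by (rule ereal_mult_left_mono) simp
      then show "ereal (- (x t \<bullet> ?w t)) \<le> ?f x t"
        unfolding times_ereal.simps scale by (simp only: E_def)
    qed
    moreover have "ereal (?p \<bullet> ?b) \<le> \<psi> ?p + conjugate \<psi> ?b"
      by (rule fenchel_young[of \<psi> 0, OF psi_not psi0])
    \<comment> \<open>By the energy identity the two lower bounds are opposite finite
      numbers.\<close>
    ultimately have "ereal (- (?p \<bullet> ?b)) + ereal (?p \<bullet> ?b) \<le> ereal_integral ?M (?f x) + (\<psi> ?p + conjugate \<psi> ?b)"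
      unfolding energy(2)[OF ac] by (rule add_mono)
    then show ?thesis by (simp add: path_functional_def add.assoc zero_ereal_def)
  qed
  have zero: "path_functional T \<omega> S \<phi> \<psi> u = 0"
  proof -
    let ?p = "u 0 - u T" and ?b = "- ((u 0 + u T) /\<^sub>R 2)"
    have "ereal_integral ?M (?f u) = ereal (\<integral>t. - (u t \<bullet> - G t (u t)) \<partial>?M)"
    proof (rule ereal_integral_eq_integral[OF energy(1)[OF u]])
      show "AE t in ?M. ?f u t = ereal (- (u t \<bullet> - G t (u t)))"
        using ac_path_path_deriv[OF T u] AE_space
      proof eventually_elim
        case (elim t)
        then have t: "t \<in> {0..T}" by simp
        have "E t (G t (u t)) = g t (E t (u t))"
        proof -
          have "exp (\<omega> * t) * exp (- \<omega> * t) = 1" by (simp flip: exp_add)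
          then show ?thesis
            by (simp add: E_def G_def linear_scale[OF unitary_linear[OF group]] unitary_inverse[OF group])
        qed
        moreover have "E t (- G t (u t)) = - E t (G t (u t))"
          using E_diff[of t 0 "G t (u t)"] E_diff[of t 0 0] by simp
        \<comment> \<open>The evolution equation says exactly that the argument of the conjugate is
          the gradient at the argument of \<phi>, the case of equality in the Fenchel-Young
          inequality.\<close>
        ultimately have d: "- E t (path_deriv T u t) = g t (E t (u t))" using elim by simp
        have "g t (E t (u t)) \<in> subdifferential (\<phi> t) (E t (u t))"
          using gateaux_convex.subdifferential_eq[OF g[OF t]] by (simp add: F_eq[OF t])
        from conjugate_eq_if_subdifferential[OF this]
        have "\<phi> t (E t (u t)) + conjugate (\<phi> t) (- E t (path_deriv T u t)) = ereal (E t (u t) \<bullet> - E t (path_deriv T u t))"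
          unfolding d .
        then have "?f u t = ereal (exp (- 2 * \<omega> * t) * (E t (u t) \<bullet> - E t (path_deriv T u t)))"
          by (simp only: E_def times_ereal.simps)
        then show ?case unfolding scale using elim by simp
      qed
    qed
    moreover have "\<psi> ?p + conjugate \<psi> ?b = ereal (?p \<bullet> ?b)"
      by (rule conjugate_eq_if_subdifferential) (use x0 in \<open>simp add: u0 uT\<close>)
    ultimately have "ereal_integral ?M (?f u) + (\<psi> ?p + conjugate \<psi> ?b) = ereal (- (?p \<bullet> ?b)) + ereal (?p \<bullet> ?b)"
      unfolding energy(2)[OF u] by simp
    then show ?thesis by (simp add: path_functional_def add.assoc zero_ereal_def)
  qed
  have inf: "(INF x\<in>A2_paths T. path_functional T \<omega> S \<phi> \<psi> x) = 0"
  proof (rule antisym)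
    show "(INF x\<in>A2_paths T. path_functional T \<omega> S \<phi> \<psi> x) \<le> 0"
      using INF_lower[OF uA, of "path_functional T \<omega> S \<phi> \<psi>"] by (simp add: zero)
    show "0 \<le> (INF x\<in>A2_paths T. path_functional T \<omega> S \<phi> \<psi> x)"
      by (rule INF_greatest) (rule nonneg)
  qed

  \<comment> \<open>The integral equation and the boundary condition\<close>
  define v where "v t = S t (exp (\<omega> * t) *\<^sub>R u t)" for t
  have vE: "v t = E t (u t)" for t
    by (simp add: v_def E_def linear_scale[OF unitary_linear[OF group]])
  have subd: "subdifferential (\<phi> s) (v s) = {g s (v s)}" if s: "s \<in> {0..T}" for s
    using gateaux_convex.subdifferential_eq[OF g[OF s]] by (simp add: F_eq[OF s])
  have v0: "v 0 = x0" by (simp add: v_def u0 unitary_zero[OF group])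
  \<comment> \<open>The derivative of exp (\<omega> t) u t almost everywhere. The integrand of the
    integral equation is \<open>- S t (W s)\<close>, so \<open>S t\<close> can be pulled out and the
    equation reduces to the fundamental theorem for that path.\<close>
  define W where "W s = exp (\<omega> * s) *\<^sub>R - G s (u s) + (\<omega> * exp (\<omega> * s)) *\<^sub>R u s" for s
  have Wp: "ac_path T (\<lambda>t. exp (\<omega> * t) *\<^sub>R u t) W"
    unfolding W_def by (rule ac_path_bilinear[OF bounded_bilinear_scaleR ac_path_exp u])
  have SW: "S (t - s) (g s (v s) - \<omega> *\<^sub>R v s) = - S t (W s)" for t s
  proof -
    note lin = linear_diff[OF unitary_linear[OF group]] linear_scale[OF unitary_linear[OF group]]
      linear_add[OF unitary_linear[OF group]] linear_neg[OF unitary_linear[OF group]]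
    have add: "S (t - s) y = S t (S (- s) y)" for y using unitary_add[OF group, of t "- s" y] by simp
    have "exp (\<omega> * s) * exp (- \<omega> * s) = 1" by (simp flip: exp_add)
    then have "W s = - S (- s) (g s (v s)) + (\<omega> * exp (\<omega> * s)) *\<^sub>R u s"
      by (simp add: W_def G_def vE)
    moreover have "S (- s) (v s) = exp (\<omega> * s) *\<^sub>R u s"
      by (simp add: v_def unitary_inverse[OF group])
    ultimately have "W s = - S (- s) (g s (v s) - \<omega> *\<^sub>R v s)"
      by (simp add: lin)
    then show ?thesis unfolding add by (simp add: lin)
  qed
  have volterra: "set_integrable lebesgue {0..t} (\<lambda>s. S (t - s) (g s (v s) - \<omega> *\<^sub>R v s)) \<and>
      v t = S t (v 0) - (LINT s:{0..t}|lebesgue. S (t - s) (g s (v s) - \<omega> *\<^sub>R v s))" if t: "t \<in> {0..T}" for t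
  proof -
    have bl: "bounded_linear (\<lambda>y. - S t y)"
      by (rule bounded_linear_minus[OF bounded_linear_unitary[OF group]])
    note W = ac_path_integral[OF Wp t]
    have "(LINT s:{0..t}|lebesgue. - S t (W s)) = - S t (exp (\<omega> * t) *\<^sub>R u t - u 0)"
      using set_integral_bounded_linear(2)[OF bl W(1)] W(2) by simp
    also have "\<dots> = S t (v 0) - v t"
      by (simp add: linear_diff[OF unitary_linear[OF group]] v_def unitary_zero[OF group])
    finally show ?thesis
      using set_integral_bounded_linear(1)[OF bl W(1)] unfolding SW by simp
  qed
  \<comment> \<open>Running the group and the exponential back from time \<open>T\<close> returns
    \<open>u T\<close>, so the boundary condition for \<open>v\<close> is the one that
    \<open>x0\<close> was chosen to satisfy.\<close>
  have rewind: "S (- T) (exp (- \<omega> * T) *\<^sub>R v T) = P x0"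
  proof -
    have "exp (- \<omega> * T) * exp (\<omega> * T) = 1" by (simp flip: exp_add)
    then show ?thesis
      by (simp add: v_def uT linear_scale[OF unitary_linear[OF group]] unitary_inverse[OF group])
  qed
  have boundary: "(v 0 + S (- T) (exp (- \<omega> * T) *\<^sub>R v T)) /\<^sub>R 2
      \<in> uminus ` subdifferential \<psi> (v 0 - S (- T) (exp (- \<omega> * T) *\<^sub>R v T))"
    unfolding rewind v0 using x0 by (intro image_eqI[of _ _ "- ((x0 + P x0) /\<^sub>R 2)"]) auto
  show ?thesis
    unfolding Let_def
  proof (intro bexI[OF _ uA] conjI)
    show "path_functional T \<omega> S \<phi> \<psi> u = (INF x\<in>A2_paths T. path_functional T \<omega> S \<phi> \<psi> x)"
      by (simp only: zero inf)
    show "\<exists>g. (\<forall>s\<in>{0..T}. subdifferential (\<phi> s) (S s (exp (\<omega> * s) *\<^sub>R u s)) = {g s}) \<and>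
        (\<forall>t\<in>{0..T}.
           set_integrable lebesgue {0..t}
             (\<lambda>s. S (t - s) (g s - \<omega> *\<^sub>R S s (exp (\<omega> * s) *\<^sub>R u s))) \<and>
           S t (exp (\<omega> * t) *\<^sub>R u t) = S t (S 0 (exp (\<omega> * 0) *\<^sub>R u 0)) -
             (LINT s:{0..t}|lebesgue. S (t - s) (g s - \<omega> *\<^sub>R S s (exp (\<omega> * s) *\<^sub>R u s))))"
      unfolding v_def[symmetric]
      by (intro exI[of _ "\<lambda>s. g s (v s)"] conjI ballI)
        (rule subd volterra[THEN conjunct1] volterra[THEN conjunct2]; assumption)+
    show "(S 0 (exp (\<omega> * 0) *\<^sub>R u 0) + S (- T) (exp (- \<omega> * T) *\<^sub>R S T (exp (\<omega> * T) *\<^sub>R u T))) /\<^sub>R 2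
        \<in> uminus ` subdifferential \<psi>
            (S 0 (exp (\<omega> * 0) *\<^sub>R u 0) - S (- T) (exp (- \<omega> * T) *\<^sub>R S T (exp (\<omega> * T) *\<^sub>R u T)))"
      unfolding v_def[symmetric] by (rule boundary)
  qed (rule inf)
qed

end
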